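(* Let $A$ and $B$ be quadratic $\mathbb K$-algebras and let $\tau: B\otimes A\to A\otimes B$ be a graded twisting map. Then $\tau$ has the unique extension property if and only if the twisted tensor product algebra $A\otimes_\tau B$ is quadratic.
   Context: $\mathbb K$ is a field, $\otimes=\otimes_{\mathbb K}$, $\mathbb N=\{0,1,2,\dots\}$. All graded algebras are $\mathbb N$-graded associative unital $\mathbb K$-algebras which are connected ($A_0=\mathbb K 1_A$) and locally finite dimensional ($\dim A_i<\infty$ for all $i$). $\mu_A$ is the multiplication of $A$; $1_A$ also denotes the identity map of $A$. Tensor products of graded spaces are graded by $(V\otimes W)_m=\bigoplus_{k+l=m}V_k\otimes W_l$ (similarly for more factors). A linear map is graded if it preserves degree; $f_n$ denotes its degree $n$ component and $f_{\le n}=\bigoplus_{i\le n}f_i$. A graded algebra $A$ is one-generated if the canonical map $\pi: T(A_1)\to A$ is surjective; it is quadratic if it is one-generated and $\ker\pi$ is generated as a two-sided ideal by $\ker\pi\cap (A_1\otimes A_1)$. A graded twisting map is a graded linear map $\tau:B\otimes A\to A\otimes B$ with $\tau(1_B\otimes a)=a\otimes 1_B$, $\tau(b\otimes 1_A)=1_A\otimes b$ for all $a\in A,b\in B$, and $$\tau(\mu_B\otimes\mu_A)=(\mu_A\otimes\mu_B)(1_A\otimes\tau\otimes 1_B)(\tau\otimes\tau)(1_B\otimes\tau\otimes 1_A)$$ on $B\otimes B\otimes A\otimes A$. Then $A\otimes_\tau B$ is the graded associative algebra with underlying space $A\otimes B$ and multiplication $(\mu_A\otimes\mu_B)(1_A\otimes\tau\otimes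 1_B)$. A graded linear map $t:(B\otimes A)_{\le n}\to(A\otimes B)_{\le n}$ is graded twisting to degree $n$ if for each $i\le n$: $t(1_B\otimes a)=a\otimes 1_B$ and $t(b\otimes 1_A)=1_A\otimes b$ for $a\in A_i$, $b\in B_i$, and $t_i(\mu_B\otimes\mu_A)=(\mu_A\otimes\mu_B)(1_A\otimes t_{\le i}\otimes 1_B)(t_{\le i}\otimes t_{\le i})(1_B\otimes t_{\le i}\otimes 1_A)$ on $(B\otimes B\otimes A\otimes A)_i$. A graded linear map $B\otimes A\to A\otimes B$ is graded twisting to degree $n$ if its restriction to $(B\otimes A)_{\le n}$ is. A graded twisting map $\tau$ has the unique extension property if for every $n\ge 3$ and every graded linear map $\tau':B\otimes A\to A\otimes B$ that is graded twisting to degree $n$ and satisfies $\tau'_i=\tau_i$ for all $i<n$, one has $\tau'_n=\tau_n$. *)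

theory Defs
  imports Complex_Main "HOL-Library.Function_Algebras"
begin

text \<open>
  The ground field is a type \<open>'k::field\<close>. A vector space is a subspace of an ambient type
  \<open>'v::ab_group_add\<close> on which a scalar multiplication satisfies the library locale
  \<^locale>\<open>vector_space\<close>; so any vector space can be used as its own ambient type, and tensor
  products live in function types. Linear maps are HOL functions of which only the values
  on the relevant subspace matter.
\<close>

section \<open>Graded vector spaces and linear maps\<close>

record ('k, 'v) gspace =
  smul :: "'k \<Rightarrow> 'v \<Rightarrow> 'v"
  gr :: "nat \<Rightarrow> 'v set"

definition carr :: "('k::field, 'v::ab_group_add, 'm) gspace_scheme \<Rightarrow> 'v set" where
  "carr V = module.span (smul V) (\<Union>n. gr V n)"

definition graded_space :: "('k::field, 'v::ab_group_add, 'm) gspace_scheme \<Rightarrow> bool" where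
  "graded_space V \<longleftrightarrow>
     vector_space (smul V) \<and>
     (\<forall>n. module.subspace (smul V) (gr V n)) \<and>
     (\<forall>c. (\<forall>i. c i \<in> gr V i) \<and> finite {i. c i \<noteq> 0} \<and> (\<Sum>i | c i \<noteq> 0. c i) = 0
        \<longrightarrow> (\<forall>i. c i = 0))"

definition hcomp :: "('k::field, 'v::ab_group_add, 'm) gspace_scheme \<Rightarrow> nat \<Rightarrow> 'v \<Rightarrow> 'v" where
  "hcomp V n x =
     (THE c. (\<forall>i. c i \<in> gr V i) \<and> finite {i. c i \<noteq> 0} \<and> x = (\<Sum>i | c i \<noteq> 0. c i)) n"

definition linear_on ::
  "('k::field \<Rightarrow> 'v::ab_group_add \<Rightarrow> 'v) \<Rightarrow> 'v set \<Rightarrow> ('k \<Rightarrow> 'x::ab_group_add \<Rightarrow> 'x) \<Rightarrow> ('v \<Rightarrow> 'x) \<Rightarrow> bool"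
  where
  "linear_on s U s' f \<longleftrightarrow>
     (\<forall>x\<in>U. \<forall>y\<in>U. f (x + y) = f x + f y) \<and> (\<forall>c. \<forall>x\<in>U. f (s c x) = s' c (f x))"

definition graded_linear ::
  "('k::field, 'v::ab_group_add, 'm) gspace_scheme \<Rightarrow> ('k, 'x::ab_group_add, 'n) gspace_scheme \<Rightarrow>
     ('v \<Rightarrow> 'x) \<Rightarrow> bool" where
  "graded_linear V X f \<longleftrightarrow>
     linear_on (smul V) (carr V) (smul X) f \<and> (\<forall>n. \<forall>x\<in>gr V n. f x \<in> gr X n)"

definition bilinear_on ::
  "('k::field, 'v::ab_group_add, 'm) gspace_scheme \<Rightarrow> ('k, 'w::ab_group_add, 'n) gspace_scheme \<Rightarrow>
     ('k \<Rightarrow> 'x::ab_group_add \<Rightarrow> 'x) \<Rightarrow> ('v \<Rightarrow> 'w \<Rightarrow> 'x) \<Rightarrow> bool" where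
  "bilinear_on V W s h \<longleftrightarrow>
     (\<forall>w\<in>carr W. linear_on (smul V) (carr V) s (\<lambda>v. h v w)) \<and>
     (\<forall>v\<in>carr V. linear_on (smul W) (carr W) s (\<lambda>w. h v w))"

text \<open>The subspace $V_{\le n}$.\<close>

definition upto_deg :: "nat \<Rightarrow> ('k, 'v::zero, 'm) gspace_scheme \<Rightarrow> ('k, 'v) gspace" where
  "upto_deg n V = \<lparr>smul = smul V, gr = (\<lambda>i. if i \<le> n then gr V i else {0})\<rparr>"

text \<open>
  The map $f_{\le n}$ on $V_{\le n}$, extended by zero to all of $V$. Only the values of
  \<open>f\<close> on $V_{\le n}$ are used.
\<close>

definition map_upto ::
  "('k::field, 'v::ab_group_add, 'm) gspace_scheme \<Rightarrow> nat \<Rightarrow> ('v \<Rightarrow> 'x::comm_monoid_add) \<Rightarrow> 'v \<Rightarrow> 'x"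
  where
  "map_upto V n f x = (\<Sum>i\<le>n. f (hcomp V i x))"

section \<open>Tensor products\<close>

text \<open>
  Over a field the canonical map from $V \otimes W$ to the dual of the space of bilinear forms
  on $V \times W$ is injective, and $V \otimes W$ is taken to be its image: $v \otimes w$ is
  evaluation of bilinear forms at $(v, w)$. The universal property is \<open>tensor_universal\<close> below.
\<close>

definition fun_scale :: "'k::field \<Rightarrow> ('f \<Rightarrow> 'k) \<Rightarrow> 'f \<Rightarrow> 'k" where
  "fun_scale c x = (\<lambda>\<beta>. c * x \<beta>)"

definition tens ::
  "('k::field, 'v::ab_group_add, 'm) gspace_scheme \<Rightarrow> ('k, 'w::ab_group_add, 'n) gspace_scheme \<Rightarrow>
     'v \<Rightarrow> 'w \<Rightarrow> ('v \<Rightarrow> 'w \<Rightarrow> 'k) \<Rightarrow> 'k" where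
  "tens V W v w = (\<lambda>\<beta>. if bilinear_on V W (*) \<beta> then \<beta> v w else 0)"

definition tprod ::
  "('k::field, 'v::ab_group_add, 'm) gspace_scheme \<Rightarrow> ('k, 'w::ab_group_add, 'n) gspace_scheme \<Rightarrow>
     ('k, ('v \<Rightarrow> 'w \<Rightarrow> 'k) \<Rightarrow> 'k) gspace"  (infixr \<open>\<otimes>\<close> 70) where
  "V \<otimes> W =
     \<lparr>smul = fun_scale,
      gr = (\<lambda>m. module.span fun_scale
             {tens V W v w | v w k l. v \<in> gr V k \<and> w \<in> gr W l \<and> k + l = m})\<rparr>"

text \<open>
  The linear map on $V \otimes W$ with values in \<open>X\<close> induced by a bilinear map \<open>h\<close>; it is
  unique on the carrier.
\<close>

definition tlift ::
  "('k::field, 'v::ab_group_add, 'm) gspace_scheme \<Rightarrow> ('k, 'w::ab_group_add, 'n) gspace_scheme \<Rightarrow>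
     ('k, 'x::ab_group_add, 'p) gspace_scheme \<Rightarrow> ('v \<Rightarrow> 'w \<Rightarrow> 'x) \<Rightarrow> (('v \<Rightarrow> 'w \<Rightarrow> 'k) \<Rightarrow> 'k) \<Rightarrow> 'x"
  where
  "tlift V W X h =
     (SOME L. linear_on (smul (V \<otimes> W)) (carr (V \<otimes> W)) (smul X) L \<and>
        (\<forall>v\<in>carr V. \<forall>w\<in>carr W. L (tens V W v w) = h v w))"

text \<open>$f \otimes g : V \otimes W \to V' \otimes W'$.\<close>

definition tmap where
  "tmap V W V' W' f g = tlift V W (V' \<otimes> W') (\<lambda>v w. tens V' W' (f v) (g w))"

text \<open>
  The rebracketing isomorphism
  $(U \otimes V) \otimes (W \otimes X) \to U \otimes ((V \otimes W) \otimes X)$ and its inverse.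
\<close>

definition rebracket where
  "rebracket U V W X =
     (let Y = U \<otimes> ((V \<otimes> W) \<otimes> X) in
      tlift (U \<otimes> V) (W \<otimes> X) Y (\<lambda>p q.
        tlift U V Y (\<lambda>u v.
          tlift W X Y (\<lambda>w x.
            tens U ((V \<otimes> W) \<otimes> X) u (tens (V \<otimes> W) X (tens V W v w) x)) q) p))"

definition unrebracket where
  "unrebracket U V W X =
     (let Y = (U \<otimes> V) \<otimes> (W \<otimes> X) in
      tlift U ((V \<otimes> W) \<otimes> X) Y (\<lambda>u r.
        tlift (V \<otimes> W) X Y (\<lambda>s x.
          tlift V W Y (\<lambda>v w.
            tens (U \<otimes> V) (W \<otimes> X) (tens U V u v) (tens W X w x)) s) r))"

text \<open>
  The map $1_U \otimes f \otimes 1_X : U \otimes V \otimes W \otimes X \to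
  U \otimes V' \otimes W' \otimes X$ for $f : V \otimes W \to V' \otimes W'$, where all
  fourfold tensor products are bracketed as two by two.
\<close>

definition mid_map where
  "mid_map U V W X V' W' f =
     unrebracket U V' W' X \<circ>
     tmap U ((V \<otimes> W) \<otimes> X) U ((V' \<otimes> W') \<otimes> X) id (tmap (V \<otimes> W) X (V' \<otimes> W') X f id) \<circ>
     rebracket U V W X"

section \<open>Graded algebras\<close>

record ('k, 'v) galgebra = "('k, 'v) gspace" +
  mul :: "'v \<Rightarrow> 'v \<Rightarrow> 'v"
  one :: 'v

definition graded_algebra :: "('k::field, 'v::ab_group_add, 'm) galgebra_scheme \<Rightarrow> bool" where
  "graded_algebra A \<longleftrightarrow>
     graded_space A \<and>
     bilinear_on A A (smul A) (mul A) \<and>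
     (\<forall>m n. \<forall>x\<in>gr A m. \<forall>y\<in>gr A n. mul A x y \<in> gr A (m + n)) \<and>
     (\<forall>x\<in>carr A. \<forall>y\<in>carr A. \<forall>z\<in>carr A. mul A (mul A x y) z = mul A x (mul A y z)) \<and>
     (\<forall>x\<in>carr A. mul A (one A) x = x \<and> mul A x (one A) = x) \<and>
     gr A 0 = range (\<lambda>c. smul A c (one A)) \<and>
     (\<forall>n. \<exists>S. finite S \<and> gr A n = module.span (smul A) S)"

text \<open>The multiplication as a linear map $A \otimes A \to A$.\<close>

definition mu :: "('k::field, 'v::ab_group_add, 'm) galgebra_scheme \<Rightarrow> (('v \<Rightarrow> 'v \<Rightarrow> 'k) \<Rightarrow> 'k) \<Rightarrow> 'v"
  where
  "mu A = tlift A A A (mul A)"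

subsection \<open>Tensor algebra and quadratic algebras\<close>

text \<open>
  The tensor algebra of a vector space \<open>U\<close>, modelled like the binary tensor product:
  \<open>word s U [u\<^sub>1, \<dots>, u\<^sub>n]\<close> is $u_1 \otimes \dots \otimes u_n$, evaluation at
  \<open>[u\<^sub>1, \<dots>, u\<^sub>n]\<close> of the functions on lists that are multilinear on lists of each length.
\<close>

definition multilinear_form ::
  "('k::field \<Rightarrow> 'v::ab_group_add \<Rightarrow> 'v) \<Rightarrow> 'v set \<Rightarrow> ('v list \<Rightarrow> 'k) \<Rightarrow> bool" where
  "multilinear_form s U \<phi> \<longleftrightarrow>
     (\<forall>xs\<in>lists U. \<forall>ys\<in>lists U. linear_on s U (*) (\<lambda>u. \<phi> (xs @ u # ys)))"

definition word ::
  "('k::field \<Rightarrow> 'v::ab_group_add \<Rightarrow> 'v) \<Rightarrow> 'v set \<Rightarrow> 'v list \<Rightarrow> ('v list \<Rightarrow> 'k) \<Rightarrow> 'k" where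
  "word s U xs = (\<lambda>\<phi>. if multilinear_form s U \<phi> then \<phi> xs else 0)"

text \<open>The multiplication is concatenation of words, see \<open>tensor_algebra_mul_word\<close> below.\<close>

definition tensor_algebra ::
  "('k::field \<Rightarrow> 'v::ab_group_add \<Rightarrow> 'v) \<Rightarrow> 'v set \<Rightarrow> ('k, ('v list \<Rightarrow> 'k) \<Rightarrow> 'k) galgebra" where
  "tensor_algebra s U =
     \<lparr>smul = fun_scale,
      gr = (\<lambda>n. module.span fun_scale {word s U xs | xs. xs \<in> lists U \<and> length xs = n}),
      mul = (\<lambda>x y \<phi>. if multilinear_form s U \<phi> then x (\<lambda>xs. y (\<lambda>ys. \<phi> (xs @ ys))) else 0),
      one = word s U []\<rparr>"

abbreviation T1 :: "('k::field, 'v::ab_group_add, 'm) galgebra_scheme \<Rightarrow>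
    ('k, ('v list \<Rightarrow> 'k) \<Rightarrow> 'k) galgebra" where
  "T1 A \<equiv> tensor_algebra (smul A) (gr A 1)"

text \<open>The canonical map $\pi : T(A_1) \to A$.\<close>

definition tcanon ::
  "('k::field, 'v::ab_group_add, 'm) galgebra_scheme \<Rightarrow> (('v list \<Rightarrow> 'k) \<Rightarrow> 'k) \<Rightarrow> 'v" where
  "tcanon A =
     (SOME L. linear_on (smul (T1 A)) (carr (T1 A)) (smul A) L \<and>
        (\<forall>xs\<in>lists (gr A 1). L (word (smul A) (gr A 1) xs) = foldr (mul A) xs (one A)))"

definition two_sided_ideal ::
  "('k::field, 'v::ab_group_add, 'm) galgebra_scheme \<Rightarrow> 'v set \<Rightarrow> bool" where
  "two_sided_ideal R I \<longleftrightarrow>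
     module.subspace (smul R) I \<and> I \<subseteq> carr R \<and>
     (\<forall>r\<in>carr R. \<forall>x\<in>I. mul R r x \<in> I \<and> mul R x r \<in> I)"

definition ideal_generated ::
  "('k::field, 'v::ab_group_add, 'm) galgebra_scheme \<Rightarrow> 'v set \<Rightarrow> 'v set" where
  "ideal_generated R S = \<Inter>{I. two_sided_ideal R I \<and> S \<subseteq> I}"

definition tcanon_kernel ::
  "('k::field, 'v::ab_group_add, 'm) galgebra_scheme \<Rightarrow> (('v list \<Rightarrow> 'k) \<Rightarrow> 'k) set" where
  "tcanon_kernel A = {x \<in> carr (T1 A). tcanon A x = 0}"

definition one_generated :: "('k::field, 'v::ab_group_add, 'm) galgebra_scheme \<Rightarrow> bool" where
  "one_generated A \<longleftrightarrow> graded_algebra A \<and> tcanon A ` carr (T1 A) = carr A"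

definition quadratic :: "('k::field, 'v::ab_group_add, 'm) galgebra_scheme \<Rightarrow> bool" where
  "quadratic A \<longleftrightarrow>
     one_generated A \<and>
     tcanon_kernel A = ideal_generated (T1 A) (tcanon_kernel A \<inter> gr (T1 A) 2)"

section \<open>Twisting maps\<close>

text \<open>
  The composite
  $(\mu_A \otimes \mu_B)(1_A \otimes t \otimes 1_B)(t \otimes t)(1_B \otimes t \otimes 1_A)$
  on $B \otimes B \otimes A \otimes A$.
\<close>

definition twist_rhs where
  "twist_rhs A B t =
     tmap (A \<otimes> A) (B \<otimes> B) A B (mu A) (mu B) \<circ>
     mid_map A B A B A B t \<circ>
     tmap (B \<otimes> A) (B \<otimes> A) (A \<otimes> B) (A \<otimes> B) t t \<circ>
     mid_map B B A A A B t"

definition graded_twisting ::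
  "('k::field, 'a::ab_group_add, 'm) galgebra_scheme \<Rightarrow> ('k, 'b::ab_group_add, 'n) galgebra_scheme \<Rightarrow>
     ((('b \<Rightarrow> 'a \<Rightarrow> 'k) \<Rightarrow> 'k) \<Rightarrow> ('a \<Rightarrow> 'b \<Rightarrow> 'k) \<Rightarrow> 'k) \<Rightarrow> bool" where
  "graded_twisting A B \<tau> \<longleftrightarrow>
     graded_linear (B \<otimes> A) (A \<otimes> B) \<tau> \<and>
     (\<forall>a\<in>carr A. \<tau> (tens B A (one B) a) = tens A B a (one B)) \<and>
     (\<forall>b\<in>carr B. \<tau> (tens B A b (one A)) = tens A B (one A) b) \<and>
     (\<forall>x\<in>carr ((B \<otimes> B) \<otimes> (A \<otimes> A)).
        \<tau> (tmap (B \<otimes> B) (A \<otimes> A) B A (mu B) (mu A) x) = twist_rhs A B \<tau> x)"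

text \<open>
  Only the values of \<open>t\<close> on $(B \otimes A)_{\le n}$ matter, so for
  $t : B \otimes A \to A \otimes B$ this is the condition on its restriction.
\<close>

definition graded_twisting_to ::
  "('k::field, 'a::ab_group_add, 'm) galgebra_scheme \<Rightarrow> ('k, 'b::ab_group_add, 'n) galgebra_scheme \<Rightarrow>
     nat \<Rightarrow> ((('b \<Rightarrow> 'a \<Rightarrow> 'k) \<Rightarrow> 'k) \<Rightarrow> ('a \<Rightarrow> 'b \<Rightarrow> 'k) \<Rightarrow> 'k) \<Rightarrow> bool" where
  "graded_twisting_to A B n t \<longleftrightarrow>
     graded_linear (upto_deg n (B \<otimes> A)) (upto_deg n (A \<otimes> B)) t \<and>
     (\<forall>i\<le>n.
        (\<forall>a\<in>gr A i. t (tens B A (one B) a) = tens A B a (one B)) \<and>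
        (\<forall>b\<in>gr B i. t (tens B A b (one A)) = tens A B (one A) b) \<and>
        (\<forall>x\<in>gr ((B \<otimes> B) \<otimes> (A \<otimes> A)) i.
           t (tmap (B \<otimes> B) (A \<otimes> A) B A (mu B) (mu A) x)
             = twist_rhs A B (map_upto (B \<otimes> A) i t) x))"

definition unique_extension ::
  "('k::field, 'a::ab_group_add, 'm) galgebra_scheme \<Rightarrow> ('k, 'b::ab_group_add, 'n) galgebra_scheme \<Rightarrow>
     ((('b \<Rightarrow> 'a \<Rightarrow> 'k) \<Rightarrow> 'k) \<Rightarrow> ('a \<Rightarrow> 'b \<Rightarrow> 'k) \<Rightarrow> 'k) \<Rightarrow> bool" where
  "unique_extension A B \<tau> \<longleftrightarrow>
     (\<forall>n\<ge>3. \<forall>\<tau>'.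
        graded_linear (B \<otimes> A) (A \<otimes> B) \<tau>' \<and> graded_twisting_to A B n \<tau>' \<and>
        (\<forall>i<n. \<forall>x\<in>gr (B \<otimes> A) i. \<tau>' x = \<tau> x)
        \<longrightarrow> (\<forall>x\<in>gr (B \<otimes> A) n. \<tau>' x = \<tau> x))"

text \<open>The algebra $A \otimes_\tau B$.\<close>

definition twisted_tensor ::
  "('k::field, 'a::ab_group_add, 'm) galgebra_scheme \<Rightarrow> ('k, 'b::ab_group_add, 'n) galgebra_scheme \<Rightarrow>
     ((('b \<Rightarrow> 'a \<Rightarrow> 'k) \<Rightarrow> 'k) \<Rightarrow> ('a \<Rightarrow> 'b \<Rightarrow> 'k) \<Rightarrow> 'k) \<Rightarrow>
     ('k, ('a \<Rightarrow> 'b \<Rightarrow> 'k) \<Rightarrow> 'k) galgebra" where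
  "twisted_tensor A B \<tau> =
     \<lparr>smul = smul (A \<otimes> B),
      gr = gr (A \<otimes> B),
      mul = (\<lambda>x y. (tmap (A \<otimes> A) (B \<otimes> B) A B (mu A) (mu B) \<circ> mid_map A B A B A B \<tau>)
                     (tens (A \<otimes> B) (A \<otimes> B) x y)),
      one = tens A B (one A) (one B)\<rparr>"


section \<open>Universal properties\<close>

lemma vector_space_fun_scale: "vector_space fun_scale"
  by unfold_locales (auto simp: fun_scale_def algebra_simps)

lemma eval_lift:
  fixes sX :: "'k::field \<Rightarrow> 'x::ab_group_add \<Rightarrow> 'x" and e :: "'i \<Rightarrow> 'f \<Rightarrow> 'k" and h :: "'i \<Rightarrow> 'x"
  assumes X: "vector_space sX"
    and P: "\<And>\<xi>. Vector_Spaces.linear sX (*) \<xi> \<Longrightarrow> \<exists>\<beta>. \<forall>i\<in>I. e i \<beta> = \<xi> (h i)"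
  shows "\<exists>L. Vector_Spaces.linear fun_scale sX L \<and> (\<forall>i\<in>I. L (e i) = h i)"
proof -
  interpret F: vector_space "fun_scale :: 'k \<Rightarrow> ('f \<Rightarrow> 'k) \<Rightarrow> _" by (rule vector_space_fun_scale)
  interpret X: vector_space sX by fact
  interpret K: vector_space "(*) :: 'k \<Rightarrow> 'k \<Rightarrow> 'k"
    by unfold_locales (auto simp: algebra_simps)
  interpret FX: vector_space_pair "fun_scale :: 'k \<Rightarrow> ('f \<Rightarrow> 'k) \<Rightarrow> _" sX ..
  interpret XK: vector_space_pair sX "(*) :: 'k \<Rightarrow> 'k \<Rightarrow> 'k" ..
  obtain B where B: "B \<subseteq> e ` I" "F.independent B" "e ` I \<subseteq> F.span B"
    using F.maximal_independent_subset[of "e ` I"] by blast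
  define r where "r b = (SOME i. i \<in> I \<and> e i = b)" for b
  have r: "r b \<in> I" "e (r b) = b" if "b \<in> B" for b
    using someI_ex[of "\<lambda>i. i \<in> I \<and> e i = b"] that B(1) unfolding r_def by auto
  obtain L where L: "Vector_Spaces.linear fun_scale sX L" "\<forall>b\<in>B. L b = h (r b)"
    using FX.linear_independent_extend[OF B(2), of "\<lambda>b. h (r b)"] by blast
  interpret L: Vector_Spaces.linear fun_scale sX L by fact
  have "L (e i) = h i" if i: "i \<in> I" for i
  proof (rule ccontr)
    assume ne: "L (e i) \<noteq> h i"
    have "e i \<in> F.span B" using B(3) i by blast
    then obtain t c where t: "finite t" "t \<subseteq> B" "e i = (\<Sum>b\<in>t. fun_scale (c b) b)"
      unfolding F.span_explicit by blast
    have "X.independent {h i - L (e i)}"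
      using ne X.independent_insert[of "h i - L (e i)" "{}"] by (simp add: X.independent_empty)
    then obtain \<xi> where \<xi>: "Vector_Spaces.linear sX (*) \<xi>" "\<xi> (h i - L (e i)) = 1"
      using XK.linear_independent_extend[of "{h i - L (e i)}" "\<lambda>_. 1"] by auto
    interpret \<xi>: Vector_Spaces.linear sX "(*)" \<xi> by fact
    obtain \<beta> where \<beta>: "\<forall>j\<in>I. e j \<beta> = \<xi> (h j)" using P[OF \<xi>(1)] by blast
    have ev: "(\<Sum>b\<in>t. fun_scale (c b) b) \<beta> = (\<Sum>b\<in>t. c b * b \<beta>)" using t(1)
      by (induction t rule: finite_induct) (auto simp: fun_scale_def)
    have "\<xi> (h i) = (\<Sum>b\<in>t. c b * b \<beta>)" using \<beta> i t(3) ev by metis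
    also have "\<dots> = (\<Sum>b\<in>t. c b * \<xi> (h (r b)))"
      using t(2) r \<beta> by (intro sum.cong refl) (metis subsetD)
    also have "\<dots> = \<xi> (\<Sum>b\<in>t. sX (c b) (L b))"
      using t(2) L(2) by (simp add: \<xi>.sum \<xi>.scale subset_iff)
    also have "\<dots> = \<xi> (L (e i))" unfolding t(3) by (simp add: L.sum L.scale)
    finally show False using \<xi>(2) by (simp add: \<xi>.diff)
  qed
  with L show ?thesis by blast
qed

lemma linear_on_span_unique:
  fixes s :: "'k::field \<Rightarrow> 'v::ab_group_add \<Rightarrow> 'v" and sX :: "'k \<Rightarrow> 'x::ab_group_add \<Rightarrow> 'x"
  assumes s: "vector_space s" and X: "vector_space sX"
    and f: "linear_on s (module.span s S) sX f" and g: "linear_on s (module.span s S) sX g"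
    and eq: "\<And>x. x \<in> S \<Longrightarrow> f x = g x" and x: "x \<in> module.span s S"
  shows "f x = g x"
proof -
  interpret V: vector_space s by fact
  interpret X: vector_space sX by fact
  have "x \<in> V.span S \<and> f x = g x" using x
  proof (induction rule: V.span_induct_alt)
    case base
    have "f (s 0 0) = sX 0 (f 0)" "g (s 0 0) = sX 0 (g 0)"
      using f g V.span_zero[of S] unfolding linear_on_def by blast+
    then show ?case by (simp add: V.span_zero)
  next
    case (step c x y)
    have a: "x \<in> V.span S" "s c x \<in> V.span S" "y \<in> V.span S"
      using step by (auto intro: V.span_base V.span_scale)
    have "f (s c x + y) = sX c (f x) + f y" "g (s c x + y) = sX c (g x) + g y"
      using f g a unfolding linear_on_def by metis+
    with step eq a show ?case by (simp add: V.span_add)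
  qed
  then show ?thesis ..
qed

lemma carr_tprod:
  fixes V :: "('k::field, 'v::ab_group_add, 'm) gspace_scheme"
    and W :: "('k, 'w::ab_group_add, 'n) gspace_scheme"
  assumes V: "graded_space V" and W: "graded_space W"
  shows "carr (V \<otimes> W) = module.span fun_scale {tens V W v w | v w. v \<in> carr V \<and> w \<in> carr W}"
    (is "_ = module.span _ ?G")
proof -
  interpret F: vector_space "fun_scale :: 'k \<Rightarrow> (('v \<Rightarrow> 'w \<Rightarrow> 'k) \<Rightarrow> 'k) \<Rightarrow> _"
    by (rule vector_space_fun_scale)
  interpret V: vector_space "smul V" using V by (simp add: graded_space_def)
  interpret W: vector_space "smul W" using W by (simp add: graded_space_def)
  let ?H = "\<Union>m. {tens V W v w | v w k l. v \<in> gr V k \<and> w \<in> gr W l \<and> k + l = m}"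
  have cV: "v \<in> carr V" if "v \<in> gr V k" for v k
    using that unfolding carr_def by (auto intro: V.span_base)
  have cW: "w \<in> carr W" if "w \<in> gr W k" for w k
    using that unfolding carr_def by (auto intro: W.span_base)
  have add1: "tens V W (x + y) w = tens V W x w + tens V W y w"
    "tens V W (smul V c x) w = fun_scale c (tens V W x w)"
    if "x \<in> carr V" "y \<in> carr V" "w \<in> carr W" for x y w c
    using that by (auto simp: tens_def fun_scale_def fun_eq_iff bilinear_on_def linear_on_def)
  have add2: "tens V W v (x + y) = tens V W v x + tens V W v y"
    "tens V W v (smul W c x) = fun_scale c (tens V W v x)"
    if "x \<in> carr W" "y \<in> carr W" "v \<in> carr V" for x y v c
    using that by (auto simp: tens_def fun_scale_def fun_eq_iff bilinear_on_def linear_on_def)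
  have z1: "tens V W 0 w = 0" if "w \<in> carr W" for w
    using add1(2)[of 0 0 w 0] that V.span_zero by (simp add: carr_def)
  have z2: "tens V W v 0 = 0" if "v \<in> carr V" for v
    using add2(2)[of 0 0 v 0] that W.span_zero by (simp add: carr_def)
  have st1: "tens V W v w \<in> F.span ?H" if v: "v \<in> carr V" and w: "w \<in> gr W l" for v w l
  proof -
    have "v \<in> carr V \<and> tens V W v w \<in> F.span ?H" using v unfolding carr_def[of V]
    proof (induction rule: V.span_induct_alt)
      case base
      show ?case using z1[OF cW[OF w]] V.span_zero F.span_zero by (metis (no_types, lifting))
    next
      case (step c x y)
      then obtain k where k: "x \<in> gr V k" by blast
      have yc: "y \<in> carr V" using step by (simp add: carr_def)
      have "tens V W x w \<in> F.span ?H" using k w by (intro F.span_base) blast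
      moreover have "tens V W (smul V c x + y) w = fun_scale c (tens V W x w) + tens V W y w"
        using add1 cV[OF k] yc cW[OF w] V.subspace_span V.span_scale by (metis carr_def)
      moreover have "smul V c x + y \<in> carr V"
        using cV[OF k] yc by (simp add: carr_def V.span_add V.span_scale)
      ultimately have "tens V W (smul V c x + y) w \<in> F.span ?H"
        using conjunct2[OF step.IH] by (metis (no_types, lifting) F.span_add F.span_scale)
      with \<open>smul V c x + y \<in> carr V\<close> show ?case by (simp only: carr_def simp_thms)
    qed
    then show ?thesis ..
  qed
  have st2: "tens V W v w \<in> F.span ?H" if v: "v \<in> carr V" and w: "w \<in> carr W" for v w
  proof -
    have "w \<in> carr W \<and> tens V W v w \<in> F.span ?H" using w unfolding carr_def[of W]
    proof (induction rule: W.span_induct_alt)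
      case base
      show ?case using z2[OF v] W.span_zero F.span_zero by (metis (no_types, lifting))
    next
      case (step c x y)
      then obtain k where k: "x \<in> gr W k" by blast
      have yc: "y \<in> carr W" using step by (simp add: carr_def)
      have "tens V W v (smul W c x + y) = fun_scale c (tens V W v x) + tens V W v y"
        using add2 cW[OF k] yc v W.span_scale by (metis carr_def)
      moreover have "smul W c x + y \<in> carr W"
        using cW[OF k] yc by (simp add: carr_def W.span_add W.span_scale)
      ultimately have "tens V W v (smul W c x + y) \<in> F.span ?H"
        using conjunct2[OF step.IH] st1[OF v k] by (metis (no_types, lifting) F.span_add F.span_scale)
      with \<open>smul W c x + y \<in> carr W\<close> show ?case by (simp only: carr_def simp_thms)
    qed
    then show ?thesis ..
  qed
  have "carr (V \<otimes> W) = F.span (\<Union>m. F.span {tens V W v w | v w k l. v \<in> gr V k \<and> w \<in> gr W l \<and> k + l = m})"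
    by (simp add: carr_def tprod_def)
  also have "\<dots> = F.span ?G"
  proof (rule equalityI)
    show "F.span (\<Union>m. F.span {tens V W v w | v w k l. v \<in> gr V k \<and> w \<in> gr W l \<and> k + l = m}) \<subseteq> F.span ?G"
    proof (rule F.span_minimal[OF _ F.subspace_span], rule UN_least)
      fix m
      show "F.span {tens V W v w | v w k l. v \<in> gr V k \<and> w \<in> gr W l \<and> k + l = m} \<subseteq> F.span ?G"
        by (rule F.span_mono) (use cV cW in blast)
    qed
    have "?H \<subseteq> (\<Union>m. F.span {tens V W v w | v w k l. v \<in> gr V k \<and> w \<in> gr W l \<and> k + l = m})"
      by (rule UN_mono[OF order.refl]) (rule F.span_superset)
    then have "F.span ?H \<subseteq> F.span (\<Union>m. F.span {tens V W v w | v w k l. v \<in> gr V k \<and> w \<in> gr W l \<and> k + l = m})"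
      by (rule F.span_mono)
    then show "F.span ?G \<subseteq> F.span (\<Union>m. F.span {tens V W v w | v w k l. v \<in> gr V k \<and> w \<in> gr W l \<and> k + l = m})"
      using st2 by (intro F.span_minimal[OF _ F.subspace_span]) blast
  qed
  finally show ?thesis .
qed

lemma tensor_universal:
  fixes V :: "('k::field, 'v::ab_group_add, 'm) gspace_scheme"
    and W :: "('k, 'w::ab_group_add, 'n) gspace_scheme"
    and X :: "('k, 'x::ab_group_add, 'p) gspace_scheme"
  assumes V: "graded_space V" and W: "graded_space W" and X: "vector_space (smul X)"
    and h: "bilinear_on V W (smul X) h"
  shows "linear_on (smul (V \<otimes> W)) (carr (V \<otimes> W)) (smul X) (tlift V W X h)"
    and "\<And>v w. v \<in> carr V \<Longrightarrow> w \<in> carr W \<Longrightarrow> tlift V W X h (tens V W v w) = h v w"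
    and "\<And>L x. linear_on (smul (V \<otimes> W)) (carr (V \<otimes> W)) (smul X) L \<Longrightarrow>
           (\<And>v w. v \<in> carr V \<Longrightarrow> w \<in> carr W \<Longrightarrow> L (tens V W v w) = h v w) \<Longrightarrow>
           x \<in> carr (V \<otimes> W) \<Longrightarrow> L x = tlift V W X h x"
proof -
  have "\<exists>L. Vector_Spaces.linear fun_scale (smul X) L \<and>
        (\<forall>i\<in>carr V \<times> carr W. L (tens V W (fst i) (snd i)) = h (fst i) (snd i))"
  proof (rule eval_lift[OF X, where h = "\<lambda>i. h (fst i) (snd i)" and e = "\<lambda>i. tens V W (fst i) (snd i)"])
    fix \<xi> assume "Vector_Spaces.linear (smul X) (*) \<xi>"
    then interpret \<xi>: Vector_Spaces.linear "smul X" "(*)" \<xi> .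
    have "bilinear_on V W (*) (\<lambda>v w. \<xi> (h v w))"
      using h by (simp add: bilinear_on_def linear_on_def \<xi>.add \<xi>.scale)
    then show "\<exists>\<beta>. \<forall>i\<in>carr V \<times> carr W. tens V W (fst i) (snd i) \<beta> = \<xi> (h (fst i) (snd i))"
      by (intro exI[of _ "\<lambda>v w. \<xi> (h v w)"]) (simp add: tens_def)
  qed
  then obtain L where L: "Vector_Spaces.linear fun_scale (smul X) L"
      "\<forall>v\<in>carr V. \<forall>w\<in>carr W. L (tens V W v w) = h v w" by auto
  interpret L: Vector_Spaces.linear fun_scale "smul X" L by (rule L(1))
  have "linear_on (smul (V \<otimes> W)) (carr (V \<otimes> W)) (smul X) L"
    by (simp add: linear_on_def tprod_def L.add L.scale)
  with L(2) have ex: "\<exists>L. linear_on (smul (V \<otimes> W)) (carr (V \<otimes> W)) (smul X) L \<and>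
      (\<forall>v\<in>carr V. \<forall>w\<in>carr W. L (tens V W v w) = h v w)" by blast
  from someI_ex[OF this]
  have 1: "linear_on (smul (V \<otimes> W)) (carr (V \<otimes> W)) (smul X) (tlift V W X h)"
    and 2: "\<forall>v\<in>carr V. \<forall>w\<in>carr W. tlift V W X h (tens V W v w) = h v w"
    unfolding tlift_def by blast+
  show "linear_on (smul (V \<otimes> W)) (carr (V \<otimes> W)) (smul X) (tlift V W X h)" by (rule 1)
  show "tlift V W X h (tens V W v w) = h v w" if "v \<in> carr V" "w \<in> carr W" for v w
    using 2 that by blast
  fix L x
  assume L: "linear_on (smul (V \<otimes> W)) (carr (V \<otimes> W)) (smul X) L"
    and eq: "\<And>v w. v \<in> carr V \<Longrightarrow> w \<in> carr W \<Longrightarrow> L (tens V W v w) = h v w"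
    and x: "x \<in> carr (V \<otimes> W)"
  have sm: "smul (V \<otimes> W) = fun_scale" by (simp add: tprod_def)
  show "L x = tlift V W X h x"
    by (rule linear_on_span_unique[OF vector_space_fun_scale X
          L[unfolded sm carr_tprod[OF V W]] 1[unfolded sm carr_tprod[OF V W]] _
          x[unfolded carr_tprod[OF V W]]]) (use eq 2 in auto)
qed

lemma hcomp_eq:
  fixes V :: "('k::field, 'v::ab_group_add, 'm) gspace_scheme"
  assumes V: "graded_space V" and c: "\<And>i. c i \<in> gr V i"
    and S: "finite S" "\<And>i. i \<notin> S \<Longrightarrow> c i = 0" and x: "x = (\<Sum>i\<in>S. c i)"
  shows "hcomp V n x = c n"
proof -
  interpret V: vector_space "smul V" using V by (simp add: graded_space_def)
  have sub: "V.subspace (gr V i)" for i using V by (simp add: graded_space_def)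
  let ?P = "\<lambda>c. (\<forall>i. c i \<in> gr V i) \<and> finite {i. c i \<noteq> 0} \<and> x = (\<Sum>i | c i \<noteq> 0. c i)"
  have fin: "finite {i. c i \<noteq> 0}" by (rule finite_subset[OF _ S(1)]) (use S(2) in blast)
  have sm: "(\<Sum>i\<in>S. c i) = (\<Sum>i | c i \<noteq> 0. c i)"
    by (rule sum.mono_neutral_right[OF S(1)]) (use S(2) in blast)+
  have "(THE c. ?P c) = c"
  proof (rule the_equality)
    show "?P c" using c x fin sm by simp
    fix d assume d: "?P d"
    let ?e = "\<lambda>i. d i - c i"
    let ?T = "{i. d i \<noteq> 0} \<union> S"
    have finT: "finite ?T" using d S(1) by simp
    have "(\<Sum>i | ?e i \<noteq> 0. ?e i) = (\<Sum>i\<in>?T. ?e i)"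
      by (rule sum.mono_neutral_left[OF finT]) (use S(2) in auto)
    also have "\<dots> = (\<Sum>i\<in>?T. d i) - (\<Sum>i\<in>?T. c i)" by (rule sum_subtractf)
    also have "(\<Sum>i\<in>?T. d i) = (\<Sum>i | d i \<noteq> 0. d i)"
      by (rule sum.mono_neutral_right[OF finT]) auto
    also have "(\<Sum>i\<in>?T. c i) = (\<Sum>i\<in>S. c i)"
      by (rule sum.mono_neutral_right[OF finT]) (use S(2) in auto)
    finally have 0: "(\<Sum>i | ?e i \<noteq> 0. ?e i) = 0" using d x by simp
    have fe: "finite {i. ?e i \<noteq> 0}"
      by (rule finite_subset[OF _ finT]) (use S(2) in fastforce)
    have "\<forall>i. ?e i \<in> gr V i" using d c sub V.subspace_diff by blast
    moreover have "\<forall>c. (\<forall>i. c i \<in> gr V i) \<and> finite {i. c i \<noteq> 0} \<and> (\<Sum>i | c i \<noteq> 0. c i) = 0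
        \<longrightarrow> (\<forall>i. c i = 0)"
      using V unfolding graded_space_def by (elim conjE)
    ultimately have "\<forall>i. ?e i = 0" using 0 fe by (elim allE[of _ ?e]) (rule mp, assumption, intro conjI)
    then show "d = c" by (simp add: fun_eq_iff)
  qed
  then show ?thesis by (simp add: hcomp_def)
qed

lemma carr_decomp:
  fixes V :: "('k::field, 'v::ab_group_add, 'm) gspace_scheme"
  assumes V: "graded_space V" and x: "x \<in> carr V"
  shows "\<exists>c S. (\<forall>i. c i \<in> gr V i) \<and> finite S \<and> (\<forall>i. i \<notin> S \<longrightarrow> c i = 0) \<and> x = (\<Sum>i\<in>S. c i)"
proof -
  interpret V: vector_space "smul V" using V by (simp add: graded_space_def)
  have sub: "V.subspace (gr V i)" for i using V by (simp add: graded_space_def)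
  show ?thesis using x unfolding carr_def
  proof (induction rule: V.span_induct_alt)
    case base
    show ?case
      by (intro exI[of _ "\<lambda>_. 0"] exI[of _ "{}"]) (simp add: V.subspace_0[OF sub])
  next
    case (step a x y)
    then obtain k where k: "x \<in> gr V k" by blast
    from step obtain c S where c: "\<forall>i. c i \<in> gr V i" "finite S" "\<forall>i. i \<notin> S \<longrightarrow> c i = 0"
      "y = (\<Sum>i\<in>S. c i)" by blast
    let ?d = "\<lambda>i. (if i = k then smul V a x else 0) + c i"
    have "(\<Sum>i\<in>insert k S. ?d i) =
        (\<Sum>i\<in>insert k S. if i = k then smul V a x else 0) + (\<Sum>i\<in>insert k S. c i)"
      by (rule sum.distrib)
    also have "(\<Sum>i\<in>insert k S. if i = k then smul V a x else 0) = smul V a x"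
      using c(2) by (simp add: sum.delta)
    also have "(\<Sum>i\<in>insert k S. c i) = y"
      unfolding c(4) by (rule sum.mono_neutral_right) (use c in auto)
    finally have "smul V a x + y = (\<Sum>i\<in>insert k S. ?d i)" by simp
    moreover have "\<forall>i. ?d i \<in> gr V i"
      using c(1) k sub by (auto intro: V.subspace_add V.subspace_scale V.subspace_0)
    ultimately show ?case using c(2,3)
      by (intro exI[of _ ?d] exI[of _ "insert k S"]) auto
  qed
qed

lemma hcomp_gr:
  assumes V: "graded_space V" and x: "x \<in> gr V k"
  shows "hcomp V n x = (if n = k then x else 0)"
proof -
  interpret V: vector_space "smul V" using V by (simp add: graded_space_def)
  have sub: "V.subspace (gr V i)" for i using V by (simp add: graded_space_def)
  show ?thesis
    by (rule hcomp_eq[OF V, where S = "{k}"]) (use x V.subspace_0[OF sub] in auto)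
qed

lemma linear_on_hcomp:
  assumes V: "graded_space V"
  shows "linear_on (smul V) (carr V) (smul V) (hcomp V n)"
    and "x \<in> carr V \<Longrightarrow> hcomp V n x \<in> gr V n"
proof -
  interpret V: vector_space "smul V" using V by (simp add: graded_space_def)
  have sub: "V.subspace (gr V i)" for i using V by (simp add: graded_space_def)
  show "hcomp V n x \<in> gr V n" if "x \<in> carr V" for x
    using carr_decomp[OF V that] hcomp_eq[OF V] by metis
  have "hcomp V n (x + y) = hcomp V n x + hcomp V n y"
    and "hcomp V n (smul V a x) = smul V a (hcomp V n x)"
    if x: "x \<in> carr V" and y: "y \<in> carr V" for x y a
  proof -
    from carr_decomp[OF V x] obtain c S where c: "\<And>i. c i \<in> gr V i" "finite S"
      "\<And>i. i \<notin> S \<Longrightarrow> c i = 0" "x = (\<Sum>i\<in>S. c i)" by blast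
    from carr_decomp[OF V y] obtain d T where d: "\<And>i. d i \<in> gr V i" "finite T"
      "\<And>i. i \<notin> T \<Longrightarrow> d i = 0" "y = (\<Sum>i\<in>T. d i)" by blast
    have xs: "x = (\<Sum>i\<in>S \<union> T. c i)"
      unfolding c(4) by (rule sum.mono_neutral_left) (use c d in auto)
    have ys: "y = (\<Sum>i\<in>S \<union> T. d i)"
      unfolding d(4) by (rule sum.mono_neutral_left) (use c d in auto)
    have "hcomp V n (x + y) = c n + d n"
      by (rule hcomp_eq[OF V, where S = "S \<union> T"])
        (use c d xs ys sub in \<open>auto simp: sum.distrib intro: V.subspace_add\<close>)
    then show "hcomp V n (x + y) = hcomp V n x + hcomp V n y"
      using hcomp_eq[OF V c] hcomp_eq[OF V d] by simp
    have "hcomp V n (smul V a x) = smul V a (c n)"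
      by (rule hcomp_eq[OF V, where S = S])
        (use c sub in \<open>auto simp: V.scale_sum_right intro: V.subspace_scale\<close>)
    then show "hcomp V n (smul V a x) = smul V a (hcomp V n x)"
      using hcomp_eq[OF V c] by simp
  qed
  then show "linear_on (smul V) (carr V) (smul V) (hcomp V n)"
    by (simp add: linear_on_def)
qed

lemma graded_space_tprod:
  fixes V :: "('k::field, 'v::ab_group_add, 'm) gspace_scheme"
    and W :: "('k, 'w::ab_group_add, 'n) gspace_scheme"
  assumes V: "graded_space V" and W: "graded_space W"
  shows "graded_space (V \<otimes> W)"
proof -
  interpret F: vector_space "fun_scale :: 'k \<Rightarrow> (('v \<Rightarrow> 'w \<Rightarrow> 'k) \<Rightarrow> 'k) \<Rightarrow> _"
    by (rule vector_space_fun_scale)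
  interpret V: vector_space "smul V" using V by (simp add: graded_space_def)
  interpret W: vector_space "smul W" using W by (simp add: graded_space_def)
  have cV: "v \<in> carr V" if "v \<in> gr V k" for v k
    using that unfolding carr_def by (auto intro: V.span_base)
  have cW: "w \<in> carr W" if "w \<in> gr W k" for w k
    using that unfolding carr_def by (auto intro: W.span_base)
  define p where "p \<beta> m = (\<lambda>v w. \<Sum>k\<le>m. \<beta> (hcomp V k v) (hcomp W (m - k) w))"
    for \<beta> :: "'v \<Rightarrow> 'w \<Rightarrow> 'k" and m
  have p: "bilinear_on V W (*) (p \<beta> m)" if \<beta>: "bilinear_on V W (*) \<beta>" for \<beta> m
  proof -
    have h: "hcomp V k v \<in> carr V" if "v \<in> carr V" for k v
      using linear_on_hcomp(2)[OF V that] cV by blast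
    have h': "hcomp W k v \<in> carr W" if "v \<in> carr W" for k v
      using linear_on_hcomp(2)[OF W that] cW by blast
    show ?thesis using linear_on_hcomp(1)[OF V] linear_on_hcomp(1)[OF W] \<beta> h h'
      by (simp add: bilinear_on_def linear_on_def p_def sum.distrib sum_distrib_left)
  qed
  have gr: "gr (V \<otimes> W) i = F.span {tens V W v w | v w k l. v \<in> gr V k \<and> w \<in> gr W l \<and> k + l = i}" for i
    by (simp add: tprod_def)
  have z: "x \<beta> = 0" if x: "x \<in> gr (V \<otimes> W) i" and "\<not> bilinear_on V W (*) \<beta>" for x i \<beta>
    using x unfolding gr
    by (induction rule: F.span_induct_alt) (use that(2) in \<open>auto simp: fun_scale_def tens_def\<close>)
  have ev: "x (p \<beta> m) = (if i = m then x \<beta> else 0)"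
    if x: "x \<in> gr (V \<otimes> W) i" and \<beta>: "bilinear_on V W (*) \<beta>" for x i \<beta> m
    using x unfolding gr
  proof (induction rule: F.span_induct_alt)
    case base
    show ?case by simp
  next
    case (step c x y)
    then obtain v w k l where vw: "v \<in> gr V k" "w \<in> gr W l" "k + l = i" "x = tens V W v w" by blast
    have z1: "\<beta> 0 y = 0" if "y \<in> carr W" for y
    proof -
      have "\<beta> (smul V 0 0) y = 0 * \<beta> 0 y"
        using \<beta> that V.span_zero unfolding bilinear_on_def linear_on_def carr_def by blast
      then show ?thesis by simp
    qed
    have z2: "\<beta> y 0 = 0" if "y \<in> carr V" for y
    proof -
      have "\<beta> y (smul W 0 0) = 0 * \<beta> y 0"
        using \<beta> that W.span_zero unfolding bilinear_on_def linear_on_def carr_def by blast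
      then show ?thesis by simp
    qed
    have t: "\<beta> (hcomp V j v) (hcomp W (m - j) w) = (if j = k then if i = m then \<beta> v w else 0 else 0)"
      if "j \<le> m" for j
      using that z1[OF cW[OF vw(2)]] z1[of 0] z2[OF cV[OF vw(1)]] vw(3) W.span_zero
      by (auto simp: hcomp_gr[OF V vw(1)] hcomp_gr[OF W vw(2)] carr_def)
    have "p \<beta> m v w = (\<Sum>j\<le>m. if j = k then if i = m then \<beta> v w else 0 else 0)"
      unfolding p_def by (rule sum.cong) (use t in auto)
    also have "\<dots> = (if i = m then \<beta> v w else 0)" using vw(3) by (auto simp: sum.delta)
    finally have "x (p \<beta> m) = (if i = m then x \<beta> else 0)"
      using \<beta> p[OF \<beta>] vw(4) by (simp add: tens_def)
    then show ?case using step by (simp add: fun_scale_def)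
  qed
  show ?thesis unfolding graded_space_def
  proof (intro conjI allI impI)
    show "vector_space (smul (V \<otimes> W))"
      using vector_space_fun_scale by (simp add: tprod_def)
    show "module.subspace (smul (V \<otimes> W)) (gr (V \<otimes> W) n)" for n
      by (simp add: tprod_def F.subspace_span)
    fix c i
    assume c: "(\<forall>i. c i \<in> gr (V \<otimes> W) i) \<and> finite {i. c i \<noteq> 0} \<and> (\<Sum>i | c i \<noteq> 0. c i) = 0"
    have "c i \<beta> = 0" for \<beta>
    proof (cases "bilinear_on V W (*) \<beta>")
      case False
      then show ?thesis using z c by blast
    next
      case True
      have sum_ev: "(\<Sum>j\<in>S. c j) \<gamma> = (\<Sum>j\<in>S. c j \<gamma>)" if "finite S" for S \<gamma>
        using that by (induction rule: finite_induct) auto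
      have evc: "c j (p \<beta> i) = (if j = i then c j \<beta> else 0)" for j
        using ev[of "c j" j \<beta> i] c True by blast
      have "0 = (\<Sum>j | c j \<noteq> 0. c j (p \<beta> i))" using c sum_ev by (metis zero_fun_apply)
      also have "\<dots> = (\<Sum>j | c j \<noteq> 0. if j = i then c i \<beta> else 0)"
        by (rule sum.cong) (use evc in auto)
      also have "\<dots> = c i \<beta>" using c by (auto simp: sum.delta)
      finally show ?thesis by simp
    qed
    then show "c i = 0" by (simp add: fun_eq_iff)
  qed
qed

lemma tensor_algebra_mul_word:
  assumes "vector_space s" "module.subspace s U" "xs \<in> lists U" "ys \<in> lists U"
  shows "mul (tensor_algebra s U) (word s U xs) (word s U ys) = word s U (xs @ ys)"
proof (rule ext)
  interpret vector_space s by (rule assms(1))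
  have sub: "x + y \<in> U" "s c x \<in> U" if "x \<in> U" "y \<in> U" for x y c
    using assms(2) that by (auto intro: subspace_add subspace_scale)
  fix \<phi>
  show "mul (tensor_algebra s U) (word s U xs) (word s U ys) \<phi> = word s U (xs @ ys) \<phi>"
  proof (cases "multilinear_form s U \<phi>")
    case True
    have 1: "multilinear_form s U (\<lambda>ys. \<phi> (zs @ ys))" if "zs \<in> lists U" for zs
      unfolding multilinear_form_def
    proof (intro ballI)
      fix as bs assume "as \<in> lists U" "bs \<in> lists U"
      then have "linear_on s U (*) (\<lambda>u. \<phi> ((zs @ as) @ u # bs))"
        using True that unfolding multilinear_form_def by (meson append_in_lists_conv)
      then show "linear_on s U (*) (\<lambda>u. \<phi> (zs @ as @ u # bs))" by simp
    qed
    have 2: "multilinear_form s U (\<lambda>zs. word s U ys (\<lambda>ys. \<phi> (zs @ ys)))"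
      unfolding multilinear_form_def
    proof (intro ballI)
      fix as bs assume ab: "as \<in> lists U" "bs \<in> lists U"
      have "linear_on s U (*) (\<lambda>u. \<phi> (as @ u # (bs @ ys)))"
        using True ab assms(4) unfolding multilinear_form_def by (meson append_in_lists_conv)
      then have lin: "linear_on s U (*) (\<lambda>u. \<phi> ((as @ u # bs) @ ys))" by simp
      have w: "word s U ys (\<lambda>ys. \<phi> ((as @ u # bs) @ ys)) = \<phi> ((as @ u # bs) @ ys)" if "u \<in> U" for u
        using 1[of "as @ u # bs"] ab that by (simp add: word_def)
      show "linear_on s U (*) (\<lambda>u. word s U ys (\<lambda>ys. \<phi> ((as @ u # bs) @ ys)))"
        using lin w unfolding linear_on_def by (simp add: sub)
    qed
    from True 1[OF assms(3)] 2 show ?thesis by (simp add: tensor_algebra_def word_def)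
  next
    case False
    then show ?thesis by (simp add: tensor_algebra_def word_def)
  qed
qed


lemma tcanon_universal:
  fixes A :: "('k::field, 'v::ab_group_add, 'm) galgebra_scheme"
  assumes A: "graded_algebra A"
  shows "linear_on (smul (T1 A)) (carr (T1 A)) (smul A) (tcanon A)"
    and "xs \<in> lists (gr A 1) \<Longrightarrow> tcanon A (word (smul A) (gr A 1) xs) = foldr (mul A) xs (one A)"
proof -
  have vs: "vector_space (smul A)" and bil: "bilinear_on A A (smul A) (mul A)"
    and prod: "\<And>m n x y. x \<in> gr A m \<Longrightarrow> y \<in> gr A n \<Longrightarrow> mul A x y \<in> gr A (m + n)"
    and one: "gr A 0 = range (\<lambda>c. smul A c (one A))"
    using A by (auto simp: graded_algebra_def graded_space_def)
  interpret A: vector_space "smul A" by fact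
  have c: "v \<in> carr A" if "v \<in> gr A k" for v k
    using that unfolding carr_def by (auto intro: A.span_base)
  have fold: "foldr (mul A) ys (one A) \<in> gr A (length ys)" if "ys \<in> lists (gr A 1)" for ys
    using that
  proof (induction ys)
    case Nil
    have "smul A 1 (one A) \<in> gr A 0" unfolding one by (rule rangeI)
    then show ?case by simp
  next
    case (Cons y ys)
    then show ?case using prod[of y 1 _ "length ys"] by auto
  qed
  have lin: "linear_on (smul A) (gr A 1) (smul A) (\<lambda>u. foldr (mul A) (as @ u # bs) (one A))"
    if "as \<in> lists (gr A 1)" "bs \<in> lists (gr A 1)" for as bs
    using that(1)
  proof (induction as)
    case Nil
    then show ?case using bil c fold[OF that(2)]
      unfolding bilinear_on_def linear_on_def by simp
  next
    case (Cons a as)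
    have ca: "a \<in> carr A" using Cons c[of a 1] by auto
    have cf: "foldr (mul A) (as @ u # bs) (one A) \<in> carr A" if "u \<in> gr A 1" for u
      using fold[of "as @ u # bs"] Cons that \<open>bs \<in> _\<close> by (intro c[of _ "length (as @ u # bs)"]) (auto simp del: foldr_append)
    have IH: "linear_on (smul A) (gr A 1) (smul A) (\<lambda>u. foldr (mul A) (as @ u # bs) (one A))"
      using Cons by auto
    have l: "linear_on (smul A) (carr A) (smul A) (mul A a)"
      using bil ca unfolding bilinear_on_def by blast
    show ?case using IH l cf unfolding linear_on_def by simp
  qed
  have "\<exists>L. Vector_Spaces.linear fun_scale (smul A) L \<and>
     (\<forall>xs\<in>lists (gr A 1). L (word (smul A) (gr A 1) xs) = foldr (mul A) xs (one A))"
  proof (rule eval_lift[OF vs])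
    fix \<xi> assume "Vector_Spaces.linear (smul A) (*) \<xi>"
    then interpret \<xi>: Vector_Spaces.linear "smul A" "(*)" \<xi> .
    have "multilinear_form (smul A) (gr A 1) (\<lambda>xs. \<xi> (foldr (mul A) xs (one A)))"
      unfolding multilinear_form_def
    proof (intro ballI)
      fix as bs assume ab: "as \<in> lists (gr A 1)" "bs \<in> lists (gr A 1)"
      show "linear_on (smul A) (gr A 1) (*) (\<lambda>u. \<xi> (foldr (mul A) (as @ u # bs) (one A)))"
        using lin[OF ab] unfolding linear_on_def by (simp add: \<xi>.add \<xi>.scale del: foldr_append)
    qed
    then show "\<exists>\<beta>. \<forall>xs\<in>lists (gr A 1). word (smul A) (gr A 1) xs \<beta> = \<xi> (foldr (mul A) xs (one A))"
      by (intro exI[of _ "\<lambda>xs. \<xi> (foldr (mul A) xs (one A))"]) (simp add: word_def)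
  qed
  then obtain L where L: "Vector_Spaces.linear fun_scale (smul A) L"
    "\<forall>xs\<in>lists (gr A 1). L (word (smul A) (gr A 1) xs) = foldr (mul A) xs (one A)" by blast
  interpret L: Vector_Spaces.linear fun_scale "smul A" L by (rule L(1))
  have "linear_on (smul (T1 A)) (carr (T1 A)) (smul A) L"
    by (simp add: linear_on_def tensor_algebra_def L.add L.scale)
  with L(2) have "\<exists>L. linear_on (smul (T1 A)) (carr (T1 A)) (smul A) L \<and>
      (\<forall>xs\<in>lists (gr A 1). L (word (smul A) (gr A 1) xs) = foldr (mul A) xs (one A))" by blast
  from someI_ex[OF this]
  have *: "linear_on (smul (T1 A)) (carr (T1 A)) (smul A) (tcanon A) \<and>
      (\<forall>xs\<in>lists (gr A 1). tcanon A (word (smul A) (gr A 1) xs) = foldr (mul A) xs (one A))"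
    unfolding tcanon_def .
  from * show "linear_on (smul (T1 A)) (carr (T1 A)) (smul A) (tcanon A)" ..
  from * show "tcanon A (word (smul A) (gr A 1) xs) = foldr (mul A) xs (one A)"
    if "xs \<in> lists (gr A 1)" using that by blast
qed

end

theory Submission
  imports Defs
begin

text \<open>
  Let $C = A \otimes_\tau B$, let $K$ be the kernel of $T(C_1) \to C$ and $I \subseteq K$ the ideal
  generated by its elements of degree 2. As $C$ is one-generated, it is quadratic iff $K = I$.

  Suppose $K = I$ and let $\tau'$ agree with $\tau$ below degree $n$. The difference $\delta$ of the
  two maps in degree $n$ defines a product of $C_i$ and $C_{n-i}$. By the associativity of the
  products given by $\tau$ and $\tau'$, the form sending $x_1 \dots x_n$ to the $\delta$-product of
  $x_1$ and $x_2 \cdots x_n$ vanishes on $I$, hence on $K$. Applied to the relations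
  $w a = \tau(w \otimes a)$ with $w \in B_1$ and $a \in A_{n-1}$, this yields
  $\delta(w \otimes a) = 0$, and the twisting identity propagates it to $\delta = 0$.

  Conversely, let $n$ be minimal with $K_n \neq I_n$, and let $\lambda$ be a functional that
  vanishes on $I$ but not on $K_n$. Since $A$ and $B$ are quadratic,
  $\lambda(b a - \tau(b \otimes a))$ is a well-defined linear function of $b \otimes a$ in degree
  $n$. Its multiples by elements of $C_n$ can be added to $\tau$ without violating the twisting
  identity up to degree $n$. By uniqueness they are zero, which forces $\lambda$ to vanish on $K_n$.
\<close>

section \<open>Linear maps on subspaces\<close>

text \<open>In the first direction the right-hand side \<tau>(w \<otimes> a) of the relation
  contributes nothing: it is a sum of terms a' \<otimes> b', whose words begin in degree 1 of A or
  lie entirely in degree 1 of B, and \<delta> vanishes at the head of such words because both maps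
  are unital. What remains is the value \<delta>(w \<otimes> a) of the words for w a. The bound 3
  \<le> n leaves a nonempty tail behind a quadratic relation at the head of a word of length n; the
  comparison of the two associativity laws needs it. In the converse the obstacle is that the
  twisting identity contains the map four times, so corrections need not add up. A correction
  concentrated in degree n, however, meets only scalars in a product of total degree n, which makes
  the condition linear. The functional is evaluated on lifts of A and B to the tensor algebra; these
  are multiplicative only modulo I, and this uses that both algebras are quadratic. The multiplier a
  \<otimes> b, nonzero together with b \<otimes> a, detects the scalar attached to b \<otimes> a. In
  degrees up to 2 the ideals K and I agree anyway, which again matches the bound 3 \<le> n.\<close>

lemma fun_scale_apply: "fun_scale c x \<phi> = c * x \<phi>"
  by (simp add: fun_scale_def)

lemma fun_scale_0: "fun_scale 0 x = 0"
  by (simp add: fun_scale_def fun_eq_iff)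

lemma fun_scale_fun_scale: "fun_scale c (fun_scale d x) = fun_scale (c * d) x"
  by (simp add: fun_scale_def mult.assoc)

lemma linear_on_comp:
  assumes "linear_on s U s' f" "\<And>x. x \<in> U \<Longrightarrow> f x \<in> U'" "linear_on s' U' s'' g"
  shows "linear_on s U s'' (\<lambda>x. g (f x))"
  using assms by (simp add: linear_on_def)

lemma linear_on_id: "linear_on s U s (\<lambda>x. x)"
  by (simp add: linear_on_def)

lemma linear_on_plus:
  assumes "vector_space s'" "linear_on s U s' f" "linear_on s U s' g"
  shows "linear_on s U s' (\<lambda>x. f x + g x)"
proof -
  interpret vector_space s' by fact
  show ?thesis using assms(2,3) by (simp add: linear_on_def algebra_simps)
qed

lemma linear_on_minus:
  assumes "vector_space s'" "linear_on s U s' f" "linear_on s U s' g"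
  shows "linear_on s U s' (\<lambda>x. f x - g x)"
proof -
  interpret vector_space s' by fact
  show ?thesis using assms(2,3) by (simp add: linear_on_def algebra_simps)
qed

lemma linear_on_scale:
  assumes "vector_space s'" "linear_on s U s' f"
  shows "linear_on s U s' (\<lambda>x. s' c (f x))"
proof -
  interpret vector_space s' by fact
  show ?thesis using assms(2) by (simp add: linear_on_def algebra_simps)
qed

lemma linear_on_zero_map:
  assumes "vector_space s'"
  shows "linear_on s U s' (\<lambda>x. 0)"
proof -
  interpret vector_space s' by fact
  show ?thesis by (simp add: linear_on_def)
qed

lemma linear_on_mono: "linear_on s U s' f \<Longrightarrow> U' \<subseteq> U \<Longrightarrow> linear_on s U' s' f"
  unfolding linear_on_def by blast

lemma linear_on_cong:
  assumes "linear_on s U s' f" "\<And>x. x \<in> U \<Longrightarrow> f x = g x" "vector_space s" "module.subspace s U"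
  shows "linear_on s U s' g"
proof -
  interpret vector_space s by fact
  show ?thesis using assms(1) subspace_add[OF assms(4)] subspace_scale[OF assms(4)]
    by (simp add: linear_on_def assms(2)[symmetric])
qed

lemma linear_on_0:
  assumes "vector_space s" "vector_space s'" "module.subspace s U" "linear_on s U s' f"
  shows "f 0 = 0"
proof -
  interpret V: vector_space s by fact
  interpret X: vector_space s' by fact
  have "f (s 0 0) = s' 0 (f 0)" using assms(4) V.subspace_0[OF assms(3)] unfolding linear_on_def
      by blast
  then show ?thesis by simp
qed

lemma linear_on_diff:
  assumes "vector_space s" "vector_space s'" "module.subspace s U" "linear_on s U s' f" "x \<in> U" "y
      \<in> U"
  shows "f (x - y) = f x - f y"
proof -
  interpret V: vector_space s by fact
  interpret X: vector_space s' by fact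
  have "s (-1) y \<in> U" using V.subspace_scale[OF assms(3,6)] .
  then have "f (x + s (-1) y) = f x + s' (-1) (f y)"
    using assms(4-6) unfolding linear_on_def by metis
  then show ?thesis by simp
qed

lemma linear_on_sum:
  assumes "vector_space s" "vector_space s'" "module.subspace s U" "linear_on s U s' f"
    and "\<And>i. i \<in> S \<Longrightarrow> x i \<in> U"
  shows "f (\<Sum>i\<in>S. x i) = (\<Sum>i\<in>S. f (x i))"
proof -
  interpret V: vector_space s by fact
  show ?thesis
  proof (cases "finite S")
    case True
    then show ?thesis using assms(5)
    proof (induction S rule: finite_induct)
      case empty
      then show ?case using linear_on_0[OF assms(1-4)] by simp
    next
      case (insert i S)
      have "(\<Sum>i\<in>S. x i) \<in> U" using insert by (intro V.subspace_sum[OF assms(3)]) auto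
      with insert assms(4) show ?case by (simp add: linear_on_def)
    qed
  qed (use linear_on_0[OF assms(1-4)] in simp)
qed

text \<open>\<open>linear_on\<close> speaks only of arguments in \<open>U\<close>, so the induction
  over the span carries membership in \<open>U\<close> along with the claim. With \<open>Z\<close> a
  degree component, an ideal or the zero space, this is the principle behind the later checks on
  generators.\<close>

lemma linear_on_span_subspace:
  assumes s: "vector_space s" and X: "vector_space s'" and f: "linear_on s U s' f"
    and U: "module.subspace s U" and S: "S \<subseteq> U" and Z: "module.subspace s' Z"
    and base: "\<And>x. x \<in> S \<Longrightarrow> f x \<in> Z" and x: "x \<in> module.span s S"
  shows "f x \<in> Z"
proof -
  interpret V: vector_space s by fact
  interpret X: vector_space s' by fact
  have "x \<in> U \<and> f x \<in> Z" using x
  proof (induction rule: V.span_induct_alt)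
    case base
    show ?case using linear_on_0[OF s X U f] V.subspace_0[OF U] X.subspace_0[OF Z] by simp
  next
    case (step c x y)
    have "s c x \<in> U" "x \<in> U" using step S V.subspace_scale[OF U] by auto
    moreover have "f (s c x + y) = s' c (f x) + f y"
      using f calculation step unfolding linear_on_def by metis
    ultimately show ?case
      using step base V.subspace_add[OF U] X.subspace_add[OF Z] X.subspace_scale[OF Z] by simp
  qed
  then show ?thesis ..
qed

lemma subspace_0': "vector_space s \<Longrightarrow> module.subspace s {0}"
proof -
  assume "vector_space s"
  then interpret vector_space s .
  show "subspace {0}" by (rule subspace_single_0)
qed

lemma subspace_eqI:
  assumes "vector_space s" "vector_space s'" "linear_on s U s' f" "linear_on s U s' g"
    "module.subspace s U" "S \<subseteq> U" "\<And>x. x \<in> S \<Longrightarrow> f x = g x" "x \<in> module.span s S"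
  shows "f x = g x"
proof -
  have "f x - g x \<in> {0}"
    by (rule linear_on_span_subspace[OF assms(1,2) linear_on_minus[OF assms(2-4)] assms(5,6)
        subspace_0'[OF assms(2)] _ assms(8)])
      (simp add: assms(7))
  then show ?thesis by simp
qed

lemma linear_on_image_subspace:
  assumes s: "vector_space s" and s': "vector_space s'" and f: "linear_on s U s' f" and U:
      "module.subspace s U"
  shows "module.subspace s' (f ` U)"
proof -
  interpret V: vector_space s by fact
  interpret X: vector_space s' by fact
  show ?thesis unfolding X.subspace_def
  proof (intro conjI ballI allI)
    show "0 \<in> f ` U" using linear_on_0[OF s s' U f] V.subspace_0[OF U] by (metis imageI)
    fix x c assume "x \<in> f ` U"
    then obtain u where u: "u \<in> U" "x = f u" by blast
    have "f (s c u) = s' c x" using f u by (simp add: linear_on_def)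
    then show "s' c x \<in> f ` U" using V.subspace_scale[OF U u(1)] by (metis imageI)
    fix y assume "y \<in> f ` U"
    then obtain v where v: "v \<in> U" "y = f v" by blast
    have "f (u + v) = x + y" using f u v by (simp add: linear_on_def)
    then show "x + y \<in> f ` U" using V.subspace_add[OF U u(1) v(1)] by (metis imageI)
  qed
qed

text \<open>A basis of \<open>I\<close> stays independent when \<open>y\<close> is added, so the
  values 1 at \<open>y\<close> and 0 on the basis can be prescribed. This later turns an element
  outside an ideal into a scalar test.\<close>

lemma exists_functional:
  assumes s: "vector_space s" and I: "module.subspace s I" and y: "y \<notin> I"
  shows "\<exists>f. Vector_Spaces.linear s ((*) :: 'k::field \<Rightarrow> 'k \<Rightarrow> 'k) f \<and> f y = 1 \<and> (\<forall>x\<in>I. f x = 0)"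
proof -
  interpret V: vector_space s by fact
  interpret K: vector_space "(*) :: 'k \<Rightarrow> 'k \<Rightarrow> 'k"
    by unfold_locales (auto simp: algebra_simps)
  interpret VK: vector_space_pair s "(*) :: 'k \<Rightarrow> 'k \<Rightarrow> 'k" ..
  obtain E where E: "E \<subseteq> I" "V.independent E" "I \<subseteq> V.span E"
    using V.maximal_independent_subset[of I] by blast
  have "V.span E \<subseteq> I" using E(1) I by (rule V.span_minimal)
  then have y': "y \<notin> V.span E" using y by blast
  then have ind: "V.independent (insert y E)" using E(2) by (simp add: V.independent_insert)
  obtain f where f: "Vector_Spaces.linear s (*) f" "\<forall>b\<in>insert y E. f b = (if b = y then 1 else 0)"
    using VK.linear_independent_extend[OF ind, of "\<lambda>b. if b = y then 1 else 0"] by blast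
  interpret f: Vector_Spaces.linear s "(*)" f by fact
  have yE: "y \<notin> E" using y' V.span_base by blast
  have "f x = 0" if "x \<in> V.span E" for x
    using that
  proof (induction rule: V.span_induct_alt)
    case (step c x z)
    then show ?case using f(2) yE by (auto simp: f.add f.scale)
  qed (simp add: f.zero)
  with f E(3) show ?thesis by auto
qed

text \<open>Preimages are chosen on a basis of \<open>W\<close> and extended linearly to the whole
  ambient space, so that sections constructed for different degrees can be added.\<close>

lemma linear_on_right_inverse:
  assumes s: "vector_space s" and s': "vector_space s'" and f: "linear_on s U s' f"
    and U: "module.subspace s U" and W: "module.subspace s' W" and sur: "W \<subseteq> f ` U"
  shows "\<exists>g. Vector_Spaces.linear s' s g \<and> (\<forall>w\<in>W. g w \<in> U \<and> f (g w) = w)"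
proof -
  interpret V: vector_space s by fact
  interpret X: vector_space s' by fact
  interpret XV: vector_space_pair s' s ..
  obtain E where E: "E \<subseteq> W" "X.independent E" "W \<subseteq> X.span E"
    using X.maximal_independent_subset[of W] by blast
  have "\<forall>w\<in>E. \<exists>u\<in>U. f u = w" using E(1) sur by blast
  then obtain h where h: "\<And>w. w \<in> E \<Longrightarrow> h w \<in> U" "\<And>w. w \<in> E \<Longrightarrow> f (h w) = w" by metis
  obtain g where g: "Vector_Spaces.linear s' s g" "\<forall>b\<in>E. g b = h b"
    using XV.linear_independent_extend[OF E(2), of h] by blast
  interpret g: Vector_Spaces.linear s' s g by fact
  have "g w \<in> U \<and> f (g w) = w" if "w \<in> X.span E" for w
    using that
  proof (induction rule: X.span_induct_alt)
    case base
    show ?case using linear_on_0[OF s s' U f] V.subspace_0[OF U] by (simp add: g.zero)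
  next
    case (step c x y)
    have 1: "g (s' c x + y) = s c (g x) + g y" by (simp add: g.add g.scale)
    have 2: "g x \<in> U" "f (g x) = x" using step h g(2) by auto
    have 3: "s c (g x) \<in> U" using 2 V.subspace_scale[OF U] by simp
    have "f (s c (g x) + g y) = s' c (f (g x)) + f (g y)"
      using f 2 3 step unfolding linear_on_def by metis
    then show ?case using 1 2 3 step V.subspace_add[OF U] by simp
  qed
  with E(3) g(1) show ?thesis by blast
qed

section \<open>Graded spaces and tensor products\<close>

lemma graded_spaceD:
  assumes "graded_space V"
  shows "vector_space (smul V)" "module.subspace (smul V) (gr V n)"
    "module.subspace (smul V) (carr V)" "x \<in> gr V n \<Longrightarrow> x \<in> carr V"
proof -
  interpret vector_space "smul V" using assms by (simp add: graded_space_def)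
  show "vector_space (smul V)" ..
  show "module.subspace (smul V) (gr V n)" using assms by (simp add: graded_space_def)
  show "module.subspace (smul V) (carr V)" by (simp add: carr_def)
  show "x \<in> gr V n \<Longrightarrow> x \<in> carr V" unfolding carr_def by (auto intro: span_base)
qed

lemma carr_closed:
  assumes "graded_space V"
  shows "x \<in> carr V \<Longrightarrow> y \<in> carr V \<Longrightarrow> x + y \<in> carr V"
    "x \<in> carr V \<Longrightarrow> smul V c x \<in> carr V" "0 \<in> carr V"
    "x \<in> carr V \<Longrightarrow> y \<in> carr V \<Longrightarrow> x - y \<in> carr V"
proof -
  interpret vector_space "smul V" using assms by (rule graded_spaceD)
  note sub = graded_spaceD(3)[OF assms]
  show "x \<in> carr V \<Longrightarrow> y \<in> carr V \<Longrightarrow> x + y \<in> carr V"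
    "x \<in> carr V \<Longrightarrow> smul V c x \<in> carr V" "0 \<in> carr V"
    "x \<in> carr V \<Longrightarrow> y \<in> carr V \<Longrightarrow> x - y \<in> carr V"
    using sub subspace_add subspace_scale subspace_0 subspace_diff by blast+
qed

lemma gr_closed:
  assumes "graded_space V"
  shows "x \<in> gr V n \<Longrightarrow> y \<in> gr V n \<Longrightarrow> x + y \<in> gr V n"
    "x \<in> gr V n \<Longrightarrow> smul V c x \<in> gr V n" "0 \<in> gr V n"
    "x \<in> gr V n \<Longrightarrow> y \<in> gr V n \<Longrightarrow> x - y \<in> gr V n"
proof -
  interpret vector_space "smul V" using assms by (rule graded_spaceD)
  note sub = graded_spaceD(2)[OF assms]
  show "x \<in> gr V n \<Longrightarrow> y \<in> gr V n \<Longrightarrow> x + y \<in> gr V n"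
    "x \<in> gr V n \<Longrightarrow> smul V c x \<in> gr V n" "0 \<in> gr V n"
    "x \<in> gr V n \<Longrightarrow> y \<in> gr V n \<Longrightarrow> x - y \<in> gr V n"
    using sub subspace_add subspace_scale subspace_0 subspace_diff by blast+
qed

lemma smul_tprod [simp]: "smul (V \<otimes> W) = fun_scale"
  by (simp add: tprod_def)

lemma tens_add_left:
  "x \<in> carr V \<Longrightarrow> y \<in> carr V \<Longrightarrow> w \<in> carr W \<Longrightarrow> tens V W (x + y) w = tens V W x w + tens V W y w"
  by (auto simp: tens_def fun_eq_iff bilinear_on_def linear_on_def)

lemma tens_scale_left:
  "x \<in> carr V \<Longrightarrow> w \<in> carr W \<Longrightarrow> tens V W (smul V c x) w = fun_scale c (tens V W x w)"
  by (auto simp: tens_def fun_scale_def fun_eq_iff bilinear_on_def linear_on_def)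

lemma tens_add_right:
  "x \<in> carr W \<Longrightarrow> y \<in> carr W \<Longrightarrow> v \<in> carr V \<Longrightarrow> tens V W v (x + y) = tens V W v x + tens V W v y"
  by (auto simp: tens_def fun_eq_iff bilinear_on_def linear_on_def)

lemma tens_scale_right:
  "x \<in> carr W \<Longrightarrow> v \<in> carr V \<Longrightarrow> tens V W v (smul W c x) = fun_scale c (tens V W v x)"
  by (auto simp: tens_def fun_scale_def fun_eq_iff bilinear_on_def linear_on_def)

lemma tens_gr:
  fixes V :: "('k::field, 'v::ab_group_add, 'm) gspace_scheme"
    and W :: "('k, 'w::ab_group_add, 'n) gspace_scheme"
  assumes "v \<in> gr V k" "w \<in> gr W l" "k + l = n"
  shows "tens V W v w \<in> gr (V \<otimes> W) n"
proof -
  interpret F: vector_space "fun_scale :: 'k \<Rightarrow> (('v \<Rightarrow> 'w \<Rightarrow> 'k) \<Rightarrow> 'k) \<Rightarrow> _"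
    by (rule vector_space_fun_scale)
  show ?thesis using assms by (auto simp: tprod_def intro!: F.span_base)
qed

lemma tens_carr:
  fixes V :: "('k::field, 'v::ab_group_add, 'm) gspace_scheme"
    and W :: "('k, 'w::ab_group_add, 'n) gspace_scheme"
  assumes "graded_space V" "graded_space W" "v \<in> carr V" "w \<in> carr W"
  shows "tens V W v w \<in> carr (V \<otimes> W)"
proof -
  interpret F: vector_space "fun_scale :: 'k \<Rightarrow> (('v \<Rightarrow> 'w \<Rightarrow> 'k) \<Rightarrow> 'k) \<Rightarrow> _"
    by (rule vector_space_fun_scale)
  show ?thesis using assms by (auto simp: carr_tprod intro!: F.span_base)
qed

text \<open>Formulated as membership in a subspace, so that one rule covers preservation of degree,
  congruence modulo an ideal and, with the zero subspace, equality of maps.\<close>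

lemma tprod_subspaceI:
  assumes V: "graded_space V" and W: "graded_space W" and X: "vector_space sX"
    and f: "linear_on fun_scale (carr (V \<otimes> W)) sX f" and Z: "module.subspace sX Z"
    and base: "\<And>v w k l. v \<in> gr V k \<Longrightarrow> w \<in> gr W l \<Longrightarrow> k + l = n \<Longrightarrow> f (tens V W v w) \<in> Z"
    and x: "x \<in> gr (V \<otimes> W) n"
  shows "f x \<in> Z"
proof (rule linear_on_span_subspace[OF vector_space_fun_scale X f _ _ Z])
  note VW = graded_space_tprod[OF V W]
  show "module.subspace fun_scale (carr (V \<otimes> W))" using graded_spaceD(3)[OF VW] by simp
  let ?S = "{tens V W v w | v w k l. v \<in> gr V k \<and> w \<in> gr W l \<and> k + l = n}"
  show "?S \<subseteq> carr (V \<otimes> W)"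
    using V W by (auto intro!: tens_carr intro: graded_spaceD)
  show "f x \<in> Z" if "x \<in> ?S" for x using that base by blast
  show "x \<in> module.span fun_scale ?S" using x by (simp add: tprod_def)
qed

lemma tprod_eqI:
  assumes V: "graded_space V" and W: "graded_space W" and X: "vector_space sX"
    and f: "linear_on fun_scale (carr (V \<otimes> W)) sX f" and g: "linear_on fun_scale (carr (V \<otimes> W)) sX
        g"
    and base: "\<And>v w k l. v \<in> gr V k \<Longrightarrow> w \<in> gr W l \<Longrightarrow> k + l = n
       \<Longrightarrow> f (tens V W v w) = g (tens V W v w)"
    and x: "x \<in> gr (V \<otimes> W) n"
  shows "f x = g x"
proof -
  have "f x - g x \<in> {0}"
    by (rule tprod_subspaceI[OF V W X linear_on_minus[OF X f g] subspace_0'[OF X] _ x])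
      (simp add: base)
  then show ?thesis by simp
qed

lemma carr_subspaceI:
  assumes V: "graded_space V" and X: "vector_space sX"
    and f: "linear_on (smul V) (carr V) sX f" and Z: "module.subspace sX Z"
    and base: "\<And>n v. v \<in> gr V n \<Longrightarrow> f v \<in> Z"
    and x: "x \<in> carr V"
  shows "f x \<in> Z"
  by (rule linear_on_span_subspace[OF graded_spaceD(1)[OF V] X f graded_spaceD(3)[OF V] _ Z _
      x[unfolded carr_def]])
    (use base graded_spaceD(4)[OF V] in auto)

lemma carr_eqI:
  assumes V: "graded_space V" and X: "vector_space sX"
    and f: "linear_on (smul V) (carr V) sX f" and g: "linear_on (smul V) (carr V) sX g"
    and base: "\<And>n v. v \<in> gr V n \<Longrightarrow> f v = g v"
    and x: "x \<in> carr V"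
  shows "f x = g x"
proof -
  have "f x - g x \<in> {0}"
    by (rule carr_subspaceI[OF V X linear_on_minus[OF X f g] subspace_0'[OF X] _ x])
      (simp add: base)
  then show ?thesis by simp
qed

lemma tprod_carr_subspaceI:
  assumes V: "graded_space V" and W: "graded_space W" and X: "vector_space sX"
    and f: "linear_on fun_scale (carr (V \<otimes> W)) sX f" and Z: "module.subspace sX Z"
    and base: "\<And>v w. v \<in> carr V \<Longrightarrow> w \<in> carr W \<Longrightarrow> f (tens V W v w) \<in> Z"
    and x: "x \<in> carr (V \<otimes> W)"
  shows "f x \<in> Z"
proof (rule carr_subspaceI[OF graded_space_tprod[OF V W] X _ Z _ x])
  show "linear_on (smul (V \<otimes> W)) (carr (V \<otimes> W)) sX f" using f by simp
  show "f x \<in> Z" if "x \<in> gr (V \<otimes> W) n" for n x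
    by (rule tprod_subspaceI[OF V W X f Z _ that]) (intro base graded_spaceD(4)[OF V]
        graded_spaceD(4)[OF W])
qed

lemma tprod_carr_eqI:
  assumes V: "graded_space V" and W: "graded_space W" and X: "vector_space sX"
    and f: "linear_on fun_scale (carr (V \<otimes> W)) sX f" and g: "linear_on fun_scale (carr (V \<otimes> W)) sX
        g"
    and base: "\<And>v w. v \<in> carr V \<Longrightarrow> w \<in> carr W \<Longrightarrow> f (tens V W v w) = g (tens V W v w)"
    and x: "x \<in> carr (V \<otimes> W)"
  shows "f x = g x"
proof -
  have "f x - g x \<in> {0}"
    by (rule tprod_carr_subspaceI[OF V W X linear_on_minus[OF X f g] subspace_0'[OF X] _ x])
      (simp add: base)
  then show ?thesis by simp
qed

section \<open>Pure tensors and the maps induced by bilinear and quadrilinear maps\<close>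

lemma bilinear_onI:
  assumes "\<And>w. w \<in> carr W \<Longrightarrow> linear_on (smul V) (carr V) s (\<lambda>v. h v w)"
    and "\<And>v. v \<in> carr V \<Longrightarrow> linear_on (smul W) (carr W) s (\<lambda>w. h v w)"
  shows "bilinear_on V W s h"
  using assms by (simp add: bilinear_on_def)

lemma bilinear_onD:
  assumes "bilinear_on V W s h"
  shows "w \<in> carr W \<Longrightarrow> linear_on (smul V) (carr V) s (\<lambda>v. h v w)"
    "v \<in> carr V \<Longrightarrow> linear_on (smul W) (carr W) s (\<lambda>w. h v w)"
  using assms by (simp_all add: bilinear_on_def)

text \<open>Functionals with value 1 at \<open>v\<close> and at \<open>w\<close> multiply to a
  bilinear form with value 1 at the pair, and the pure tensor is evaluation at that pair.\<close>

lemma tens_neq_0: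
  fixes V :: "('k::field, 'v::ab_group_add, 'm) gspace_scheme"
    and W :: "('k, 'w::ab_group_add, 'n) gspace_scheme"
  assumes V: "graded_space V" and W: "graded_space W" and "v \<noteq> 0" "w \<noteq> 0"
  shows "tens V W v w \<noteq> 0"
proof
  assume 0: "tens V W v w = 0"
  note vV = graded_spaceD(1)[OF V] and vW = graded_spaceD(1)[OF W]
  obtain f where f: "Vector_Spaces.linear (smul V) (*) f" "f v = 1"
    using exists_functional[OF vV subspace_0'[OF vV], of v] assms(3) by auto
  obtain g where g: "Vector_Spaces.linear (smul W) (*) g" "g w = 1"
    using exists_functional[OF vW subspace_0'[OF vW], of w] assms(4) by auto
  interpret f: Vector_Spaces.linear "smul V" "(*)" f by fact
  interpret g: Vector_Spaces.linear "smul W" "(*)" g by fact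
  have "bilinear_on V W (*) (\<lambda>v w. f v * g w)"
  proof (rule bilinear_onI; unfold linear_on_def; intro conjI ballI allI)
    show "f (x + y) * g w = f x * g w + f y * g w" for x y w by (simp only: f.add distrib_right)
    show "f (smul V c x) * g w = c * (f x * g w)" for c x w by (simp only: f.scale mult.assoc)
    show "f v * g (x + y) = f v * g x + f v * g y" for v x y by (simp only: g.add distrib_left)
    show "f v * g (smul W c x) = c * (f v * g x)" for c v x by
        (simp only: g.scale mult.left_commute)
  qed
  then have "tens V W v w (\<lambda>v w. f v * g w) = 1" by (simp add: tens_def f(2) g(2))
  then show False by (simp add: 0)
qed

text \<open>Transposition identifies the bilinear forms on V x W with those on W x V. This compares
  a \<otimes> b with b \<otimes> a, which live in different function spaces.\<close>

lemma tens_swap_eq_0: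
  assumes "tens V W v w = 0" shows "tens W V w v = 0"
proof
  fix \<beta>
  have "bilinear_on V W (*) (\<lambda>v w. \<beta> w v) \<longleftrightarrow> bilinear_on W V (*) \<beta>"
    unfolding bilinear_on_def by blast
  then show "tens W V w v \<beta> = 0 \<beta>"
    using fun_cong[OF assms, of "\<lambda>v w. \<beta> w v"] by (simp add: tens_def)
qed

lemma linear_on_tens:
  "w \<in> carr W \<Longrightarrow> linear_on (smul V) (carr V) fun_scale (\<lambda>v. tens V W v w)"
  "v \<in> carr V \<Longrightarrow> linear_on (smul W) (carr W) fun_scale (\<lambda>w. tens V W v w)"
  by (simp_all add: linear_on_def tens_add_left tens_scale_left tens_add_right tens_scale_right)

lemma linear_on_tens_comp:
  "w \<in> carr W \<Longrightarrow> linear_on s U (smul V) f \<Longrightarrow> (\<And>x. x \<in> U \<Longrightarrow> f x \<in> carr V) \<Longrightarrow>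
    linear_on s U fun_scale (\<lambda>x. tens V W (f x) w)"
  "v \<in> carr V \<Longrightarrow> linear_on s U (smul W) g \<Longrightarrow> (\<And>x. x \<in> U \<Longrightarrow> g x \<in> carr W) \<Longrightarrow>
    linear_on s U fun_scale (\<lambda>x. tens V W v (g x))"
  using linear_on_comp[OF _ _ linear_on_tens(1)] linear_on_comp[OF _ _ linear_on_tens(2)] by blast+

text \<open>Both sides are linear and agree on pure tensors, so uniqueness of the lift applies. The
  subspace \<open>U\<close> containing the values of \<open>h\<close> is there because
  \<open>g\<close> is linear on a carrier only.\<close>

lemma tlift_comp:
  assumes V: "graded_space V" and W: "graded_space W"
    and X: "vector_space (smul X)" and Y: "vector_space (smul Y)"
    and h: "bilinear_on V W (smul X) h"
    and U: "\<And>v w. v \<in> carr V \<Longrightarrow> w \<in> carr W \<Longrightarrow> h v w \<in> U" "module.subspace (smul X) U"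
    and g: "linear_on (smul X) U (smul Y) g"
    and x: "x \<in> carr (V \<otimes> W)"
  shows "g (tlift V W X h x) = tlift V W Y (\<lambda>v w. g (h v w)) x"
proof -
  note T = tensor_universal[OF V W X h]
  have gh: "bilinear_on V W (smul Y) (\<lambda>v w. g (h v w))"
    by (intro bilinear_onI linear_on_comp[OF _ _ g] bilinear_onD[OF h]) (auto simp: U)
  have inU: "tlift V W X h x \<in> U" if "x \<in> carr (V \<otimes> W)" for x
    by (rule tprod_carr_subspaceI[OF V W X _ U(2) _ that]) (use T(1) in \<open>simp_all add: T(2) U(1)\<close>)
  show ?thesis
    by (rule tensor_universal(3)[OF V W Y gh _ _ x])
      (use linear_on_comp[OF T(1) inU g] in \<open>simp_all add: T(2)\<close>)
qed

lemma tlift_in: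
  assumes V: "graded_space V" and W: "graded_space W" and X: "vector_space (smul X)"
    and h: "bilinear_on V W (smul X) h"
    and U: "module.subspace (smul X) U"
    and "\<And>v w. v \<in> carr V \<Longrightarrow> w \<in> carr W \<Longrightarrow> h v w \<in> U"
    and x: "x \<in> carr (V \<otimes> W)"
  shows "tlift V W X h x \<in> U"
  by (rule tprod_carr_subspaceI[OF V W X _ U _ x])
    (use tensor_universal(1,2)[OF V W X h] in \<open>simp_all add: assms\<close>)

lemma tlift_gr:
  assumes V: "graded_space V" and W: "graded_space W" and X: "vector_space (smul X)"
    and h: "bilinear_on V W (smul X) h"
    and U: "module.subspace (smul X) U"
    and "\<And>v w k l. v \<in> gr V k \<Longrightarrow> w \<in> gr W l \<Longrightarrow> k + l = n \<Longrightarrow> h v w \<in> U"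
    and x: "x \<in> gr (V \<otimes> W) n"
  shows "tlift V W X h x \<in> U"
  by (rule tprod_subspaceI[OF V W X _ U _ x])
    (use tensor_universal(1,2)[OF V W X h] V W in \<open>simp_all add: assms graded_spaceD\<close>)

text \<open>A lift is an arbitrary choice, so linearity in a parameter cannot be read off its
  definition. It follows from uniqueness on the carrier: sums and multiples of lifts are lifts of
  the sums and multiples.\<close>

lemma linear_on_tlift_param:
  assumes V: "graded_space V" and W: "graded_space W" and X: "vector_space (smul X)"
    and P: "graded_space P"
    and h: "\<And>p. p \<in> carr P \<Longrightarrow> bilinear_on V W (smul X) (h p)"
    and lin: "\<And>v w. v \<in> carr V \<Longrightarrow> w \<in> carr W \<Longrightarrow> linear_on (smul P) (carr P) (smul X) (\<lambda>p. h p v w)"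
    and x: "x \<in> carr (V \<otimes> W)"
  shows "linear_on (smul P) (carr P) (smul X) (\<lambda>p. tlift V W X (h p) x)"
  unfolding linear_on_def
proof (intro conjI ballI allI)
  note T = tensor_universal[OF V W X h]
  fix p q c assume p: "p \<in> carr P" 
  show "tlift V W X (h (smul P c p)) x = smul X c (tlift V W X (h p) x)"
    using lin p by (intro T(3)[symmetric] linear_on_scale[OF X] T(1)[OF p] x)
      (simp_all add: T(2) carr_closed P linear_on_def)
  assume q: "q \<in> carr P"
  show "tlift V W X (h (p + q)) x = tlift V W X (h p) x + tlift V W X (h q) x"
    using lin p q by (intro T(3)[symmetric] linear_on_plus[OF X] T(1)[OF p] T(1)[OF q] x)
      (simp_all add: T(2) carr_closed P linear_on_def)
qed

definition quadrilinear_on where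
  "quadrilinear_on U V W X s H \<longleftrightarrow>
     (\<forall>v\<in>carr V. \<forall>w\<in>carr W. \<forall>x\<in>carr X. linear_on (smul U) (carr U) s (\<lambda>u. H u v w x)) \<and>
     (\<forall>u\<in>carr U. \<forall>w\<in>carr W. \<forall>x\<in>carr X. linear_on (smul V) (carr V) s (\<lambda>v. H u v w x)) \<and>
     (\<forall>u\<in>carr U. \<forall>v\<in>carr V. \<forall>x\<in>carr X. linear_on (smul W) (carr W) s (\<lambda>w. H u v w x)) \<and>
     (\<forall>u\<in>carr U. \<forall>v\<in>carr V. \<forall>w\<in>carr W. linear_on (smul X) (carr X) s (\<lambda>x. H u v w x))"

text \<open>The two ways of nesting the lifts of one quadrilinear map: by pairs, as in
  \<open>rebracket\<close>, and from the outside inwards, as in \<open>unrebracket\<close>. In the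
  last claim \<open>s\<close> is a general tensor, because the map in the middle later produces
  values that need not be pure.\<close>

lemma tlift_tlift:
  assumes gs: "graded_space U" "graded_space V" "graded_space W" "graded_space X"
    and Y: "vector_space (smul Y)" and H: "quadrilinear_on U V W X (smul Y) H"
  shows "bilinear_on (U \<otimes> V) (W \<otimes> X) (smul Y)
      (\<lambda>p q. tlift U V Y (\<lambda>u v. tlift W X Y (\<lambda>w x. H u v w x) q) p)" (is ?th1)
    and "u \<in> carr U \<Longrightarrow> v \<in> carr V \<Longrightarrow> w \<in> carr W \<Longrightarrow> x \<in> carr X \<Longrightarrow>
      tlift U V Y (\<lambda>u v. tlift W X Y (\<lambda>w x. H u v w x) (tens W X w x)) (tens U V u v) = H u v w x"
    and "bilinear_on U ((V \<otimes> W) \<otimes> X) (smul Y)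
      (\<lambda>u r. tlift (V \<otimes> W) X Y (\<lambda>s x. tlift V W Y (\<lambda>v w. H u v w x) s) r)" (is ?th3)
    and "u \<in> carr U \<Longrightarrow> s \<in> carr (V \<otimes> W) \<Longrightarrow> x \<in> carr X \<Longrightarrow>
      tlift (V \<otimes> W) X Y (\<lambda>s x. tlift V W Y (\<lambda>v w. H u v w x) s) (tens (V \<otimes> W) X s x)
       = tlift V W Y (\<lambda>v w. H u v w x) s"
proof -
  have H1: "\<And>v w x. v \<in> carr V \<Longrightarrow> w \<in> carr W \<Longrightarrow> x \<in> carr X \<Longrightarrow>
      linear_on (smul U) (carr U) (smul Y) (\<lambda>u. H u v w x)"
    and H2: "\<And>u w x. u \<in> carr U \<Longrightarrow> w \<in> carr W \<Longrightarrow> x \<in> carr X \<Longrightarrow>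
      linear_on (smul V) (carr V) (smul Y) (\<lambda>v. H u v w x)"
    and H3: "\<And>u v x. u \<in> carr U \<Longrightarrow> v \<in> carr V \<Longrightarrow> x \<in> carr X \<Longrightarrow>
      linear_on (smul W) (carr W) (smul Y) (\<lambda>w. H u v w x)"
    and H4: "\<And>u v w. u \<in> carr U \<Longrightarrow> v \<in> carr V \<Longrightarrow> w \<in> carr W \<Longrightarrow>
      linear_on (smul X) (carr X) (smul Y) (\<lambda>x. H u v w x)"
    using H unfolding quadrilinear_on_def by blast+
  note gp = graded_space_tprod
  have b1: "bilinear_on W X (smul Y) (\<lambda>w x. H u v w x)" if "u \<in> carr U" "v \<in> carr V" for u v
    by (rule bilinear_onI) (use H3 H4 that in auto)
  have b2: "bilinear_on U V (smul Y) (\<lambda>u v. tlift W X Y (\<lambda>w x. H u v w x) q)"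
    if "q \<in> carr (W \<otimes> X)" for q
    by (rule bilinear_onI; rule linear_on_tlift_param) (use H1 H2 b1 gs Y that in auto)
  show ?th1
  proof (rule bilinear_onI)
    fix q assume q: "q \<in> carr (W \<otimes> X)"
    show "linear_on (smul (U \<otimes> V)) (carr (U \<otimes> V)) (smul Y)
          (\<lambda>p. tlift U V Y (\<lambda>u v. tlift W X Y (\<lambda>w x. H u v w x) q) p)"
      using tensor_universal(1)[OF gs(1,2) Y b2[OF q]] by simp
  next
    fix p assume p: "p \<in> carr (U \<otimes> V)"
    show "linear_on (smul (W \<otimes> X)) (carr (W \<otimes> X)) (smul Y)
          (\<lambda>q. tlift U V Y (\<lambda>u v. tlift W X Y (\<lambda>w x. H u v w x) q) p)"
      by (rule linear_on_tlift_param[OF gs(1,2) Y gp[OF gs(3,4)] b2 _ p])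
        (use tensor_universal(1)[OF gs(3,4) Y b1] in auto)
  qed
  show "tlift U V Y (\<lambda>u v. tlift W X Y (\<lambda>w x. H u v w x) (tens W X w x)) (tens U V u v) = H u v w x"
    if "u \<in> carr U" "v \<in> carr V" "w \<in> carr W" "x \<in> carr X"
    using that tensor_universal(2)[OF gs(1,2) Y b2[OF tens_carr[OF gs(3,4) that(3,4)]] that(1,2)]
      tensor_universal(2)[OF gs(3,4) Y b1[OF that(1,2)] that(3,4)] by simp
  have b3: "bilinear_on V W (smul Y) (\<lambda>v w. H u v w x)" if "u \<in> carr U" "x \<in> carr X" for u x
    by (rule bilinear_onI) (use H2 H3 that in auto)
  have b4: "bilinear_on (V \<otimes> W) X (smul Y) (\<lambda>s x. tlift V W Y (\<lambda>v w. H u v w x) s)"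
    if u: "u \<in> carr U" for u
  proof (rule bilinear_onI)
    fix x assume x: "x \<in> carr X"
    show "linear_on (smul (V \<otimes> W)) (carr (V \<otimes> W)) (smul Y) (tlift V W Y (\<lambda>v w. H u v w x))"
      using tensor_universal(1)[OF gs(2,3) Y b3[OF u x]] by simp
  next
    fix s assume s: "s \<in> carr (V \<otimes> W)"
    show "linear_on (smul X) (carr X) (smul Y) (\<lambda>x. tlift V W Y (\<lambda>v w. H u v w x) s)"
      by (rule linear_on_tlift_param) (use H4 b3 gs Y u s in auto)
  qed
  show ?th3
  proof (rule bilinear_onI)
    fix r assume r: "r \<in> carr ((V \<otimes> W) \<otimes> X)"
    show "linear_on (smul U) (carr U) (smul Y)
          (\<lambda>u. tlift (V \<otimes> W) X Y (\<lambda>s x. tlift V W Y (\<lambda>v w. H u v w x) s) r)"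
      by (rule linear_on_tlift_param[OF gp[OF gs(2,3)] gs(4) Y gs(1) b4 _ r], assumption,
          rule linear_on_tlift_param) (use H1 b3 gs Y in auto)
  next
    fix u assume u: "u \<in> carr U"
    show "linear_on (smul ((V \<otimes> W) \<otimes> X)) (carr ((V \<otimes> W) \<otimes> X)) (smul Y)
       (\<lambda>r. tlift (V \<otimes> W) X Y (\<lambda>s x. tlift V W Y (\<lambda>v w. H u v w x) s) r)"
      using tensor_universal(1)[OF gp[OF gs(2,3)] gs(4) Y b4[OF u]] by simp
  qed
  show "tlift (V \<otimes> W) X Y (\<lambda>s x. tlift V W Y (\<lambda>v w. H u v w x) s) (tens (V \<otimes> W) X s x)
       = tlift V W Y (\<lambda>v w. H u v w x) s"
    if "u \<in> carr U" "s \<in> carr (V \<otimes> W)" "x \<in> carr X"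
    using tensor_universal(2)[OF gp[OF gs(2,3)] gs(4) Y b4[OF that(1)] that(2,3)] .
qed

section \<open>Twisting maps evaluated on pure tensors\<close>

lemma graded_linear_carr:
  assumes V: "graded_space V" and X: "graded_space X" and f: "graded_linear V X f" and x: "x \<in>
      carr V"
  shows "f x \<in> carr X"
  by (rule carr_subspaceI[OF V graded_spaceD(1)[OF X] _ graded_spaceD(3)[OF X] _ x])
    (use f in \<open>auto simp: graded_linear_def intro: graded_spaceD(4)[OF X]\<close>)

lemma graded_algebraD:
  assumes "graded_algebra A"
  shows "graded_space A" "bilinear_on A A (smul A) (mul A)"
    "x \<in> gr A m \<Longrightarrow> y \<in> gr A n \<Longrightarrow> mul A x y \<in> gr A (m + n)"
    "x \<in> carr A \<Longrightarrow> y \<in> carr A \<Longrightarrow> z \<in> carr A \<Longrightarrow> mul A (mul A x y) z = mul A x (mul A y z)"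
    "x \<in> carr A \<Longrightarrow> mul A (one A) x = x" "x \<in> carr A \<Longrightarrow> mul A x (one A) = x"
    "gr A 0 = range (\<lambda>c. smul A c (one A))" "\<exists>S. finite S \<and> gr A n = module.span (smul A) S"
    "one A \<in> gr A 0" "x \<in> carr A \<Longrightarrow> y \<in> carr A \<Longrightarrow> mul A x y \<in> carr A"
proof -
  show gA: "graded_space A" and bil: "bilinear_on A A (smul A) (mul A)"
    and prod: "x \<in> gr A m \<Longrightarrow> y \<in> gr A n \<Longrightarrow> mul A x y \<in> gr A (m + n)"
    and "x \<in> carr A \<Longrightarrow> y \<in> carr A \<Longrightarrow> z \<in> carr A \<Longrightarrow> mul A (mul A x y) z = mul A x (mul A y z)"
    "x \<in> carr A \<Longrightarrow> mul A (one A) x = x" "x \<in> carr A \<Longrightarrow> mul A x (one A) = x"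
    and r: "gr A 0 = range (\<lambda>c. smul A c (one A))" 
    and "\<exists>S. finite S \<and> gr A n = module.span (smul A) S" for x y z m n
    using assms by (simp_all add: graded_algebra_def)
  interpret vector_space "smul A" using gA by (rule graded_spaceD)
  have "smul A 1 (one A) \<in> gr A 0" unfolding r by (rule rangeI)
  then show "one A \<in> gr A 0" by simp
  note c = graded_spaceD(4)[OF gA]
  have 1: "mul A x y \<in> carr A" if x: "x \<in> gr A n" and y: "y \<in> carr A" for x y n
    by (rule carr_subspaceI[OF gA graded_spaceD(1)[OF gA] bilinear_onD(2)[OF bil c[OF x]]
        graded_spaceD(3)[OF gA] _ y])
     (rule c[OF prod[OF x]])
  show "mul A x y \<in> carr A" if x: "x \<in> carr A" and y: "y \<in> carr A" for x y
    by (rule carr_subspaceI[OF gA graded_spaceD(1)[OF gA] bilinear_onD(1)[OF bil y]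
        graded_spaceD(3)[OF gA] _ x])
     (rule 1[OF _ y])
qed

lemma mu:
  assumes A: "graded_algebra A"
  shows "linear_on fun_scale (carr (A \<otimes> A)) (smul A) (mu A)"
    "x \<in> carr A \<Longrightarrow> y \<in> carr A \<Longrightarrow> mu A (tens A A x y) = mul A x y"
    "p \<in> carr (A \<otimes> A) \<Longrightarrow> mu A p \<in> carr A"
    "p \<in> gr (A \<otimes> A) n \<Longrightarrow> mu A p \<in> gr A n"
proof -
  note gA = graded_algebraD(1)[OF A] and vA = graded_spaceD(1)[OF graded_algebraD(1)[OF A]]
  note T = tensor_universal[OF gA gA vA graded_algebraD(2)[OF A]]
  show "linear_on fun_scale (carr (A \<otimes> A)) (smul A) (mu A)"
    using T(1) by (simp add: mu_def)
  show "x \<in> carr A \<Longrightarrow> y \<in> carr A \<Longrightarrow> mu A (tens A A x y) = mul A x y"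
    using T(2) by (simp add: mu_def)
  show "mu A p \<in> carr A" if "p \<in> carr (A \<otimes> A)"
    unfolding mu_def
    by (rule tlift_in[OF gA gA vA graded_algebraD(2)[OF A] graded_spaceD(3)[OF gA] _ that])
      (rule graded_algebraD[OF A])
  show "mu A p \<in> gr A n" if "p \<in> gr (A \<otimes> A) n"
    unfolding mu_def
    by (rule tlift_gr[OF gA gA vA graded_algebraD(2)[OF A] graded_spaceD(2)[OF gA] _ that])
      (use graded_algebraD(3)[OF A] in blast)
qed

lemma tmap:
  assumes gs: "graded_space V" "graded_space W" "graded_space V'" "graded_space W'"
    and f: "linear_on (smul V) (carr V) (smul V') f" "\<And>v. v \<in> carr V \<Longrightarrow> f v \<in> carr V'"
    and g: "linear_on (smul W) (carr W) (smul W') g" "\<And>v. v \<in> carr W \<Longrightarrow> g v \<in> carr W'"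
  shows "linear_on fun_scale (carr (V \<otimes> W)) fun_scale (tmap V W V' W' f g)"
    "v \<in> carr V \<Longrightarrow> w \<in> carr W \<Longrightarrow> tmap V W V' W' f g (tens V W v w) = tens V' W' (f v) (g w)"
    "p \<in> carr (V \<otimes> W) \<Longrightarrow> tmap V W V' W' f g p \<in> carr (V' \<otimes> W')"
    "(\<And>k v. v \<in> gr V k \<Longrightarrow> f v \<in> gr V' k) \<Longrightarrow> (\<And>k v. v \<in> gr W k \<Longrightarrow> g v \<in> gr W' k) \<Longrightarrow>
      p \<in> gr (V \<otimes> W) n \<Longrightarrow> tmap V W V' W' f g p \<in> gr (V' \<otimes> W') n"
proof -
  have gVW': "graded_space (V' \<otimes> W')" by (intro graded_space_tprod gs)
  have vs: "vector_space (smul (V' \<otimes> W'))" using graded_spaceD(1)[OF gVW'] .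
  have bil: "bilinear_on V W (smul (V' \<otimes> W')) (\<lambda>v w. tens V' W' (f v) (g w))"
    by (rule bilinear_onI) (use f g in \<open>simp_all add: linear_on_tens_comp\<close>)
  note T = tensor_universal[OF gs(1,2) vs bil]
  show "linear_on fun_scale (carr (V \<otimes> W)) fun_scale (tmap V W V' W' f g)"
    using T(1) by (simp add: tmap_def)
  show "v \<in> carr V \<Longrightarrow> w \<in> carr W \<Longrightarrow> tmap V W V' W' f g (tens V W v w) = tens V' W' (f v) (g w)"
    using T(2) by (simp add: tmap_def)
  show "tmap V W V' W' f g p \<in> carr (V' \<otimes> W')" if "p \<in> carr (V \<otimes> W)"
    unfolding tmap_def
    by (rule tlift_in[OF gs(1,2) vs bil graded_spaceD(3)[OF gVW'] _ that])
      (intro tens_carr gs f g)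
  show "tmap V W V' W' f g p \<in> gr (V' \<otimes> W') n"
    if "\<And>k v. v \<in> gr V k \<Longrightarrow> f v \<in> gr V' k" "\<And>k v. v \<in> gr W k \<Longrightarrow> g v \<in> gr W' k" "p \<in> gr (V \<otimes> W) n"
    unfolding tmap_def
    by (rule tlift_gr[OF gs(1,2) vs bil graded_spaceD(2)[OF gVW'] _ that(3)])
      (use that(1,2) in \<open>blast intro: tens_gr\<close>)
qed

text \<open>Rebracketing brings \<open>v\<close> and \<open>w\<close> together so that
  \<open>f\<close> can act on them. As \<open>f (tens V W v w)\<close> need not be pure, the last
  claim distributes it to the outer factors by a lift.\<close>

lemma mid_map:
  fixes V :: "('k::field, 'v::ab_group_add, 'm) gspace_scheme"
    and W :: "('k, 'w::ab_group_add, 'n) gspace_scheme"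
  assumes gs: "graded_space U" "graded_space V" "graded_space W" "graded_space X"
      "graded_space V'" "graded_space W'"
    and f: "linear_on fun_scale (carr (V \<otimes> W)) fun_scale f" "\<And>p. p \<in> carr (V \<otimes> W) \<Longrightarrow>
        f p \<in> carr (V' \<otimes> W')"
  shows "linear_on fun_scale (carr ((U \<otimes> V) \<otimes> (W \<otimes> X))) fun_scale (mid_map U V W X V' W' f)"
    "p \<in> carr ((U \<otimes> V) \<otimes> (W \<otimes> X)) \<Longrightarrow> mid_map U V W X V' W' f p \<in> carr ((U \<otimes> V') \<otimes> (W' \<otimes> X))"
    "u \<in> carr U \<Longrightarrow> v \<in> carr V \<Longrightarrow> w \<in> carr W \<Longrightarrow> x \<in> carr X \<Longrightarrow>
      mid_map U V W X V' W' f (tens (U \<otimes> V) (W \<otimes> X) (tens U V u v) (tens W X w x)) =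
      tlift V' W' ((U \<otimes> V') \<otimes> (W' \<otimes> X)) (\<lambda>v' w'. tens (U \<otimes> V') (W' \<otimes> X) (tens U V' u v') (tens W'
          X w' x))
        (f (tens V W v w))"
proof -
  note gp = graded_space_tprod
  note [simp] = gs gp tens_carr
  let ?Y = "U \<otimes> ((V \<otimes> W) \<otimes> X)" and ?Z = "(U \<otimes> V') \<otimes> (W' \<otimes> X)" and ?Y' = "U \<otimes> ((V' \<otimes> W') \<otimes> X)"
  have vY: "vector_space (smul ?Y)" and vZ: "vector_space (smul ?Z)"
    by (rule graded_spaceD(1); simp)+
  have R: "quadrilinear_on U V W X (smul ?Y) (\<lambda>u v w x. tens U ((V \<otimes> W) \<otimes> X) u (tens (V \<otimes> W) X
      (tens V W v w) x))"
    and S: "quadrilinear_on U V' W' X (smul ?Z) (\<lambda>u v w x. tens (U \<otimes> V') (W' \<otimes> X) (tens U V' u v)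
        (tens W' X w x))"
    by (simp_all add: quadrilinear_on_def linear_on_tens_comp linear_on_tens)
  note TR = tlift_tlift(1,2)[OF gs(1-4) vY R]
  have re1: "linear_on fun_scale (carr ((U \<otimes> V) \<otimes> (W \<otimes> X))) fun_scale (rebracket U V W X)"
    unfolding rebracket_def Let_def
    using tensor_universal(1)[OF _ _ vY TR(1)] by simp
  have re2: "rebracket U V W X (tens (U \<otimes> V) (W \<otimes> X) (tens U V u v) (tens W X w x))
     = tens U ((V \<otimes> W) \<otimes> X) u (tens (V \<otimes> W) X (tens V W v w) x)"
    if "u \<in> carr U" "v \<in> carr V" "w \<in> carr W" "x \<in> carr X" for u v w x
    unfolding rebracket_def Let_def
    using that tensor_universal(2)[OF _ _ vY TR(1)] TR(2)[OF that] by simp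
  have re3: "rebracket U V W X p \<in> carr ?Y" if p: "p \<in> carr ((U \<otimes> V) \<otimes> (W \<otimes> X))" for p
  proof (rule tprod_carr_subspaceI[OF _ _ _ re1 _ _ p])
    fix q r assume q: "q \<in> carr (U \<otimes> V)" and r: "r \<in> carr (W \<otimes> X)"
    show "rebracket U V W X (tens (U \<otimes> V) (W \<otimes> X) q r) \<in> carr ?Y"
    proof (rule tprod_carr_subspaceI[OF _ _ _ _ _ _ q])
      show "linear_on fun_scale (carr (U \<otimes> V)) fun_scale (\<lambda>q. rebracket U V W X (tens (U \<otimes> V)
          (W \<otimes> X) q r))"
        by (rule linear_on_comp[OF linear_on_tens(1)[of _ _ "U \<otimes> V", simplified] _ re1])
            (simp_all add: r)
      fix u v assume uv: "u \<in> carr U" "v \<in> carr V"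
      show "rebracket U V W X (tens (U \<otimes> V) (W \<otimes> X) (tens U V u v) r) \<in> carr ?Y"
        by (rule tprod_carr_subspaceI[OF _ _ _ _ _ _ r], simp, simp, rule vY[unfolded smul_tprod],
            rule linear_on_comp[OF linear_on_tens(2)[of _ _ "W \<otimes> X", simplified] _ re1])
          (use graded_spaceD(3)[of ?Y] in \<open>simp_all add: uv re2\<close>)
    qed (use graded_spaceD(3)[of ?Y] vY in simp_all)
  qed (use graded_spaceD(3)[of ?Y] vY in simp_all)
  note TS = tlift_tlift(3,4)[OF gs(1,5,6,4) vZ S]
  have un1: "linear_on fun_scale (carr ?Y') fun_scale (unrebracket U V' W' X)"
    unfolding unrebracket_def Let_def
    using tensor_universal(1)[OF _ _ vZ TS(1)] by simp
  have un2: "unrebracket U V' W' X (tens U ((V' \<otimes> W') \<otimes> X) u (tens (V' \<otimes> W') X s x))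
     = tlift V' W' ?Z (\<lambda>v' w'. tens (U \<otimes> V') (W' \<otimes> X) (tens U V' u v') (tens W' X w' x)) s"
    if "u \<in> carr U" "s \<in> carr (V' \<otimes> W')" "x \<in> carr X" for u s x
    unfolding unrebracket_def Let_def
    using that tensor_universal(2)[OF _ _ vZ TS(1)] TS(2)[OF that] by simp
  have un3: "unrebracket U V' W' X p \<in> carr ?Z" if p: "p \<in> carr ?Y'" for p
  proof (rule tprod_carr_subspaceI[OF _ _ _ un1 _ _ p])
    fix u q assume u: "u \<in> carr U" and q: "q \<in> carr ((V' \<otimes> W') \<otimes> X)"
    show "unrebracket U V' W' X (tens U ((V' \<otimes> W') \<otimes> X) u q) \<in> carr ?Z"
    proof (rule tprod_carr_subspaceI[OF _ _ _ _ _ _ q])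
      show "linear_on fun_scale (carr ((V' \<otimes> W') \<otimes> X)) fun_scale
         (\<lambda>q. unrebracket U V' W' X (tens U ((V' \<otimes> W') \<otimes> X) u q))"
        by (rule linear_on_comp[OF linear_on_tens(2)[of _ _ "(V' \<otimes> W') \<otimes> X", simplified] _ un1])
            (simp_all add: u)
      fix s x assume s: "s \<in> carr (V' \<otimes> W')" and x: "x \<in> carr X"
      show "unrebracket U V' W' X (tens U ((V' \<otimes> W') \<otimes> X) u (tens (V' \<otimes> W') X s x)) \<in> carr ?Z"
        unfolding un2[OF u s x]
        by (rule tlift_in[OF _ _ vZ _ graded_spaceD(3) _ s])
          (use S in \<open>auto intro!: bilinear_onI simp: quadrilinear_on_def u x\<close>)
    qed (use graded_spaceD(3)[of ?Z] vZ in simp_all)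
  qed (use graded_spaceD(3)[of ?Z] vZ in simp_all)
  have vV: "vector_space (smul V)" "vector_space (fun_scale :: 'k \<Rightarrow> (('v \<Rightarrow> 'w \<Rightarrow> 'k) \<Rightarrow> 'k) \<Rightarrow> _)"
    by (simp_all add: graded_spaceD(1) vector_space_fun_scale)
  let ?g = "tmap (V \<otimes> W) X (V' \<otimes> W') X f id"
  have g: "linear_on fun_scale (carr ((V \<otimes> W) \<otimes> X)) fun_scale ?g"
    "\<And>v w. v \<in> carr (V \<otimes> W) \<Longrightarrow> w \<in> carr X \<Longrightarrow> ?g (tens (V \<otimes> W) X v w) = tens (V' \<otimes> W') X (f v) w"
    "\<And>p. p \<in> carr ((V \<otimes> W) \<otimes> X) \<Longrightarrow> ?g p \<in> carr ((V' \<otimes> W') \<otimes> X)"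
    using tmap(1-3)[of "V \<otimes> W" X "V' \<otimes> W'" X f id] f by (simp_all add: linear_on_id id_def)
  let ?h = "tmap U ((V \<otimes> W) \<otimes> X) U ((V' \<otimes> W') \<otimes> X) id ?g"
  have h: "linear_on fun_scale (carr ?Y) fun_scale ?h"
    "\<And>v w. v \<in> carr U \<Longrightarrow> w \<in> carr ((V \<otimes> W) \<otimes> X) \<Longrightarrow> ?h (tens U ((V \<otimes> W) \<otimes> X) v w) =
        tens U ((V' \<otimes> W') \<otimes> X) v (?g w)"
    "\<And>p. p \<in> carr ?Y \<Longrightarrow> ?h p \<in> carr ?Y'"
    using tmap(1-3)[of U "(V \<otimes> W) \<otimes> X" U "(V' \<otimes> W') \<otimes> X" id ?g] g by
        (simp_all add: linear_on_id id_def)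
  show "linear_on fun_scale (carr ((U \<otimes> V) \<otimes> (W \<otimes> X))) fun_scale (mid_map U V W X V' W' f)"
    unfolding mid_map_def comp_def
    by (rule linear_on_comp[OF linear_on_comp[OF re1 re3 h(1)] _ un1]) (auto intro!: h(3) re3)
  show "mid_map U V W X V' W' f p \<in> carr ?Z" if "p \<in> carr ((U \<otimes> V) \<otimes> (W \<otimes> X))"
    unfolding mid_map_def comp_def by (intro un3 h(3) re3 that)
  show "mid_map U V W X V' W' f (tens (U \<otimes> V) (W \<otimes> X) (tens U V u v) (tens W X w x)) =
      tlift V' W' ?Z (\<lambda>v' w'. tens (U \<otimes> V') (W' \<otimes> X) (tens U V' u v') (tens W' X w' x))
        (f (tens V W v w))" if "u \<in> carr U" "v \<in> carr V" "w \<in> carr W" "x \<in> carr X"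
    using that f(2) by (simp add: mid_map_def re2 h(2) g(2) un2)
qed

section \<open>Products on A \<otimes> B attached to graded linear maps from B \<otimes> A to A
  \<otimes> B\<close>

locale algebra_pair =
  fixes A :: "('k::field, 'a::ab_group_add) galgebra"
    and B :: "('k, 'b::ab_group_add) galgebra"
  assumes A: "graded_algebra A" and B: "graded_algebra B"
begin

abbreviation "C \<equiv> A \<otimes> B"
abbreviation "D \<equiv> B \<otimes> A"
abbreviation "tBBAA \<equiv> tens (B \<otimes> B) (A \<otimes> A)"
abbreviation "muBA \<equiv> tmap (B \<otimes> B) (A \<otimes> A) B A (mu B) (mu A)"
abbreviation "tAB \<equiv> tens A B"
abbreviation "tBA \<equiv> tens B A"
abbreviation "tA a \<equiv> tAB a (one B)"
abbreviation "tB b \<equiv> tAB (one A) b"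
abbreviation "glin t \<equiv> graded_linear D C t"

text \<open>
  The multiplication of $A \otimes_t B$, for an arbitrary linear map \<open>t\<close> in place of a
  twisting map.
\<close>

definition tmul where
  "tmul t x y =
     (tmap (A \<otimes> A) (B \<otimes> B) A B (mu A) (mu B) \<circ> mid_map A B A B A B t) (tens (A \<otimes> B) (A \<otimes> B) x y)"

text \<open>$x \mapsto a x b$ for the $A$-$B$-bimodule structure of $A \otimes B$.\<close>

definition act where
  "act a b = tmap A B A B (mul A a) (\<lambda>w. mul B w b)"

lemma gs [simp]: "graded_space A" "graded_space B" "graded_space C" "graded_space D"
  using graded_algebraD(1)[OF A] graded_algebraD(1)[OF B] by (auto intro: graded_space_tprod)

lemma vs [simp]: "vector_space (smul A)" "vector_space (smul B)"
  "vector_space (fun_scale :: 'k \<Rightarrow> ('f \<Rightarrow> 'k) \<Rightarrow> _)"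
  by (simp_all add: graded_spaceD vector_space_fun_scale)

lemma sub [simp]: "module.subspace fun_scale (carr C)" "module.subspace fun_scale (carr D)"
  "module.subspace fun_scale (gr C n)" "module.subspace fun_scale (gr D n)"
  using graded_spaceD(2,3)[of C] graded_spaceD(2,3)[of D] by auto

lemmas gr_carr = graded_spaceD(4)[OF gs(1)] graded_spaceD(4)[OF gs(2)]
  graded_spaceD(4)[OF gs(3)] graded_spaceD(4)[OF gs(4)]

lemma C_closed [simp]:
  "x \<in> carr C \<Longrightarrow> y \<in> carr C \<Longrightarrow> x + y \<in> carr C"
  "x \<in> carr C \<Longrightarrow> y \<in> carr C \<Longrightarrow> x - y \<in> carr C"
  "x \<in> carr C \<Longrightarrow> fun_scale c x \<in> carr C" "0 \<in> carr C"
  using carr_closed[of C] by auto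

lemma A_closed [simp]:
  "x \<in> carr A \<Longrightarrow> y \<in> carr A \<Longrightarrow> x + y \<in> carr A" "x \<in> carr A \<Longrightarrow> smul A c x \<in> carr A"
  "v \<in> carr B \<Longrightarrow> w \<in> carr B \<Longrightarrow> v + w \<in> carr B" "v \<in> carr B \<Longrightarrow> smul B c v \<in> carr B"
  "0 \<in> carr A" "0 \<in> carr B"
  using carr_closed[of A] carr_closed[of B] by auto

lemma tens_in [simp]:
  "a \<in> carr A \<Longrightarrow> b \<in> carr B \<Longrightarrow> tAB a b \<in> carr C"
  "a \<in> carr A \<Longrightarrow> b \<in> carr B \<Longrightarrow> tBA b a \<in> carr D"
  by (simp_all add: tens_carr)

lemma one_in [simp]: "one A \<in> carr A" "one B \<in> carr B" "one A \<in> gr A 0" "one B \<in> gr B 0"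
  using graded_algebraD(9)[OF A] graded_algebraD(9)[OF B] gr_carr by auto

lemma mul_in [simp]:
  "x \<in> carr A \<Longrightarrow> y \<in> carr A \<Longrightarrow> mul A x y \<in> carr A"
  "v \<in> carr B \<Longrightarrow> w \<in> carr B \<Longrightarrow> mul B v w \<in> carr B"
  using graded_algebraD(10)[OF A] graded_algebraD(10)[OF B] by auto

lemma mul_one [simp]:
  "x \<in> carr A \<Longrightarrow> mul A (one A) x = x" "x \<in> carr A \<Longrightarrow> mul A x (one A) = x"
  "v \<in> carr B \<Longrightarrow> mul B (one B) v = v" "v \<in> carr B \<Longrightarrow> mul B v (one B) = v"
  using graded_algebraD(5,6)[OF A] graded_algebraD(5,6)[OF B] by auto

lemma mul_lin:
  "y \<in> carr A \<Longrightarrow> linear_on (smul A) (carr A) (smul A) (\<lambda>x. mul A x y)"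
  "x \<in> carr A \<Longrightarrow> linear_on (smul A) (carr A) (smul A) (mul A x)"
  "y' \<in> carr B \<Longrightarrow> linear_on (smul B) (carr B) (smul B) (\<lambda>x. mul B x y')"
  "x' \<in> carr B \<Longrightarrow> linear_on (smul B) (carr B) (smul B) (mul B x')"
  using bilinear_onD[OF graded_algebraD(2)[OF A]] bilinear_onD[OF graded_algebraD(2)[OF B]] by auto

lemma tens_lin:
  "b \<in> carr B \<Longrightarrow> linear_on (smul A) (carr A) fun_scale (\<lambda>a. tAB a b)"
  "a \<in> carr A \<Longrightarrow> linear_on (smul B) (carr B) fun_scale (\<lambda>b. tAB a b)"
  "b \<in> carr B \<Longrightarrow> linear_on (smul A) (carr A) fun_scale (\<lambda>a. tBA b a)"
  "a \<in> carr A \<Longrightarrow> linear_on (smul B) (carr B) fun_scale (\<lambda>b. tBA b a)"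
  by (simp_all add: linear_on_tens)

lemma glinD:
  assumes "glin t"
  shows "linear_on fun_scale (carr D) fun_scale t" "x \<in> gr D n \<Longrightarrow> t x \<in> gr C n"
    "x \<in> carr D \<Longrightarrow> t x \<in> carr C"
  using assms graded_linear_carr[OF gs(4,3) assms] by (auto simp: graded_linear_def)

lemma act_lin:
  assumes "a \<in> carr A" "b \<in> carr B"
  shows "linear_on fun_scale (carr C) fun_scale (act a b)"
    and "c \<in> carr C \<Longrightarrow> act a b c \<in> carr C"
    and "v \<in> carr A \<Longrightarrow> w \<in> carr B \<Longrightarrow> act a b (tAB v w) = tAB (mul A a v) (mul B w b)"
  unfolding act_def using tmap(1-3)[OF gs(1,2,1,2), of "mul A a" "\<lambda>w. mul B w b"] assms
  by (simp_all add: mul_lin)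

lemma act_gr:
  assumes a: "a \<in> gr A i" and b: "b \<in> gr B k" and c: "c \<in> gr C j" and n: "i + j + k = n"
  shows "act a b c \<in> gr C n"
proof (rule tprod_subspaceI[OF gs(1,2) vs(3) _ _ _ c])
  note ab = gr_carr(1)[OF a] gr_carr(2)[OF b]
  show "linear_on fun_scale (carr C) fun_scale (act a b)" by (rule act_lin[OF ab])
  fix v w p q assume vw: "v \<in> gr A p" "w \<in> gr B q" "p + q = j"
  show "act a b (tAB v w) \<in> gr C n"
    unfolding act_lin(3)[OF ab gr_carr(1)[OF vw(1)] gr_carr(2)[OF vw(2)]]
    by (rule tens_gr[OF graded_algebraD(3)[OF A a vw(1)] graded_algebraD(3)[OF B vw(2) b]])
      (use n vw(3) in simp)
qed simp

lemma act_act: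
  assumes "a \<in> carr A" "b \<in> carr B" "a' \<in> carr A" "b' \<in> carr B" "c \<in> carr C"
  shows "act a b (act a' b' c) = act (mul A a a') (mul B b' b) c"
  by (rule tprod_carr_eqI[OF gs(1,2) vs(3) linear_on_comp[OF act_lin(1) _ act_lin(1)] act_lin(1) _
      assms(5)])
    (use assms graded_algebraD(4)[OF A] graded_algebraD(4)[OF B] in \<open>simp_all add: act_lin\<close>)

lemma act_one:
  assumes "c \<in> carr C" shows "act (one A) (one B) c = c"
  by (rule tprod_carr_eqI[OF gs(1,2) vs(3) act_lin(1) linear_on_id _ assms])
    (simp_all add: act_lin)

text \<open>Linearity in the outer factors is what later lets a scalar multiple of the unit act as
  multiplication by that scalar.\<close>

lemma act_lin_param:
  assumes c: "c \<in> carr C"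
  shows "b \<in> carr B \<Longrightarrow> linear_on (smul A) (carr A) fun_scale (\<lambda>a. act a b c)"
    and "a \<in> carr A \<Longrightarrow> linear_on (smul B) (carr B) fun_scale (\<lambda>b. act a b c)"
proof -
  have bil: "bilinear_on A B (smul C) (\<lambda>v w. tAB (mul A a v) (mul B w b))"
    if "a \<in> carr A" "b \<in> carr B" for a b
    by (rule bilinear_onI) (use that in \<open>auto intro!: linear_on_tens_comp mul_lin\<close>)
  show "linear_on (smul A) (carr A) fun_scale (\<lambda>a. act a b c)" if b: "b \<in> carr B"
    unfolding act_def tmap_def smul_tprod[of A B, symmetric]
    by (rule linear_on_tlift_param[OF gs(1,2) _ gs(1) bil _ c])
      (use b in \<open>auto intro!: linear_on_tens_comp mul_lin\<close>)
  show "linear_on (smul B) (carr B) fun_scale (\<lambda>b. act a b c)" if a: "a \<in> carr A"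
    unfolding act_def tmap_def smul_tprod[of A B, symmetric]
    by (rule linear_on_tlift_param[OF gs(1,2) _ gs(2) bil _ c])
      (use a in \<open>auto intro!: linear_on_tens_comp mul_lin\<close>)
qed

lemma mu_mu:
  "linear_on fun_scale (carr ((A \<otimes> A) \<otimes> (B \<otimes> B))) fun_scale (tmap (A \<otimes> A) (B \<otimes> B) A B (mu A)
      (mu B))"
  "p \<in> carr ((A \<otimes> A) \<otimes> (B \<otimes> B)) \<Longrightarrow> tmap (A \<otimes> A) (B \<otimes> B) A B (mu A) (mu B) p \<in> carr C"
  "x \<in> carr A \<Longrightarrow> y \<in> carr A \<Longrightarrow> v \<in> carr B \<Longrightarrow> w \<in> carr B \<Longrightarrow>
    tmap (A \<otimes> A) (B \<otimes> B) A B (mu A) (mu B) (tens (A \<otimes> A) (B \<otimes> B) (tens A A x y) (tens B B v w)) =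
    tAB (mul A x y) (mul B v w)"
  using tmap[of "A \<otimes> A" "B \<otimes> B" A B "mu A" "mu B"] mu[OF A] mu[OF B]
  by (simp_all add: graded_space_tprod tens_carr)

context
  fixes t assumes t: "glin t"
begin

lemma tmul_lin:
  "y \<in> carr C \<Longrightarrow> linear_on fun_scale (carr C) fun_scale (\<lambda>x. tmul t x y)"
  "x \<in> carr C \<Longrightarrow> linear_on fun_scale (carr C) fun_scale (\<lambda>y. tmul t x y)"
  and tmul_in [simp]: "x \<in> carr C \<Longrightarrow> y \<in> carr C \<Longrightarrow> tmul t x y \<in> carr C"
proof -
  note m = mid_map[OF gs(1,2,1,2,1,2) glinD(1,3)[OF t]]
  have g: "graded_space (C \<otimes> C)" by (simp add: graded_space_tprod)
  have l: "linear_on fun_scale (carr (C \<otimes> C)) fun_scale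
     (\<lambda>p. tmap (A \<otimes> A) (B \<otimes> B) A B (mu A) (mu B) (mid_map A B A B A B t p))"
    by (rule linear_on_comp[OF m(1,2) mu_mu(1)])
  show "linear_on fun_scale (carr C) fun_scale (\<lambda>x. tmul t x y)" if y: "y \<in> carr C"
    unfolding tmul_def comp_def
    by (rule linear_on_comp[OF linear_on_tens(1)[OF y, of C, unfolded smul_tprod] _ l])
        (simp add: tens_carr y)
  show "linear_on fun_scale (carr C) fun_scale (\<lambda>y. tmul t x y)" if x: "x \<in> carr C"
    unfolding tmul_def comp_def
    by (rule linear_on_comp[OF linear_on_tens(2)[OF x, of C, unfolded smul_tprod] _ l])
        (simp add: tens_carr x)
  show "tmul t x y \<in> carr C" if "x \<in> carr C" "y \<in> carr C"
    unfolding tmul_def comp_def by (intro mu_mu(2) m(2) tens_carr gs that)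
qed

text \<open>The familiar rule (a \<otimes> b)(a' \<otimes> b') = a t(b \<otimes> a') b'. It removes
  all rebracketing from the later computations with this product.\<close>

lemma tmul_tens:
  assumes "a \<in> carr A" "b \<in> carr B" "a' \<in> carr A" "b' \<in> carr B"
  shows "tmul t (tAB a b) (tAB a' b') = act a b' (t (tBA b a'))"
proof -
  note m = mid_map[OF gs(1,2,1,2,1,2) glinD(1,3)[OF t]]
  let ?Y = "(A \<otimes> A) \<otimes> (B \<otimes> B)"
  have gY: "graded_space (A \<otimes> A)" "graded_space (B \<otimes> B)" "graded_space ?Y" by
      (simp_all add: graded_space_tprod)
  have bil: "bilinear_on A B (smul ?Y) (\<lambda>v' w'. tens (A \<otimes> A) (B \<otimes> B) (tens A A a v') (tens B B w'
      b'))"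
    by (rule bilinear_onI)
        (use assms in \<open>auto intro!: linear_on_tens_comp linear_on_tens tens_carr\<close>)
  have "tmul t (tAB a b) (tAB a' b')
     = tmap (A \<otimes> A) (B \<otimes> B) A B (mu A) (mu B)
        (tlift A B ?Y (\<lambda>v' w'. tens (A \<otimes> A) (B \<otimes> B) (tens A A a v') (tens B B w' b'))
            (t (tBA b a')))"
    using m(3)[OF _ assms] by (simp add: tmul_def)
  also have "\<dots> = tlift A B C (\<lambda>v' w'. tmap (A \<otimes> A) (B \<otimes> B) A B (mu A) (mu B)
      (tens (A \<otimes> A) (B \<otimes> B) (tens A A a v') (tens B B w' b'))) (t (tBA b a'))"
    by (rule tlift_comp[OF gs(1,2) _ _ bil _ _ mu_mu(1)[folded smul_tprod[of "A \<otimes> A" "B \<otimes> B"]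
        smul_tprod[of A B]] glinD(3)[OF t]])
      (use assms graded_spaceD(3)[OF gY(3)] gY in \<open>simp_all add: tens_carr\<close>)
  also have "\<dots> = act a b' (t (tBA b a'))"
  proof -
    note T = tensor_universal[OF gs(1,2) _ bilinear_onI, of C]
    have bil2: "bilinear_on A B (smul C) (\<lambda>v' w'. tmap (A \<otimes> A) (B \<otimes> B) A B (mu A) (mu B)
        (tens (A \<otimes> A) (B \<otimes> B) (tens A A a v') (tens B B w' b')))"
      by (rule bilinear_onI; rule linear_on_comp[OF _ _ mu_mu(1)[folded smul_tprod[of A B]]])
       (use bilinear_onD[OF bil] gY assms in \<open>auto intro!: tens_carr\<close>)
    show ?thesis
      by (rule tensor_universal(3)[OF gs(1,2) _ bil2, symmetric])
        (use assms in \<open>simp_all add: act_lin mu_mu(3) glinD[OF t]\<close>)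
  qed
  finally show ?thesis .
qed

lemma tmul_gr:
  assumes x: "x \<in> gr C p" and y: "y \<in> gr C q" and n: "p + q = n"
  shows "tmul t x y \<in> gr C n"
proof (rule tprod_subspaceI[OF gs(1,2) vs(3) tmul_lin(1) sub(3) _ x])
  show "y \<in> carr C" using y by (rule gr_carr)
  fix a b i j assume ab: "a \<in> gr A i" "b \<in> gr B j" "i + j = p"
  show "tmul t (tAB a b) y \<in> gr C n"
  proof (rule tprod_subspaceI[OF gs(1,2) vs(3) tmul_lin(2) sub(3) _ y])
    show "tAB a b \<in> carr C" using ab gr_carr by auto
    fix a' b' k l assume ab': "a' \<in> gr A k" "b' \<in> gr B l" "k + l = q"
    show "tmul t (tAB a b) (tAB a' b') \<in> gr C n"
      using act_gr[OF ab(1) ab'(2) glinD(2)[OF t tens_gr[OF ab(2) ab'(1) refl]]] ab ab' n gr_carr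
      by (subst tmul_tens) (auto simp: add.assoc)
  qed
qed

text \<open>The map \<open>t\<close> sees only the inner factors, so outer factors pass through the
  product for every graded linear \<open>t\<close>, by associativity of A and B.\<close>

lemma tmul_act:
  assumes x: "x \<in> carr C" and y: "y \<in> carr C" and a: "a \<in> carr A" and b: "b \<in> carr B"
  shows "tmul t (act a (one B) x) (act (one A) b y) = act a b (tmul t x y)"
proof (rule tprod_carr_eqI[OF gs(1,2) vs(3) _ _ _ x])
  have y': "act (one A) b y \<in> carr C" using y b by (simp add: act_lin)
  show "linear_on fun_scale (carr C) fun_scale (\<lambda>x. tmul t (act a (one B) x) (act (one A) b y))"
    by (rule linear_on_comp[OF act_lin(1) act_lin(2) tmul_lin(1)[OF y']]) (use a in auto)
  show "linear_on fun_scale (carr C) fun_scale (\<lambda>x. act a b (tmul t x y))"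
    by (rule linear_on_comp[OF tmul_lin(1)[OF y] _ act_lin(1)]) (use a b y in auto)
  fix v w assume vw: "v \<in> carr A" "w \<in> carr B"
  show "tmul t (act a (one B) (tAB v w)) (act (one A) b y) = act a b (tmul t (tAB v w) y)"
  proof (rule tprod_carr_eqI[OF gs(1,2) vs(3) _ _ _ y])
    show "linear_on fun_scale (carr C) fun_scale (\<lambda>y. tmul t (act a (one B) (tAB v w))
        (act (one A) b y))"
      by (rule linear_on_comp[OF act_lin(1) act_lin(2) tmul_lin(2)])
          (use a b vw in \<open>auto simp: act_lin\<close>)
    show "linear_on fun_scale (carr C) fun_scale (\<lambda>y. act a b (tmul t (tAB v w) y))"
      by (rule linear_on_comp[OF tmul_lin(2) _ act_lin(1)]) (use a b vw in auto)
    fix v' w' assume vw': "v' \<in> carr A" "w' \<in> carr B"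
    show "tmul t (act a (one B) (tAB v w)) (act (one A) b (tAB v' w')) =
      act a b (tmul t (tAB v w) (tAB v' w'))"
      using a b vw vw' by (simp add: act_lin tmul_tens act_act glinD[OF t])
  qed
qed

lemma tmul_act_left:
  assumes x: "x \<in> carr C" and y: "y \<in> carr C" and a: "a \<in> carr A"
  shows "tmul t (act a (one B) x) y = act a (one B) (tmul t x y)"
  using tmul_act[OF x y a one_in(2)] by (simp add: act_one y)

lemma tmul_act_right:
  assumes x: "x \<in> carr C" and y: "y \<in> carr C" and b: "b \<in> carr B"
  shows "tmul t x (act (one A) b y) = act (one A) b (tmul t x y)"
  using tmul_act[OF x y one_in(1) b] by (simp add: act_one x)

text \<open>Of the four occurrences of \<open>t\<close>, the one applied first yields
  \<open>t (tBA b2 a1)\<close>, which is not pure in general. The other three are therefore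
  expressed by a lift evaluated there, and the second claim provides the bilinearity that this lift
  needs.\<close>

lemma twist_rhs_tens:
  assumes "b1 \<in> carr B" "b2 \<in> carr B" "a1 \<in> carr A" "a2 \<in> carr A"
  shows "twist_rhs A B t (tBBAA (tens B B b1 b2) (tens A A a1 a2))
    = tlift A B C (\<lambda>a b. tmul t (t (tBA b1 a)) (t (tBA b a2))) (t (tBA b2 a1))"
    and "bilinear_on A B fun_scale (\<lambda>a b. tmul t (t (tBA b1 a)) (t (tBA b a2)))"
proof -
  note m = mid_map[OF gs(2,2,1,1,1,2) glinD(1,3)[OF t]]
  note m2 = mid_map[OF gs(1,2,1,2,1,2) glinD(1,3)[OF t]]
  let ?Y = "D \<otimes> D"
  have gY: "graded_space ?Y" "graded_space (C \<otimes> C)" by (simp_all add: graded_space_tprod)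
  let ?h = "\<lambda>v' w'. tens D D (tBA b1 v') (tBA w' a2)"
  have bil: "bilinear_on A B (smul ?Y) ?h"
    by (rule bilinear_onI)
        (use assms in \<open>auto intro!: linear_on_tens_comp linear_on_tens tens_carr\<close>)
  let ?G = "\<lambda>p. tmap (A \<otimes> A) (B \<otimes> B) A B (mu A) (mu B) (mid_map A B A B A B t (tmap D D C C t t p))"
  have tt: "linear_on fun_scale (carr ?Y) fun_scale (tmap D D C C t t)"
    "\<And>p. p \<in> carr ?Y \<Longrightarrow> tmap D D C C t t p \<in> carr (C \<otimes> C)"
    "\<And>x y. x \<in> carr D \<Longrightarrow> y \<in> carr D \<Longrightarrow> tmap D D C C t t (tens D D x y) = tens C C (t x) (t y)"
    using tmap(1-3)[OF gs(4,4,3,3), of t t] glinD[OF t] by simp_all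
  have G: "linear_on fun_scale (carr ?Y) fun_scale ?G"
    by (rule linear_on_comp[OF linear_on_comp[OF tt(1,2) m2(1)] _ mu_mu(1)]) (auto intro!: m2 tt)
  have Gh: "?G (?h a b) = tmul t (t (tBA b1 a)) (t (tBA b a2))"
    if "a \<in> carr A" "b \<in> carr B" for a b
    using assms that by (simp add: tt tmul_def)
  have e: "mid_map B B A A A B t (tBBAA (tens B B b1 b2) (tens A A a1 a2))
     = tlift A B ?Y ?h (t (tBA b2 a1))"
    using m(3)[OF _ assms] by simp
  have 2: "?G (tlift A B ?Y ?h (t (tBA b2 a1))) = tlift A B C (\<lambda>a b. ?G (?h a b)) (t (tBA b2 a1))"
    by (rule tlift_comp[OF gs(1,2) _ _ bil _ _ G[folded smul_tprod[of D D] smul_tprod[of A B]]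
        glinD(3)[OF t]])
      (use assms graded_spaceD(3)[OF gY(1)] gY in \<open>simp_all add: tens_carr\<close>)
  have bil2: "bilinear_on A B fun_scale (\<lambda>a b. ?G (?h a b))"
    by (rule bilinear_onI; rule linear_on_comp[OF _ _ G])
       (use bilinear_onD[OF bil] gY assms in \<open>auto intro!: tens_carr\<close>)
  show 3: "bilinear_on A B fun_scale (\<lambda>a b. tmul t (t (tBA b1 a)) (t (tBA b a2)))"
    by (rule bilinear_onI; rule linear_on_cong[OF bilinear_onD(1)[OF bil2]] linear_on_cong[OF
        bilinear_onD(2)[OF bil2]])
      (use Gh graded_spaceD(3)[OF gs(1)] graded_spaceD(3)[OF gs(2)] in auto)
  have "twist_rhs A B t (tBBAA (tens B B b1 b2) (tens A A a1 a2))
     = tlift A B C (\<lambda>a b. ?G (?h a b)) (t (tBA b2 a1))"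
    unfolding twist_rhs_def comp_def e 2 ..
  also have "\<dots> = tlift A B C (\<lambda>a b. tmul t (t (tBA b1 a)) (t (tBA b a2))) (t (tBA b2 a1))"
  proof -
    note T2 = tensor_universal[OF gs(1,2) graded_spaceD(1)[OF gs(3)] bil2[folded smul_tprod[of A
        B]]]
    note T3 = tensor_universal[OF gs(1,2) graded_spaceD(1)[OF gs(3)] 3[folded smul_tprod[of A B]]]
    show ?thesis
    proof (rule tprod_carr_eqI[OF gs(1,2) vs(3) T2(1)[unfolded smul_tprod] T3(1)[unfolded
        smul_tprod]])
      show "t (tBA b2 a1) \<in> carr C" by (rule glinD(3)[OF t]) (use assms in simp)
      show "tlift A B C (\<lambda>a b. ?G (?h a b)) (tAB v w) =
        tlift A B C (\<lambda>a b. tmul t (t (tBA b1 a)) (t (tBA b a2))) (tAB v w)"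
        if "v \<in> carr A" "w \<in> carr B" for v w
        unfolding T2(2)[OF that] T3(2)[OF that] by (rule Gh[OF that])
    qed
  qed
  finally show "twist_rhs A B t (tBBAA (tens B B b1 b2) (tens A A a1 a2))
    = tlift A B C (\<lambda>a b. tmul t (t (tBA b1 a)) (t (tBA b a2))) (t (tBA b2 a1))" .
qed

lemma twist_rhs_lin:
  "linear_on fun_scale (carr ((B \<otimes> B) \<otimes> (A \<otimes> A))) fun_scale (twist_rhs A B t)"
proof -
  note m = mid_map[OF gs(2,2,1,1,1,2) glinD(1,3)[OF t]]
  note m2 = mid_map[OF gs(1,2,1,2,1,2) glinD(1,3)[OF t]]
  have tt: "linear_on fun_scale (carr (D \<otimes> D)) fun_scale (tmap D D C C t t)"
    "\<And>p. p \<in> carr (D \<otimes> D) \<Longrightarrow> tmap D D C C t t p \<in> carr (C \<otimes> C)"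
    using tmap(1-3)[OF gs(4,4,3,3), of t t] glinD[OF t] by simp_all
  show ?thesis unfolding twist_rhs_def comp_def
    by (rule linear_on_comp[OF linear_on_comp[OF linear_on_comp[OF m(1,2) tt(1)] _ m2(1)] _
        mu_mu(1)])
      (auto intro!: m2 tt m(2))
qed

end

end

section \<open>Twisting conditions as hexagons\<close>

context algebra_pair
begin

definition unital :: "nat \<Rightarrow> ((('b \<Rightarrow> 'a \<Rightarrow> 'k) \<Rightarrow> 'k) \<Rightarrow> ('a \<Rightarrow> 'b \<Rightarrow> 'k) \<Rightarrow> 'k) \<Rightarrow> bool" where
  "unital n t \<longleftrightarrow> (\<forall>a\<in>gr A n. t (tBA (one B) a) = tA a) \<and> (\<forall>b\<in>gr B n. t (tBA b (one A)) = tB b)"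

text \<open>
  The twisting identity on $b \otimes b' \otimes a \otimes 1$ and on
  $1 \otimes b \otimes a \otimes a'$; for unital maps these two cases imply the general one.
\<close>

definition hexagons :: "nat \<Rightarrow> ((('b \<Rightarrow> 'a \<Rightarrow> 'k) \<Rightarrow> 'k) \<Rightarrow> ('a \<Rightarrow> 'b \<Rightarrow> 'k) \<Rightarrow> 'k) \<Rightarrow> bool" where
  "hexagons n t \<longleftrightarrow> (\<forall>i j k. i + j + k = n \<longrightarrow>
     (\<forall>b\<in>gr B i. \<forall>b'\<in>gr B j. \<forall>a\<in>gr A k.
        t (tBA (mul B b b') a) = tmul t (tB b) (t (tBA b' a))) \<and>
     (\<forall>b\<in>gr B i. \<forall>a\<in>gr A j. \<forall>a'\<in>gr A k.
        t (tBA b (mul A a a')) = tmul t (t (tBA b a)) (tA a')))"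

lemma unitalD:
  assumes "unital n t"
  shows "a \<in> gr A n \<Longrightarrow> t (tBA (one B) a) = tA a" "b \<in> gr B n \<Longrightarrow> t (tBA b (one A)) = tB b"
  using assms by (simp_all add: unital_def)

lemma hexagonsD:
  assumes "hexagons n t" "i + j + k = n"
  shows "b \<in> gr B i \<Longrightarrow> b' \<in> gr B j \<Longrightarrow> a \<in> gr A k \<Longrightarrow>
      t (tBA (mul B b b') a) = tmul t (tB b) (t (tBA b' a))"
    "b \<in> gr B i \<Longrightarrow> a \<in> gr A j \<Longrightarrow> a' \<in> gr A k \<Longrightarrow>
      t (tBA b (mul A a a')) = tmul t (t (tBA b a)) (tA a')"
  using assms unfolding hexagons_def by blast+

lemma tens_gr' [simp]:
  "a \<in> gr A i \<Longrightarrow> b \<in> gr B j \<Longrightarrow> tAB a b \<in> gr C (i + j)"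
  "a \<in> gr A i \<Longrightarrow> b \<in> gr B j \<Longrightarrow> tBA b a \<in> gr D (j + i)"
  by (simp_all add: tens_gr)

lemma mul_gr [simp]:
  "x \<in> gr A m \<Longrightarrow> y \<in> gr A n \<Longrightarrow> mul A x y \<in> gr A (m + n)"
  "v \<in> gr B m \<Longrightarrow> w \<in> gr B n \<Longrightarrow> mul B v w \<in> gr B (m + n)"
  using graded_algebraD(3)[OF A] graded_algebraD(3)[OF B] by auto

lemma mu_mu':
  "linear_on fun_scale (carr ((B \<otimes> B) \<otimes> (A \<otimes> A))) fun_scale (muBA)"
  "p \<in> carr ((B \<otimes> B) \<otimes> (A \<otimes> A)) \<Longrightarrow> muBA p \<in> carr D"
  "p \<in> gr ((B \<otimes> B) \<otimes> (A \<otimes> A)) n \<Longrightarrow> muBA p \<in> gr D n"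
  "x \<in> carr A \<Longrightarrow> y \<in> carr A \<Longrightarrow> v \<in> carr B \<Longrightarrow> w \<in> carr B \<Longrightarrow>
    muBA (tBBAA (tens B B v w) (tens A A x y)) =
    tBA (mul B v w) (mul A x y)"
  using tmap[of "B \<otimes> B" "A \<otimes> A" B A "mu B" "mu A"] mu[OF A] mu[OF B]
  by (simp_all add: graded_space_tprod tens_carr)

context
  fixes t n assumes t: "glin t" and u: "\<And>i. i \<le> n \<Longrightarrow> unital i t"
begin

lemma t_in [simp]: "x \<in> carr D \<Longrightarrow> t x \<in> carr C" "x \<in> gr D n \<Longrightarrow> t x \<in> gr C n"
  using glinD[OF t] by auto

text \<open>On v \<otimes> w the product is v t(w \<otimes> 1) b, and unitality replaces t(w
  \<otimes> 1) by 1 \<otimes> w. The bound by \<open>n\<close> enters because the degree of w is at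
  most \<open>i\<close>.\<close>

lemma tmul_right_unit:
  assumes x: "x \<in> gr C i" and i: "i \<le> n" and b: "b \<in> carr B"
  shows "tmul t x (tB b) = act (one A) b x"
proof (rule tprod_eqI[OF gs(1,2) vs(3) _ _ _ x])
  show "linear_on fun_scale (carr C) fun_scale (\<lambda>x. tmul t x (tB b))"
    by (rule tmul_lin[OF t]) (simp add: b)
  show "linear_on fun_scale (carr C) fun_scale (act (one A) b)" by (rule act_lin) (simp_all add: b)
  fix v w k l assume vw: "v \<in> gr A k" "w \<in> gr B l" "k + l = i"
  note c = gr_carr(1)[OF vw(1)] gr_carr(2)[OF vw(2)]
  have "t (tBA w (one A)) = tB w" by (rule unitalD(2)[OF u vw(2)]) (use vw i in simp)
  then show "tmul t (tAB v w) (tB b) = act (one A) b (tAB v w)"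
    using c b by (simp add: tmul_tens[OF t] act_lin)
qed

lemma tmul_left_unit:
  assumes y: "y \<in> gr C i" and i: "i \<le> n" and a: "a \<in> carr A"
  shows "tmul t (tA a) y = act a (one B) y"
proof (rule tprod_eqI[OF gs(1,2) vs(3) _ _ _ y])
  show "linear_on fun_scale (carr C) fun_scale (tmul t (tA a))"
    by (rule tmul_lin[OF t]) (simp add: a)
  show "linear_on fun_scale (carr C) fun_scale (act a (one B))" by (rule act_lin) (simp_all add: a)
  fix v w k l assume vw: "v \<in> gr A k" "w \<in> gr B l" "k + l = i"
  note c = gr_carr(1)[OF vw(1)] gr_carr(2)[OF vw(2)]
  have "t (tBA (one B) v) = tA v" by (rule unitalD(1)[OF u vw(1)]) (use vw i in simp)
  then show "tmul t (tA a) (tAB v w) = act a (one B) (tAB v w)"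
    using c a by (simp add: tmul_tens[OF t] act_lin)
qed

text \<open>A unit in the last (or the first) of the four places makes one inner value of
  \<open>t\<close> trivial. The remaining product becomes a one-sided action, so that the lift
  collapses to a single product in A \<otimes> B.\<close>

lemma hexagons_if_twist:
  assumes tw: "\<And>x. x \<in> gr ((B \<otimes> B) \<otimes> (A \<otimes> A)) n \<Longrightarrow>
    t (muBA x) = twist_rhs A B t x"
  shows "hexagons n t"
  unfolding hexagons_def
proof (intro allI impI conjI ballI)
  fix i j k assume n: "i + j + k = n"
  fix b assume b: "b \<in> gr B i"
  note cb = gr_carr(2)[OF b]
  {
    fix b' a assume b': "b' \<in> gr B j" and a: "a \<in> gr A k"
    note cb' = gr_carr(2)[OF b'] and ca = gr_carr(1)[OF a]
    note R = twist_rhs_tens[OF t cb cb' ca one_in(1)]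
    note T = tensor_universal[OF gs(1,2) _ R(2)[folded smul_tprod[of A B]]]
    have x: "tBBAA (tens B B b b') (tens A A a (one A)) \<in> gr ((B \<otimes> B) \<otimes> (A \<otimes> A)) n"
      by (rule tens_gr[OF tens_gr[OF b b' refl] tens_gr[OF a one_in(3) refl]]) (use n in simp)
    have "t (tBA (mul B b b') a) = tlift A B C (\<lambda>v w. tmul t (t (tBA b v)) (t (tBA w (one A))))
        (t (tBA b' a))"
      using tw[OF x] cb cb' ca by (simp add: mu_mu' R(1))
    also have "\<dots> = tmul t (tB b) (t (tBA b' a))"
    proof (rule tprod_eqI[OF gs(1,2) vs(3) _ _ _ glinD(2)[OF t tens_gr'(2)[OF a b']]])
      fix v w p q assume vw: "v \<in> gr A p" "w \<in> gr B q" "p + q = j + k"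
      note c = gr_carr(1)[OF vw(1)] gr_carr(2)[OF vw(2)]
      have 1: "t (tBA w (one A)) = tB w" by (rule unitalD(2)[OF u vw(2)]) (use vw n in simp)
      have 2: "tmul t (t (tBA b v)) (tB w) = act (one A) w (t (tBA b v))"
        by (rule tmul_right_unit[OF glinD(2)[OF t tens_gr'(2)[OF vw(1) b]]]) (use n vw c in auto)
      show "tlift A B C (\<lambda>v w. tmul t (t (tBA b v)) (t (tBA w (one A)))) (tAB v w) =
          tmul t (tB b) (tAB v w)"
        using c cb by (simp add: T(2) 1 2 tmul_tens[OF t])
    qed (use T(1) tmul_lin[OF t] cb in simp_all)
    finally show "t (tBA (mul B b b') a) = tmul t (tB b) (t (tBA b' a))" .
  }
  {
    fix a a' assume a: "a \<in> gr A j" and a': "a' \<in> gr A k"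
    note ca = gr_carr(1)[OF a] and ca' = gr_carr(1)[OF a']
    note R = twist_rhs_tens[OF t one_in(2) cb ca ca']
    note T = tensor_universal[OF gs(1,2) _ R(2)[folded smul_tprod[of A B]]]
    have x: "tBBAA (tens B B (one B) b) (tens A A a a') \<in> gr ((B \<otimes> B) \<otimes> (A \<otimes> A)) n"
      by (rule tens_gr[OF tens_gr[OF one_in(4) b refl] tens_gr[OF a a' refl]]) (use n in simp)
    have "t (tBA b (mul A a a')) = tlift A B C (\<lambda>v w. tmul t (t (tBA (one B) v)) (t (tBA w a')))
        (t (tBA b a))"
      using tw[OF x] cb ca' ca by (simp add: mu_mu' R(1))
    also have "\<dots> = tmul t (t (tBA b a)) (tA a')"
    proof (rule tprod_eqI[OF gs(1,2) vs(3) _ _ _ glinD(2)[OF t tens_gr'(2)[OF a b]]])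
      fix v w p q assume vw: "v \<in> gr A p" "w \<in> gr B q" "p + q = i + j"
      note c = gr_carr(1)[OF vw(1)] gr_carr(2)[OF vw(2)]
      have 1: "t (tBA (one B) v) = tA v" by (rule unitalD(1)[OF u vw(1)]) (use vw n in simp)
      have 2: "tmul t (tA v) (t (tBA w a')) = act v (one B) (t (tBA w a'))"
        by (rule tmul_left_unit[OF glinD(2)[OF t tens_gr'(2)[OF a' vw(2)]]]) (use n vw c in auto)
      show "tlift A B C (\<lambda>v w. tmul t (t (tBA (one B) v)) (t (tBA w a'))) (tAB v w) =
          tmul t (tAB v w) (tA a')"
        using c ca' by (simp add: T(2) 1 2 tmul_tens[OF t])
    qed (use T(1) tmul_lin[OF t] ca' in simp_all)
    finally show "t (tBA b (mul A a a')) = tmul t (t (tBA b a)) (tA a')" .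
  }
qed

section \<open>From the hexagons to the full twisting identity and to associativity\<close>

context
  assumes hex: "\<And>i. i \<le> n \<Longrightarrow> hexagons i t"
begin

text \<open>For \<open>y\<close> of the form v \<otimes> 1 this is the second hexagon combined with
  the product rule on pure tensors; the right action of B commutes with products and extends it to v
  \<otimes> w.\<close>

lemma tmul_slide_left:
  assumes b: "b \<in> gr B i" and a: "a \<in> gr A j" and y: "y \<in> gr C k" and n: "i + j + k \<le> n"
  shows "tmul t (tB b) (act a (one B) y) = tmul t (t (tBA b a)) y"
proof (rule tprod_eqI[OF gs(1,2) vs(3) _ _ _ y])
  note ca = gr_carr(1)[OF a] and cb = gr_carr(2)[OF b]
  show "linear_on fun_scale (carr C) fun_scale (\<lambda>y. tmul t (tB b) (act a (one B) y))"
    by (rule linear_on_comp[OF act_lin(1,2) tmul_lin(2)[OF t]]) (use ca cb in auto)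
  show "linear_on fun_scale (carr C) fun_scale (tmul t (t (tBA b a)))"
    by (rule tmul_lin[OF t]) (use ca cb in simp)
  fix v w p q assume vw: "v \<in> gr A p" "w \<in> gr B q" "p + q = k"
  note c = gr_carr(1)[OF vw(1)] gr_carr(2)[OF vw(2)]
  have "t (tBA b (mul A a v)) = tmul t (t (tBA b a)) (tA v)"
    by (rule hexagonsD(2)[OF hex refl b a vw(1)]) (use n vw in simp)
  then show "tmul t (tB b) (act a (one B) (tAB v w)) = tmul t (t (tBA b a)) (tAB v w)"
    using c ca cb tmul_act_right[OF t, of "t (tBA b a)" "tA v" w] by
        (simp add: act_lin tmul_tens[OF t])
qed

text \<open>For \<open>x\<close> of the form 1 \<otimes> w this comes from the first hexagon; the
  left action of A extends it to v \<otimes> w.\<close>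

lemma tmul_slide_right:
  assumes b: "b \<in> gr B i" and a: "a \<in> gr A j" and x: "x \<in> gr C k" and n: "i + j + k \<le> n"
  shows "tmul t (act (one A) b x) (tA a) = tmul t x (t (tBA b a))"
proof (rule tprod_eqI[OF gs(1,2) vs(3) _ _ _ x])
  note ca = gr_carr(1)[OF a] and cb = gr_carr(2)[OF b]
  show "linear_on fun_scale (carr C) fun_scale (\<lambda>x. tmul t (act (one A) b x) (tA a))"
    by (rule linear_on_comp[OF act_lin(1,2) tmul_lin(1)[OF t]]) (use ca cb in auto)
  show "linear_on fun_scale (carr C) fun_scale (\<lambda>x. tmul t x (t (tBA b a)))"
    by (rule tmul_lin[OF t]) (use ca cb in simp)
  fix v w p q assume vw: "v \<in> gr A p" "w \<in> gr B q" "p + q = k"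
  note c = gr_carr(1)[OF vw(1)] gr_carr(2)[OF vw(2)]
  have "t (tBA (mul B w b) a) = tmul t (tB w) (t (tBA b a))"
    by (rule hexagonsD(1)[OF hex refl vw(2) b a]) (use n vw in simp)
  then show "tmul t (act (one A) b (tAB v w)) (tA a) = tmul t (tAB v w) (t (tBA b a))"
    using c ca cb tmul_act_left[OF t, of "tB w" "t (tBA b a)" v] by
        (simp add: act_lin tmul_tens[OF t])
qed

text \<open>The first hexagon splits off the product in B, the second one the product in A. What
  remains is b (c a') with c = t(b' \<otimes> a). For each summand v \<otimes> w of c, sliding v to
  the left across the product turns b into t(b \<otimes> v), while w and a' give t(w \<otimes>
  a').\<close>

lemma twist_if_hexagons:
  assumes x: "x \<in> gr ((B \<otimes> B) \<otimes> (A \<otimes> A)) n"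
  shows "t (muBA x) = twist_rhs A B t x"
proof -
  let ?mm = "\<lambda>x. t (muBA x)" and ?r = "twist_rhs A B t"
  have mm: "linear_on fun_scale (carr ((B \<otimes> B) \<otimes> (A \<otimes> A))) fun_scale ?mm"
    by (rule linear_on_comp[OF mu_mu'(1,2) glinD(1)[OF t]])
  note rr = twist_rhs_lin[OF t]
  have g [simp]: "graded_space (B \<otimes> B)" "graded_space (A \<otimes> A)" by (simp_all add: graded_space_tprod)
  have pure: "?mm (tBBAA (tens B B b b') (tens A A a a')) =
      ?r (tBBAA (tens B B b b') (tens A A a a'))"
    if b: "b \<in> gr B i" and b': "b' \<in> gr B j" and a: "a \<in> gr A k" and a': "a' \<in> gr A l" and n: "i +
        j + k + l = n" for b b' a a' i j k l
  proof -
    note cb = gr_carr(2)[OF b] and cb' = gr_carr(2)[OF b'] and ca = gr_carr(1)[OF a] and ca' =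
        gr_carr(1)[OF a']
    note R = twist_rhs_tens[OF t cb cb' ca ca']
    note T = tensor_universal[OF gs(1,2) _ R(2)[folded smul_tprod[of A B]]]
    have "?mm (tBBAA (tens B B b b') (tens A A a a')) = t (tBA (mul B b b') (mul A a a'))"
      using cb cb' ca ca' by (simp add: mu_mu')
    also have "\<dots> = tmul t (tB b) (t (tBA b' (mul A a a')))"
      by (rule hexagonsD(1)[OF hex refl b b' mul_gr(1)[OF a a']]) (use n in simp)
    also have "t (tBA b' (mul A a a')) = tmul t (t (tBA b' a)) (tA a')"
      by (rule hexagonsD(2)[OF hex refl b' a a']) (use n in simp)
    also have "tmul t (tB b) (tmul t (t (tBA b' a)) (tA a')) =
       tlift A B C (\<lambda>v w. tmul t (t (tBA b v)) (t (tBA w a'))) (t (tBA b' a))"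
    proof (rule tprod_eqI[OF gs(1,2) vs(3) _ _ _ glinD(2)[OF t tens_gr'(2)[OF a b']]])
      show "linear_on fun_scale (carr C) fun_scale (\<lambda>c. tmul t (tB b) (tmul t c (tA a')))"
        by (rule linear_on_comp[OF tmul_lin(1)[OF t] _ tmul_lin(2)[OF t]])
            (use cb ca' t in \<open>auto intro!: tmul_in\<close>)
      fix v w p q assume vw: "v \<in> gr A p" "w \<in> gr B q" "p + q = j + k"
      note c = gr_carr(1)[OF vw(1)] gr_carr(2)[OF vw(2)]
      have "tmul t (tB b) (act v (one B) (t (tBA w a'))) = tmul t (t (tBA b v)) (t (tBA w a'))"
        by (rule tmul_slide_left[OF b vw(1) glinD(2)[OF t tens_gr'(2)[OF a' vw(2)]]])
            (use n vw in simp)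
      then show "tmul t (tB b) (tmul t (tAB v w) (tA a')) =
         tlift A B C (\<lambda>v w. tmul t (t (tBA b v)) (t (tBA w a'))) (tAB v w)"
        using c cb ca' by (simp add: T(2) tmul_tens[OF t])
    qed (use T(1) in simp)
    also have "\<dots> = ?r (tBBAA (tens B B b b') (tens A A a a'))" using R(1) by simp
    finally show ?thesis .
  qed
  have tl: "linear_on fun_scale (carr (B \<otimes> B)) fun_scale (\<lambda>p. f (tBBAA p q))"
    "linear_on fun_scale (carr (A \<otimes> A)) fun_scale (\<lambda>q. f (tBBAA p' q))"
    if "q \<in> carr (A \<otimes> A)" "p' \<in> carr (B \<otimes> B)" "linear_on fun_scale (carr ((B \<otimes> B) \<otimes> (A \<otimes> A)))
        fun_scale f"
    for f :: "_ \<Rightarrow> ('a \<Rightarrow> 'b \<Rightarrow> 'k) \<Rightarrow> 'k" and q p'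
    by (rule linear_on_comp[OF linear_on_tens(1)[of _ _ "B \<otimes> B", unfolded smul_tprod] _ that(3)]
      linear_on_comp[OF linear_on_tens(2)[of _ _ "A \<otimes> A", unfolded smul_tprod] _ that(3)]; simp
          add: that tens_carr)+
  have vs': "vector_space (fun_scale :: 'k \<Rightarrow> ('f \<Rightarrow> 'k) \<Rightarrow> _)" by simp
  show ?thesis
  proof (rule tprod_eqI[OF g vs' mm rr _ x])
    fix p q k l assume p: "p \<in> gr (B \<otimes> B) k" and q: "q \<in> gr (A \<otimes> A) l" and kl: "k + l = n"
    note cp = graded_spaceD(4)[OF g(1) p] and cq = graded_spaceD(4)[OF g(2) q]
    show "?mm (tBBAA p q) = ?r (tBBAA p q)"
    proof (rule tprod_eqI[OF gs(2,2) vs' tl(1)[OF cq cp mm] tl(1)[OF cq cp rr] _ p])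
      fix b b' i j assume b: "b \<in> gr B i" and b': "b' \<in> gr B j" and ij: "i + j = k"
      have cp: "tens B B b b' \<in> carr (B \<otimes> B)" using b b' gr_carr by (auto intro: tens_carr)
      show "?mm (tBBAA (tens B B b b') q) = ?r (tBBAA (tens B B b b') q)"
        by (rule tprod_eqI[OF gs(1,1) vs' tl(2)[OF cq cp mm] tl(2)[OF cq cp rr] pure[OF b b'] q])
            (use ij kl in auto)
    qed
  qed
qed

text \<open>Outer factors pass through, which leaves b1, a2 \<otimes> b2 and a3. Sliding in the two
  bracketings shows that both equal the product of t(b1 \<otimes> a2) and t(b2 \<otimes> a3). The
  statement is bounded by degree because an extension is known to satisfy the hexagons only up to
  \<open>n\<close>.\<close>

lemma tmul_assoc_gr:
  assumes x: "x \<in> gr C p" and y: "y \<in> gr C q" and z: "z \<in> gr C r" and n: "p + q + r \<le> n"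
  shows "tmul t (tmul t x y) z = tmul t x (tmul t y z)"
proof -
  note [simp] = tmul_in[OF t]
  have cx: "x \<in> carr C" and cy: "y \<in> carr C" and cz: "z \<in> carr C" using x y z gr_carr by auto
  have 1: "linear_on fun_scale (carr C) fun_scale (\<lambda>x. tmul t (tmul t x y) z)"
    "linear_on fun_scale (carr C) fun_scale (\<lambda>x. tmul t x (tmul t y z))"
    if "y \<in> carr C" "z \<in> carr C" for y z
    using that by (auto intro!: linear_on_comp[OF tmul_lin(1)[OF t] _ tmul_lin(1)[OF t]]
        tmul_lin[OF t])
  have 2: "linear_on fun_scale (carr C) fun_scale (\<lambda>y. tmul t (tmul t x y) z)"
    "linear_on fun_scale (carr C) fun_scale (\<lambda>y. tmul t x (tmul t y z))"
    if "x \<in> carr C" "z \<in> carr C" for x z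
    using that by (auto intro!: linear_on_comp[OF tmul_lin(1)[OF t] _ tmul_lin(2)[OF t]]
       linear_on_comp[OF tmul_lin(2)[OF t] _ tmul_lin(1)[OF t]])
  have 3: "linear_on fun_scale (carr C) fun_scale (\<lambda>z. tmul t (tmul t x y) z)"
    "linear_on fun_scale (carr C) fun_scale (\<lambda>z. tmul t x (tmul t y z))"
    if "x \<in> carr C" "y \<in> carr C" for x y
    using that by (auto intro!: linear_on_comp[OF tmul_lin(2)[OF t] _ tmul_lin(2)[OF t]]
        tmul_lin[OF t])
  show ?thesis
  proof (rule tprod_eqI[OF gs(1,2) vs(3) 1[OF cy cz] _ x])
    fix a1 b1 i1 j1 assume x1: "a1 \<in> gr A i1" "b1 \<in> gr B j1" "i1 + j1 = p"
    have c1: "a1 \<in> carr A" "b1 \<in> carr B" "tAB a1 b1 \<in> carr C" using x1 gr_carr by auto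
    show "tmul t (tmul t (tAB a1 b1) y) z = tmul t (tAB a1 b1) (tmul t y z)"
    proof (rule tprod_eqI[OF gs(1,2) vs(3) 3[OF c1(3) cy] _ z])
      fix a3 b3 i3 j3 assume x3: "a3 \<in> gr A i3" "b3 \<in> gr B j3" "i3 + j3 = r"
      have c3: "a3 \<in> carr A" "b3 \<in> carr B" "tAB a3 b3 \<in> carr C" using x3 gr_carr by auto
      show "tmul t (tmul t (tAB a1 b1) y) (tAB a3 b3) = tmul t (tAB a1 b1) (tmul t y (tAB a3 b3))"
      proof (rule tprod_eqI[OF gs(1,2) vs(3) 2[OF c1(3) c3(3)] _ y])
        fix a2 b2 i2 j2 assume x2: "a2 \<in> gr A i2" "b2 \<in> gr B j2" "i2 + j2 = q"
        have c2: "a2 \<in> carr A" "b2 \<in> carr B" "tAB a2 b2 \<in> carr C" using x2 gr_carr by auto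
        let ?y = "tAB a2 b2"
        have e1: "tAB a1 b1 = act a1 (one B) (tB b1)" and e3: "tAB a3 b3 = act (one A) b3 (tA a3)"
          using c1 c3 by (simp_all add: act_lin)
        have "tmul t (tmul t (tB b1) ?y) (tA a3) = tmul t (act (one A) b2 (t (tBA b1 a2))) (tA a3)"
          using c1 c2 by (simp add: tmul_tens[OF t])
        also have "\<dots> = tmul t (t (tBA b1 a2)) (t (tBA b2 a3))"
          by (rule tmul_slide_right[OF x2(2) x3(1) glinD(2)[OF t tens_gr'(2)[OF x2(1) x1(2)]]])
              (use x1 x2 x3 n in simp)
        also have "\<dots> = tmul t (tB b1) (act a2 (one B) (t (tBA b2 a3)))"
          by (rule tmul_slide_left[OF x1(2) x2(1) glinD(2)[OF t tens_gr'(2)[OF x3(1) x2(2)]],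
              symmetric]) (use x1 x2 x3 n in simp)
        also have "\<dots> = tmul t (tB b1) (tmul t ?y (tA a3))"
          using c3 c2 by (simp add: tmul_tens[OF t])
        finally show "tmul t (tmul t (tAB a1 b1) ?y) (tAB a3 b3) =
            tmul t (tAB a1 b1) (tmul t ?y (tAB a3 b3))"
          unfolding e1 e3 using c1 c2 c3 by
              (simp add: tmul_act_left[OF t] tmul_act_right[OF t] act_lin(2))
      qed
    qed
  qed
qed

end

end

section \<open>Dependence on the map, truncation, and twisting up to a degree\<close>

lemma tmul_cong:
  assumes t: "glin t" and t': "glin t'" and eq: "\<And>j z. j \<le> m \<Longrightarrow> z \<in> gr D j \<Longrightarrow> t z = t' z"
    and x: "x \<in> gr C p" and y: "y \<in> gr C q" and m: "p + q \<le> m"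
  shows "tmul t x y = tmul t' x y"
proof -
  have cx: "x \<in> carr C" and cy: "y \<in> carr C" using x y gr_carr by auto
  show ?thesis
  proof (rule tprod_eqI[OF gs(1,2) vs(3) tmul_lin(1)[OF t cy] tmul_lin(1)[OF t' cy] _ x])
    fix a b i j assume ab: "a \<in> gr A i" "b \<in> gr B j" "i + j = p"
    have c: "a \<in> carr A" "b \<in> carr B" "tAB a b \<in> carr C" using ab gr_carr by auto
    show "tmul t (tAB a b) y = tmul t' (tAB a b) y"
    proof (rule tprod_eqI[OF gs(1,2) vs(3) tmul_lin(2)[OF t c(3)] tmul_lin(2)[OF t' c(3)] _ y])
      fix a' b' i' j' assume ab': "a' \<in> gr A i'" "b' \<in> gr B j'" "i' + j' = q"
      have c': "a' \<in> carr A" "b' \<in> carr B" using ab' gr_carr by auto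
      have "t (tBA b a') = t' (tBA b a')"
        by (rule eq[OF _ tens_gr'(2)[OF ab'(1) ab(2)]]) (use ab ab' m in simp)
      then show "tmul t (tAB a b) (tAB a' b') = tmul t' (tAB a b) (tAB a' b')"
        using c c' by (simp add: tmul_tens[OF t] tmul_tens[OF t'])
    qed
  qed
qed

text \<open>The product depends linearly on the map. The relation between the maps is required only
  up to the total degree, as the difference of two extensions will be cut off to a single
  degree.\<close>

lemma tmul_diff:
  assumes t1: "glin t1" and t2: "glin t2" and t3: "glin t3"
    and eq: "\<And>j z. j \<le> m \<Longrightarrow> z \<in> gr D j \<Longrightarrow> t3 z = t1 z - t2 z"
    and x: "x \<in> gr C p" and y: "y \<in> gr C q" and m: "p + q \<le> m"
  shows "tmul t3 x y = tmul t1 x y - tmul t2 x y"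
proof -
  have cx: "x \<in> carr C" and cy: "y \<in> carr C" using x y gr_carr by auto
  show ?thesis
  proof (rule tprod_eqI[OF gs(1,2) vs(3) tmul_lin(1)[OF t3 cy] linear_on_minus[OF vs(3)
      tmul_lin(1)[OF t1 cy] tmul_lin(1)[OF t2 cy]] _ x])
    fix a b i j assume ab: "a \<in> gr A i" "b \<in> gr B j" "i + j = p"
    have c: "a \<in> carr A" "b \<in> carr B" "tAB a b \<in> carr C" using ab gr_carr by auto
    show "tmul t3 (tAB a b) y = tmul t1 (tAB a b) y - tmul t2 (tAB a b) y"
    proof (rule tprod_eqI[OF gs(1,2) vs(3) tmul_lin(2)[OF t3 c(3)] linear_on_minus[OF vs(3)
        tmul_lin(2)[OF t1 c(3)] tmul_lin(2)[OF t2 c(3)]] _ y])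
      fix a' b' i' j' assume ab': "a' \<in> gr A i'" "b' \<in> gr B j'" "i' + j' = q"
      have c': "a' \<in> carr A" "b' \<in> carr B" using ab' gr_carr by auto
      have e: "t3 (tBA b a') = t1 (tBA b a') - t2 (tBA b a')"
        by (rule eq[OF _ tens_gr'(2)[OF ab'(1) ab(2)]]) (use ab ab' m in simp)
      have "act a b' (t1 (tBA b a') - t2 (tBA b a')) = act a b' (t1 (tBA b a')) - act a b'
          (t2 (tBA b a'))"
        by (rule linear_on_diff[OF vs(3) vs(3) sub(1) act_lin(1)[OF c(1) c'(2)]])
          (use c c' glinD(3)[OF t1] glinD(3)[OF t2] in auto)
      then show "tmul t3 (tAB a b) (tAB a' b') = tmul t1 (tAB a b) (tAB a' b') - tmul t2 (tAB a b)
          (tAB a' b')"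
        using c c' by (simp only: tmul_tens[OF t1] tmul_tens[OF t2] tmul_tens[OF t3] e)
    qed
  qed
qed

lemma hexagons_cong:
  assumes t: "glin t" and t': "glin t'" and eq: "\<And>j z. j \<le> m \<Longrightarrow> z \<in> gr D j \<Longrightarrow> t z = t' z"
    and h: "hexagons m t"
  shows "hexagons m t'"
  unfolding hexagons_def
proof (intro allI impI conjI ballI)
  fix i j k assume n: "i + j + k = m"
  fix b assume b: "b \<in> gr B i"
  {
    fix b' a assume b': "b' \<in> gr B j" and a: "a \<in> gr A k"
    have "t' (tBA (mul B b b') a) = t (tBA (mul B b b') a)"
      by (rule eq[OF _ tens_gr'(2)[OF a mul_gr(2)[OF b b']], symmetric]) (use n in simp)
    also have "\<dots> = tmul t (tB b) (t (tBA b' a))"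
      by (rule hexagonsD(1)[OF h n b b' a])
    also have "t (tBA b' a) = t' (tBA b' a)"
      by (rule eq[OF _ tens_gr'(2)[OF a b']]) (use n in simp)
    also have "tmul t (tB b) (t' (tBA b' a)) = tmul t' (tB b) (t' (tBA b' a))"
      by (rule tmul_cong[OF t t' eq tens_gr'(1)[OF one_in(3) b] glinD(2)[OF t' tens_gr'(2)[OF a
          b']]]) (use n in auto)
    finally show "t' (tBA (mul B b b') a) = tmul t' (tB b) (t' (tBA b' a))" .
  }
  {
    fix a a' assume a: "a \<in> gr A j" and a': "a' \<in> gr A k"
    have "t' (tBA b (mul A a a')) = t (tBA b (mul A a a'))"
      by (rule eq[OF _ tens_gr'(2)[OF mul_gr(1)[OF a a'] b], symmetric]) (use n in simp)
    also have "\<dots> = tmul t (t (tBA b a)) (tA a')"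
      by (rule hexagonsD(2)[OF h n b a a'])
    also have "t (tBA b a) = t' (tBA b a)"
      by (rule eq[OF _ tens_gr'(2)[OF a b]]) (use n in simp)
    also have "tmul t (t' (tBA b a)) (tA a') = tmul t' (t' (tBA b a)) (tA a')"
      by (rule tmul_cong[OF t t' eq glinD(2)[OF t' tens_gr'(2)[OF a b]] tens_gr'(1)[OF a'
          one_in(4)]]) (use n in auto)
    finally show "t' (tBA b (mul A a a')) = tmul t' (t' (tBA b a)) (tA a')" .
  }
qed

lemma unital_cong:
  assumes eq: "\<And>z. z \<in> gr D m \<Longrightarrow> t z = t' z" and u: "unital m t"
  shows "unital m t'"
  using unitalD[OF u] eq[OF tens_gr'(2)[OF _ one_in(4), of _ m, simplified]]
    eq[OF tens_gr'(2)[OF one_in(3), of _ m, simplified]] by (simp add: unital_def)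

text \<open>Cutting off above degree \<open>n\<close> gives a graded map on all of \<open>D\<close>,
  so the results about such maps apply to the truncations that occur in the definition of twisting
  up to a degree.\<close>

lemma map_upto_glin:
  assumes t: "glin t"
  shows "glin (map_upto D n t)" "j \<le> n \<Longrightarrow> x \<in> gr D j \<Longrightarrow> map_upto D n t x = t x"
proof -
  have t0: "t 0 = 0" using linear_on_0[OF vs(3) vs(3) sub(2) glinD(1)[OF t]] .
  have e: "map_upto D n t x = (if j \<le> n then t x else 0)" if "x \<in> gr D j" for x j
  proof -
    have "map_upto D n t x = (\<Sum>i\<le>n. if i = j then t x else 0)"
      unfolding map_upto_def hcomp_gr[OF gs(4) that] by (rule sum.cong) (auto simp: t0)
    then show ?thesis by (simp add: sum.delta)
  qed
  show "j \<le> n \<Longrightarrow> x \<in> gr D j \<Longrightarrow> map_upto D n t x = t x" using e by simp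
  have h: "hcomp D i x \<in> carr D" if "x \<in> carr D" for i x
    using linear_on_hcomp(2)[OF gs(4) that] gr_carr by blast
  have l: "linear_on fun_scale (carr D) fun_scale (\<lambda>x. \<Sum>i\<in>S. t (hcomp D i x))" if "finite S" for S
    using that
  proof (induction S rule: finite_induct)
    case empty
    show ?case unfolding sum.empty by (rule linear_on_zero_map[OF vs(3)])
  next
    case (insert i S)
    have "linear_on fun_scale (carr D) fun_scale (\<lambda>x. t (hcomp D i x) + (\<Sum>i\<in>S. t (hcomp D i x)))"
      by (rule linear_on_plus[OF vs(3) linear_on_comp[OF _ h glinD(1)[OF t]] insert.IH])
        (use linear_on_hcomp(1)[OF gs(4)] in simp_all)
    then show ?case unfolding sum.insert[OF insert.hyps] .
  qed
  show "glin (map_upto D n t)"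
    unfolding graded_linear_def
  proof (intro conjI allI ballI)
    show "linear_on (smul D) (carr D) (smul C) (map_upto D n t)"
      using l[of "{..n}"] by (simp add: map_upto_def[abs_def])
    show "map_upto D n t x \<in> gr C k" if "x \<in> gr D k" for k x
      using e[OF that] glinD(2)[OF t that] gr_closed(3)[OF gs(3)] by simp
  qed
qed

lemma graded_twistingD:
  assumes "graded_twisting A B t"
  shows "glin t" "unital n t" "hexagons n t"
proof -
  show t: "glin t" using assms by (simp add: graded_twisting_def)
  show u: "unital n t" for n
    using assms gr_carr by (auto simp: graded_twisting_def unital_def)
  show "hexagons n t"
    by (rule hexagons_if_twist[OF t u])
      (use assms graded_spaceD(4)[OF graded_space_tprod[OF graded_space_tprod[OF gs(2,2)]
          graded_space_tprod[OF gs(1,1)]]]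
        in \<open>auto simp: graded_twisting_def\<close>)
qed

text \<open>The definition tests degree i on the truncation at i. As the truncation agrees with the
  map up to degree i, the twisting identity is exchanged for hexagons on the truncation, and the
  hexagons are transferred between the two maps.\<close>

lemma graded_twisting_to_iff:
  assumes t: "glin t"
  shows "graded_twisting_to A B n t \<longleftrightarrow> (\<forall>i\<le>n. unital i t \<and> hexagons i t)"
proof
  assume tw: "graded_twisting_to A B n t"
  show "\<forall>i\<le>n. unital i t \<and> hexagons i t"
  proof (intro allI impI conjI)
    have u: "unital i t" if "i \<le> n" for i using tw that by
        (simp add: graded_twisting_to_def unital_def)
    fix i assume i: "i \<le> n"
    show "unital i t" using u[OF i] .
    note m = map_upto_glin(1)[OF t, of i]
    have e: "map_upto D i t x = t x" if "j \<le> i" "x \<in> gr D j" for j x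
        using map_upto_glin(2)[OF t that] .
    have "hexagons i (map_upto D i t)"
    proof (rule hexagons_if_twist[OF m])
      show "unital j (map_upto D i t)" if "j \<le> i" for j
        by (rule unital_cong[OF _ u]) (use e that i in auto)
      fix x assume x: "x \<in> gr ((B \<otimes> B) \<otimes> (A \<otimes> A)) i"
      show "map_upto D i t (muBA x) = twist_rhs A B (map_upto D i t) x"
        using tw i x e[OF le_refl mu_mu'(3)[OF x]] by (simp add: graded_twisting_to_def)
    qed
    from hexagons_cong[OF m t e this] show "hexagons i t" .
  qed
next
  assume uh: "\<forall>i\<le>n. unital i t \<and> hexagons i t"
  have "carr (upto_deg n D) \<subseteq> carr D"
  proof -
    interpret F: vector_space "fun_scale :: 'k \<Rightarrow> (('b \<Rightarrow> 'a \<Rightarrow> 'k) \<Rightarrow> 'k) \<Rightarrow> _" by (rule vs)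
    have "F.span (\<Union>i. if i \<le> n then gr D i else {0}) \<subseteq> F.span (carr D)"
      by (rule F.span_mono) (use gr_carr carr_closed(3)[OF gs(4)] in \<open>auto split: if_splits\<close>)
    also have "F.span (carr D) = carr D" using sub(2) by (rule F.span_eq_iff[THEN iffD2])
    finally show ?thesis unfolding upto_deg_def carr_def[of "\<lparr>smul = _, gr =
        _\<rparr>"] gspace.simps smul_tprod .
  qed
  then have l: "linear_on fun_scale (carr (upto_deg n D)) fun_scale t"
    by (rule linear_on_mono[OF glinD(1)[OF t]])
  have t0: "t 0 = 0" using linear_on_0[OF vs(3) vs(3) sub(2) glinD(1)[OF t]] .
  show "graded_twisting_to A B n t" unfolding graded_twisting_to_def
  proof (intro conjI allI impI ballI)
    show "graded_linear (upto_deg n D) (upto_deg n C) t"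
      using l glinD(2)[OF t] t0 by (auto simp: graded_linear_def upto_deg_def)
    fix i assume i: "i \<le> n"
    show "a \<in> gr A i \<Longrightarrow> t (tBA (one B) a) = tA a" "b \<in> gr B i \<Longrightarrow> t (tBA b (one A)) = tB b" for a b
      using uh i unitalD by auto
    note m = map_upto_glin(1)[OF t, of i]
    have e: "t x = map_upto D i t x" if "j \<le> i" "x \<in> gr D j" for j x
        using map_upto_glin(2)[OF t that] by simp
    fix x assume x: "x \<in> gr ((B \<otimes> B) \<otimes> (A \<otimes> A)) i"
    have "map_upto D i t (muBA x) = twist_rhs A B (map_upto D i t) x"
    proof (rule twist_if_hexagons[OF m _ _ x])
      show "unital j (map_upto D i t)" if "j \<le> i" for j
        by (rule unital_cong[of _ t]) (use e that i uh in auto)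
      show "hexagons j (map_upto D i t)" if j: "j \<le> i" for j
      proof (rule hexagons_cong[OF t m])
        show "t z = map_upto D i t z" if "l \<le> j" "z \<in> gr D l" for l z
          by (rule e[OF order_trans[OF that(1) j] that(2)])
        show "hexagons j t" using uh i j by simp
      qed
    qed
    then show "t (muBA x) = twist_rhs A B (map_upto D i t) x"
      using e[OF le_refl mu_mu'(3)[OF x]] by simp
  qed
qed

section \<open>The twisted tensor product as a graded algebra\<close>

lemma twisted_tensor_simps [simp]:
  "smul (twisted_tensor A B t) = fun_scale" "gr (twisted_tensor A B t) = gr C"
  "mul (twisted_tensor A B t) = tmul t" "one (twisted_tensor A B t) = tAB (one A) (one B)"
  "carr (twisted_tensor A B t) = carr C"
  by (simp_all add: twisted_tensor_def tmul_def[abs_def] carr_def)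

lemma gr_C_finite: "\<exists>S. finite S \<and> gr C n = module.span fun_scale S"
proof -
  interpret F: vector_space "fun_scale :: 'k \<Rightarrow> (('a \<Rightarrow> 'b \<Rightarrow> 'k) \<Rightarrow> 'k) \<Rightarrow> _" by (rule vs)
  interpret A: vector_space "smul A" by (rule vs)
  interpret B: vector_space "smul B" by (rule vs)
  obtain SA where SA: "\<And>i. finite (SA i)" "\<And>i. gr A i = A.span (SA i)"
    using graded_algebraD(8)[OF A] by metis
  obtain SB where SB: "\<And>i. finite (SB i)" "\<And>i. gr B i = B.span (SB i)"
    using graded_algebraD(8)[OF B] by metis
  let ?S = "\<Union>i\<in>{..n}. (\<lambda>(a, b). tAB a b) ` (SA i \<times> SB (n - i))"
  have 1: "SA i \<subseteq> gr A i" "SB i \<subseteq> gr B i" for i unfolding SA(2) SB(2)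
      by (rule A.span_superset B.span_superset)+
  have 2: "SA i \<subseteq> carr A" "SB i \<subseteq> carr B" for i using 1 gr_carr by blast+
  have "gr C n = F.span ?S"
  proof
    have "x \<in> F.span ?S" if x: "x \<in> gr C n" for x
    proof (rule tprod_subspaceI[OF gs(1,2) vs(3) linear_on_id F.subspace_span _ x])
      fix a b k l assume ab: "a \<in> gr A k" "b \<in> gr B l" "k + l = n"
      note cb = gr_carr(2)[OF ab(2)]
      have 3: "tAB a' b' \<in> F.span ?S" if "a' \<in> SA k" "b' \<in> SB l" for a' b'
        by (rule F.span_base, rule UN_I[of k]) (use that ab in auto)
      have 4: "tAB a' b \<in> F.span ?S" if a': "a' \<in> SA k" for a'
      proof -
        have "a' \<in> carr A" using a' 2 by blast
        note l = tens_lin(2)[OF this]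
        show ?thesis
          by (rule linear_on_span_subspace[OF vs(2,3) l graded_spaceD(3)[OF gs(2)] 2(2)
              F.subspace_span 3[OF a'] ab(2)[unfolded SB(2)]])
      qed
      show "tAB a b \<in> F.span ?S"
        by (rule linear_on_span_subspace[OF vs(1,3) tens_lin(1)[OF cb] graded_spaceD(3)[OF gs(1)]
            2(1) F.subspace_span 4 ab(1)[unfolded SA(2)]])
    qed
    then show "gr C n \<subseteq> F.span ?S" by blast
    show "F.span ?S \<subseteq> gr C n"
    proof (rule F.span_minimal)
      show "?S \<subseteq> gr C n"
      proof clarsimp
        fix i a b assume "i \<le> n" "a \<in> SA i" "b \<in> SB (n - i)"
        then show "tAB a b \<in> gr C n" using 1 by (intro tens_gr[of a A i b B "n - i"]) auto
      qed
    qed (rule sub)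
  qed
  moreover have "finite ?S" using SA(1) SB(1) by auto
  ultimately show ?thesis by blast
qed

lemma gr_C_0: "gr C 0 = range (\<lambda>c. fun_scale c (tAB (one A) (one B)))"
proof
  interpret F: vector_space "fun_scale :: 'k \<Rightarrow> (('a \<Rightarrow> 'b \<Rightarrow> 'k) \<Rightarrow> 'k) \<Rightarrow> _" by (rule vs)
  have r: "F.span {tAB (one A) (one B)} = range (\<lambda>c. fun_scale c (tAB (one A) (one B)))"
    by (rule F.span_singleton)
  have "x \<in> F.span {tAB (one A) (one B)}" if x: "x \<in> gr C 0" for x
  proof (rule tprod_subspaceI[OF gs(1,2) vs(3) linear_on_id F.subspace_span _ x])
    fix a b k l :: _ assume ab: "a \<in> gr A k" "b \<in> gr B l" "k + l = 0"
    then obtain c d where cd: "a = smul A c (one A)" "b = smul B d (one B)"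
      using graded_algebraD(7)[OF A] graded_algebraD(7)[OF B] by auto
    show "tAB a b \<in> F.span {tAB (one A) (one B)}"
      unfolding cd by (simp add: tens_scale_left tens_scale_right F.span_scale F.span_base)
  qed
  then show "gr C 0 \<subseteq> range (\<lambda>c. fun_scale c (tAB (one A) (one B)))" unfolding r by blast
  show "range (\<lambda>c. fun_scale c (tAB (one A) (one B))) \<subseteq> gr C 0"
    using F.subspace_scale[OF sub(3)] tens_gr'(1)[OF one_in(3,4)] by auto
qed

lemma graded_algebra_twisted_tensor:
  assumes tw: "graded_twisting A B t"
  shows "graded_algebra (twisted_tensor A B t)"
proof -
  note t = graded_twistingD(1)[OF tw] and u = graded_twistingD(2)[OF tw] and h =
      graded_twistingD(3)[OF tw]
  note [simp] = tmul_in[OF t]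
  have assoc: "tmul t (tmul t x y) z = tmul t x (tmul t y z)"
    if x: "x \<in> carr C" and y: "y \<in> carr C" and z: "z \<in> carr C" for x y z
  proof -
    note l = tmul_lin[OF t]
    \<comment> \<open>Associativity is known for homogeneous elements. Linearity extends it to one
      argument after the other, beginning with \<open>z\<close>.\<close>
    have 3: "tmul t (tmul t x y) z = tmul t x (tmul t y z)"
      if x: "x \<in> gr C i" and y: "y \<in> gr C j" for x y i j
    proof (rule carr_eqI[OF gs(3) _ _ _ _ z])
      have c: "x \<in> carr C" "y \<in> carr C" using x y gr_carr by auto
      show "linear_on (smul C) (carr C) fun_scale (\<lambda>z. tmul t x (tmul t y z))"
        unfolding smul_tprod by (rule linear_on_comp[OF l(2) _ l(2)]) (use c in auto)
      show "linear_on (smul C) (carr C) fun_scale (tmul t (tmul t x y))"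
        unfolding smul_tprod by (rule l) (use c in auto)
    qed (use tmul_assoc_gr[OF t u h x y _ le_refl] in simp_all)
    have 2: "tmul t (tmul t x y) z = tmul t x (tmul t y z)"
      if x: "x \<in> gr C i" for x i
    proof (rule carr_eqI[OF gs(3) _ _ _ _ y])
      have c: "x \<in> carr C" using x gr_carr by auto
      show "linear_on (smul C) (carr C) fun_scale (\<lambda>y. tmul t x (tmul t y z))"
        unfolding smul_tprod by (rule linear_on_comp[OF l(1) _ l(2)]) (use c z in auto)
      show "linear_on (smul C) (carr C) fun_scale (\<lambda>y. tmul t (tmul t x y) z)"
        unfolding smul_tprod by (rule linear_on_comp[OF l(2) _ l(1)]) (use c z in auto)
    qed (use 3[OF x] in simp_all)
    show ?thesis
    proof (rule carr_eqI[OF gs(3) _ _ _ _ x])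
      show "linear_on (smul C) (carr C) fun_scale (\<lambda>x. tmul t x (tmul t y z))"
        unfolding smul_tprod by (rule l(1)) (use y z in auto)
      show "linear_on (smul C) (carr C) fun_scale (\<lambda>x. tmul t (tmul t x y) z)"
        unfolding smul_tprod by (rule linear_on_comp[OF l(1) _ l(1)]) (use y z in auto)
    qed (use 2 in simp_all)
  qed
  have unit: "tmul t (tAB (one A) (one B)) x = x \<and> tmul t x (tAB (one A) (one B)) = x"
    if x: "x \<in> carr C" for x
  proof
    have l: "linear_on (smul C) (carr C) fun_scale (\<lambda>x. x)" by (simp add: linear_on_id)
    show "tmul t (tAB (one A) (one B)) x = x"
    proof (rule carr_eqI[OF gs(3) vs(3) _ l _ x])
      show "linear_on (smul C) (carr C) fun_scale (tmul t (tAB (one A) (one B)))"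
        unfolding smul_tprod by (rule tmul_lin(2)[OF t]) simp
      fix n v assume v: "v \<in> gr C n"
      show "tmul t (tAB (one A) (one B)) v = v"
        using tmul_left_unit[OF t u v le_refl one_in(1)] act_one[OF gr_carr(3)[OF v]] by simp
    qed
    show "tmul t x (tAB (one A) (one B)) = x"
    proof (rule carr_eqI[OF gs(3) vs(3) _ l _ x])
      show "linear_on (smul C) (carr C) fun_scale (\<lambda>x. tmul t x (tAB (one A) (one B)))"
        unfolding smul_tprod by (rule tmul_lin(1)[OF t]) simp
      fix n v assume v: "v \<in> gr C n"
      show "tmul t v (tAB (one A) (one B)) = v"
        using tmul_right_unit[OF t u v le_refl one_in(2)] act_one[OF gr_carr(3)[OF v]] by simp
    qed
  qed
  show ?thesis unfolding graded_algebra_def twisted_tensor_simps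
  proof (intro conjI allI ballI)
    show "graded_space (twisted_tensor A B t)"
      using gs(3) unfolding graded_space_def twisted_tensor_simps smul_tprod .
    show "bilinear_on (twisted_tensor A B t) (twisted_tensor A B t) fun_scale (tmul t)"
      unfolding bilinear_on_def twisted_tensor_simps using tmul_lin[OF t] by blast
    show "tmul t x y \<in> gr C (m + n)" if "x \<in> gr C m" "y \<in> gr C n" for m n x y
      by (rule tmul_gr[OF t that refl])
    show "gr C 0 = range (\<lambda>c. fun_scale c (tAB (one A) (one B)))" by (rule gr_C_0)
    show "\<exists>S. finite S \<and> gr C n = module.span fun_scale S" for n by (rule gr_C_finite)
  qed (rule assoc unit[THEN conjunct1] unit[THEN conjunct2]; assumption)+
qed

end

section \<open>The tensor algebra\<close>

declare One_nat_def [simp del]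

lemma multilinear_form_affix:
  assumes "multilinear_form s U \<phi>" "xs \<in> lists U" "ys \<in> lists U"
  shows "multilinear_form s U (\<lambda>zs. \<phi> (xs @ zs @ ys))"
  unfolding multilinear_form_def
proof (intro ballI)
  fix as bs assume "as \<in> lists U" "bs \<in> lists U"
  then have "linear_on s U (*) (\<lambda>u. \<phi> ((xs @ as) @ u # (bs @ ys)))"
    using assms unfolding multilinear_form_def by (meson append_in_lists_conv)
  then show "linear_on s U (*) (\<lambda>u. \<phi> (xs @ (as @ u # bs) @ ys))" by simp
qed

lemma multilinear_form_prefix:
  "multilinear_form s U \<phi> \<Longrightarrow> xs \<in> lists U \<Longrightarrow> multilinear_form s U (\<lambda>zs. \<phi> (xs @ zs))"
  using multilinear_form_affix[of s U \<phi> xs "[]"] by simp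

lemma multilinear_form_suffix:
  "multilinear_form s U \<phi> \<Longrightarrow> ys \<in> lists U \<Longrightarrow> multilinear_form s U (\<lambda>zs. \<phi> (zs @ ys))"
  using multilinear_form_affix[of s U \<phi> "[]" ys] by simp

locale tensor_alg =
  fixes s :: "'k::field \<Rightarrow> 'v::ab_group_add \<Rightarrow> 'v" and U :: "'v set"
  assumes vs: "vector_space s" and subU: "module.subspace s U"
begin

abbreviation "T \<equiv> tensor_algebra s U"

sublocale F: vector_space "fun_scale :: 'k \<Rightarrow> (('v list \<Rightarrow> 'k) \<Rightarrow> 'k) \<Rightarrow> _"
  by (rule vector_space_fun_scale)

lemma T_smul [simp]: "smul T = fun_scale"
  by (simp add: tensor_algebra_def)

lemma gr_T: "gr T n = F.span {word s U xs | xs. xs \<in> lists U \<and> length xs = n}"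
  by (simp add: tensor_algebra_def)

lemma word_gr: "xs \<in> lists U \<Longrightarrow> word s U xs \<in> gr T (length xs)"
  unfolding gr_T by (rule F.span_base) blast

lemma carr_T: "carr T = F.span {word s U xs | xs. xs \<in> lists U}" (is "_ = F.span ?W")
proof -
  have "F.span (\<Union>n. gr T n) = F.span ?W"
  proof
    show "F.span (\<Union>n. gr T n) \<subseteq> F.span ?W"
      by (rule F.span_minimal[OF _ F.subspace_span])
          (auto simp: gr_T intro: F.span_mono[THEN subsetD, rotated])
    have "?W \<subseteq> (\<Union>n. gr T n)" using word_gr by blast
    then show "F.span ?W \<subseteq> F.span (\<Union>n. gr T n)" by (rule F.span_mono)
  qed
  then show ?thesis by (simp add: carr_def)
qed

lemma gr_T_carr: "x \<in> gr T n \<Longrightarrow> x \<in> carr T"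
  unfolding carr_def T_smul by (rule F.span_base) blast

lemma word_carr [simp]: "xs \<in> lists U \<Longrightarrow> word s U xs \<in> carr T"
  using word_gr gr_T_carr by blast

lemma T_sub [simp]: "F.subspace (carr T)" "F.subspace (gr T n)"
  unfolding carr_T gr_T by (rule F.subspace_span)+

lemma T_closed [simp]:
  "x \<in> carr T \<Longrightarrow> y \<in> carr T \<Longrightarrow> x + y \<in> carr T"
  "x \<in> carr T \<Longrightarrow> y \<in> carr T \<Longrightarrow> x - y \<in> carr T"
  "x \<in> carr T \<Longrightarrow> fun_scale c x \<in> carr T" "0 \<in> carr T"
  using F.subspace_add[OF T_sub(1)] F.subspace_diff[OF T_sub(1)] F.subspace_scale[OF T_sub(1)]
      F.subspace_0[OF T_sub(1)]
  by auto

lemma T_subspaceI: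
  assumes "vector_space s'" "linear_on fun_scale (carr T) s' f" "module.subspace s' Z"
    "\<And>xs. xs \<in> lists U \<Longrightarrow> f (word s U xs) \<in> Z" "x \<in> carr T"
  shows "f x \<in> Z"
  by (rule linear_on_span_subspace[OF vector_space_fun_scale assms(1,2) T_sub(1) _ assms(3) _
      assms(5)[unfolded carr_T]])
    (use assms(4) word_carr in \<open>blast+\<close>)

lemma T_gr_subspaceI:
  assumes "vector_space s'" "linear_on fun_scale (carr T) s' f" "module.subspace s' Z"
    "\<And>xs. xs \<in> lists U \<Longrightarrow> length xs = n \<Longrightarrow> f (word s U xs) \<in> Z" "x \<in> gr T n"
  shows "f x \<in> Z"
  by (rule linear_on_span_subspace[OF vector_space_fun_scale assms(1,2) T_sub(1) _ assms(3) _
      assms(5)[unfolded gr_T]])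
    (use assms(4) word_carr in \<open>blast+\<close>)

lemma T_eqI:
  assumes "vector_space s'" "linear_on fun_scale (carr T) s' f" "linear_on fun_scale (carr T) s' g"
    "\<And>xs. xs \<in> lists U \<Longrightarrow> f (word s U xs) = g (word s U xs)" "x \<in> carr T"
  shows "f x = g x"
  by (rule subspace_eqI[OF vector_space_fun_scale assms(1-3) T_sub(1) _ _ assms(5)[unfolded
      carr_T]])
    (use assms(4) word_carr in \<open>blast+\<close>)

lemma T_gr_eqI:
  assumes "vector_space s'" "linear_on fun_scale (carr T) s' f" "linear_on fun_scale (carr T) s' g"
    "\<And>xs. xs \<in> lists U \<Longrightarrow> length xs = n \<Longrightarrow> f (word s U xs) = g (word s U xs)" "x \<in> gr T n"
  shows "f x = g x"
  by (rule subspace_eqI[OF vector_space_fun_scale assms(1-3) T_sub(1) _ _ assms(5)[unfolded gr_T]])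
    (use assms(4) word_carr in \<open>blast+\<close>)

lemma vs_K: "vector_space ((*) :: 'k \<Rightarrow> 'k \<Rightarrow> 'k)"
  by unfold_locales (auto simp: algebra_simps)

lemma eval_lin: "linear_on fun_scale V (*) (\<lambda>x. x \<phi>)"
  by (simp add: linear_on_def fun_scale_def)

lemma word_eval: "multilinear_form s U \<phi> \<Longrightarrow> word s U xs \<phi> = \<phi> xs"
  by (simp add: word_def)

text \<open>A homogeneous element of degree \<open>n\<close> sees a multilinear form only through
  its values on words of length \<open>n\<close>, which span that degree.\<close>

lemma eval_gr_cong:
  assumes "multilinear_form s U \<phi>" "multilinear_form s U \<psi>"
    "\<And>xs. xs \<in> lists U \<Longrightarrow> length xs = n \<Longrightarrow> \<phi> xs = \<psi> xs" "x \<in> gr T n"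
  shows "x \<phi> = x \<psi>"
  by (rule T_gr_eqI[OF vs_K eval_lin eval_lin _ assms(4)]) (simp add: word_eval assms)

text \<open>The product of the tensor algebra evaluates its left factor at the function that sends
  \<open>xs\<close> to the value of \<open>y\<close> on the continuations of \<open>xs\<close>. This
  function has to be multilinear itself, for otherwise a word would send it to the default value
  0.\<close>

lemma multilinear_form_eval:
  assumes \<phi>: "multilinear_form s U \<phi>" and y: "y \<in> carr T"
  shows "multilinear_form s U (\<lambda>xs. y (\<lambda>ys. \<phi> (xs @ ys)))"
  unfolding multilinear_form_def linear_on_def
proof (intro ballI conjI allI)
  interpret vector_space s by (rule vs)
  fix as bs u c assume ab: "as \<in> lists U" "bs \<in> lists U" and u: "u \<in> U"
  have p: "multilinear_form s U (\<lambda>ys. \<phi> (xs @ ys))" if "xs \<in> lists U" for xs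
    using multilinear_form_prefix[OF \<phi> that] .
  have l: "linear_on s U (*) (\<lambda>u. \<phi> (as @ u # bs @ ys))" if "ys \<in> lists U" for ys
    using \<phi> ab that unfolding multilinear_form_def by (meson append_in_lists_conv)
  show "y (\<lambda>ys. \<phi> ((as @ s c u # bs) @ ys)) = c * y (\<lambda>ys. \<phi> ((as @ u # bs) @ ys))"
  proof (rule T_eqI[OF vs_K eval_lin linear_on_scale[OF vs_K eval_lin] _ y])
    fix ys assume ys: "ys \<in> lists U"
    show "word s U ys (\<lambda>ys. \<phi> ((as @ s c u # bs) @ ys)) =
        c * word s U ys (\<lambda>ys. \<phi> ((as @ u # bs) @ ys))"
      using l[OF ys] p[of "as @ s c u # bs"] p[of "as @ u # bs"] ab u subspace_scale[OF subU u]
      by (simp add: word_eval linear_on_def)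
  qed
  fix v assume v: "v \<in> U"
  show "y (\<lambda>ys. \<phi> ((as @ (u + v) # bs) @ ys)) = y (\<lambda>ys. \<phi> ((as @ u # bs) @ ys)) + y (\<lambda>ys. \<phi>
      ((as @ v # bs) @ ys))"
  proof (rule T_eqI[OF vs_K eval_lin linear_on_plus[OF vs_K eval_lin eval_lin] _ y])
    fix ys assume ys: "ys \<in> lists U"
    show "word s U ys (\<lambda>ys. \<phi> ((as @ (u + v) # bs) @ ys)) =
      word s U ys (\<lambda>ys. \<phi> ((as @ u # bs) @ ys)) + word s U ys (\<lambda>ys. \<phi> ((as @ v # bs) @ ys))"
      using l[OF ys] p[of "as @ (u + v) # bs"] p[of "as @ u # bs"] p[of "as @ v # bs"] ab u v
          subspace_add[OF subU u v]
      by (simp add: word_eval linear_on_def)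
  qed
qed

lemma mul_T: "mul T x y \<phi> = (if multilinear_form s U \<phi> then x (\<lambda>xs. y (\<lambda>ys. \<phi> (xs @ ys))) else 0)"
  by (simp add: tensor_algebra_def)

lemma mul_word_left:
  assumes "multilinear_form s U \<phi>" "xs \<in> lists U" "y \<in> carr T"
  shows "mul T (word s U xs) y \<phi> = y (\<lambda>ys. \<phi> (xs @ ys))"
  using multilinear_form_eval[OF assms(1,3)] assms(1) by (simp add: mul_T word_eval)

lemma mul_T_lin1: "linear_on fun_scale V fun_scale (\<lambda>x. mul T x y)"
  by (auto simp: linear_on_def mul_T fun_eq_iff fun_scale_def)

lemma mul_T_lin2:
  assumes x: "x \<in> carr T" shows "linear_on fun_scale (carr T) fun_scale (mul T x)"
  unfolding linear_on_def
proof (intro conjI ballI allI)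
  fix y z c assume y: "y \<in> carr T"
  show "mul T x (fun_scale c y) = fun_scale c (mul T x y)"
  proof (rule T_eqI[OF vector_space_fun_scale mul_T_lin1 linear_on_scale[OF vector_space_fun_scale
      mul_T_lin1] _ x], rule ext)
    fix xs \<phi> assume xs: "xs \<in> lists U"
    show "mul T (word s U xs) (fun_scale c y) \<phi> = fun_scale c (mul T (word s U xs) y) \<phi>"
    proof (cases "multilinear_form s U \<phi>")
      case True
      then show ?thesis using xs y
        by (simp add: mul_word_left[OF _ _ y] mul_word_left[OF _ _ T_closed(3)[OF y]]
            fun_scale_apply)
    qed (simp add: mul_T fun_scale_apply)
  qed
  assume z: "z \<in> carr T"
  show "mul T x (y + z) = mul T x y + mul T x z"
  proof (rule T_eqI[OF vector_space_fun_scale mul_T_lin1 linear_on_plus[OF vector_space_fun_scale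
      mul_T_lin1 mul_T_lin1] _ x], rule ext)
    fix xs \<phi> assume xs: "xs \<in> lists U"
    show "mul T (word s U xs) (y + z) \<phi> = (mul T (word s U xs) y + mul T (word s U xs) z) \<phi>"
    proof (cases "multilinear_form s U \<phi>")
      case True
      then show ?thesis using xs y z
        by (simp add: mul_word_left[OF _ _ y] mul_word_left[OF _ _ z] mul_word_left[OF _ _
            T_closed(1)[OF y z]])
    qed (simp add: mul_T)
  qed
qed

lemma mul_word_word: "xs \<in> lists U \<Longrightarrow> ys \<in> lists U \<Longrightarrow> mul T (word s U xs) (word s U ys) =
    word s U (xs @ ys)"
  by (rule tensor_algebra_mul_word[OF vs subU])

lemma mul_word_right:
  assumes \<psi>: "multilinear_form s U \<psi>" and rs: "rs \<in> lists U" and x: "x \<in> carr T"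
  shows "mul T x (word s U rs) \<psi> = x (\<lambda>zs. \<psi> (zs @ rs))"
proof (rule T_eqI[OF vs_K linear_on_comp[OF mul_T_lin1[of "carr T"] _ eval_lin] eval_lin _ x])
  fix xs assume "xs \<in> lists U"
  then show "mul T (word s U xs) (word s U rs) \<psi> = word s U xs (\<lambda>zs. \<psi> (zs @ rs))"
    using rs by (simp add: mul_word_word word_eval[OF \<psi>] word_eval[OF multilinear_form_suffix[OF \<psi>
        rs]])
qed (rule UNIV_I)

lemma mul_T_gr:
  assumes x: "x \<in> gr T m" and y: "y \<in> gr T n" shows "mul T x y \<in> gr T (m + n)"
proof (rule T_gr_subspaceI[OF vector_space_fun_scale mul_T_lin1 T_sub(2) _ x])
  fix xs assume xs: "xs \<in> lists U" "length xs = m"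
  show "mul T (word s U xs) y \<in> gr T (m + n)"
  proof (rule T_gr_subspaceI[OF vector_space_fun_scale mul_T_lin2 T_sub(2) _ y])
    fix ys assume ys: "ys \<in> lists U" "length ys = n"
    show "mul T (word s U xs) (word s U ys) \<in> gr T (m + n)"
      using word_gr[of "xs @ ys"] xs ys by (simp add: mul_word_word)
  qed (use xs in simp)
qed

lemma mul_T_carr [simp]:
  assumes x: "x \<in> carr T" and y: "y \<in> carr T" shows "mul T x y \<in> carr T"
proof (rule T_subspaceI[OF vector_space_fun_scale mul_T_lin1 T_sub(1) _ x])
  fix xs assume xs: "xs \<in> lists U"
  show "mul T (word s U xs) y \<in> carr T"
    by (rule T_subspaceI[OF vector_space_fun_scale mul_T_lin2 T_sub(1) _ y])
        (use xs in \<open>simp_all add: mul_word_word\<close>)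
qed

lemma mul_T_assoc:
  assumes x: "x \<in> carr T" and y: "y \<in> carr T" and z: "z \<in> carr T"
  shows "mul T (mul T x y) z = mul T x (mul T y z)"
proof -
  note v = vector_space_fun_scale
  show ?thesis
  proof (rule T_eqI[OF v linear_on_comp[OF mul_T_lin1[of "carr T"] _ mul_T_lin1[of "carr T"]]
      mul_T_lin1 _ x])
    fix xs assume xs: "xs \<in> lists U"
    show "mul T (mul T (word s U xs) y) z = mul T (word s U xs) (mul T y z)"
    proof (rule T_eqI[OF v linear_on_comp[OF mul_T_lin2 _ mul_T_lin1[of "carr T"]]
        linear_on_comp[OF mul_T_lin1 _ mul_T_lin2] _ y])
      fix ys assume ys: "ys \<in> lists U"
      show "mul T (mul T (word s U xs) (word s U ys)) z = mul T (word s U xs) (mul T (word s U ys)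
          z)"
        by (rule T_eqI[OF v mul_T_lin2 linear_on_comp[OF mul_T_lin2 _ mul_T_lin2] _ z])
          (use xs ys in \<open>simp_all add: mul_word_word\<close>)
    qed (use xs z in simp_all)
  qed (use y in simp_all)
qed

lemma one_T: "one T = word s U []"
  by (simp add: tensor_algebra_def)

lemma one_T_in [simp]: "one T \<in> carr T" "one T \<in> gr T 0"
  using word_gr[of "[]"] by (simp_all add: one_T)

lemma mul_T_one [simp]:
  assumes x: "x \<in> carr T" shows "mul T (one T) x = x" "mul T x (one T) = x"
proof -
  show "mul T (one T) x = x"
    by (rule T_eqI[OF vector_space_fun_scale mul_T_lin2 linear_on_id _ x])
        (simp_all add: one_T mul_word_word)
  show "mul T x (one T) = x"
    by (rule T_eqI[OF vector_space_fun_scale mul_T_lin1 linear_on_id _ x])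
        (simp_all add: one_T mul_word_word)
qed

lemma mul_T_diff:
  "x \<in> carr T \<Longrightarrow> y \<in> carr T \<Longrightarrow> mul T (x - y) z = mul T x z - mul T y z"
  "x \<in> carr T \<Longrightarrow> y \<in> carr T \<Longrightarrow> z \<in> carr T \<Longrightarrow> mul T z (x - y) = mul T z x - mul T z y"
  using linear_on_diff[OF vector_space_fun_scale vector_space_fun_scale T_sub(1) mul_T_lin1]
    linear_on_diff[OF vector_space_fun_scale vector_space_fun_scale T_sub(1) mul_T_lin2] by auto

lemma two_sided_idealD:
  assumes "two_sided_ideal T I"
  shows "F.subspace I" "x \<in> I \<Longrightarrow> x \<in> carr T" "r \<in> carr T \<Longrightarrow> x \<in> I \<Longrightarrow> mul T r x \<in> I"
    "r \<in> carr T \<Longrightarrow> x \<in> I \<Longrightarrow> mul T x r \<in> I"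
  using assms by (auto simp: two_sided_ideal_def)

lemma ideal_generated:
  assumes S: "S \<subseteq> carr T"
  shows "two_sided_ideal T (ideal_generated T S)" "S \<subseteq> ideal_generated T S"
    "two_sided_ideal T I \<Longrightarrow> S \<subseteq> I \<Longrightarrow> ideal_generated T S \<subseteq> I"
proof -
  have top: "two_sided_ideal T (carr T)" by (simp add: two_sided_ideal_def)
  show "S \<subseteq> ideal_generated T S" by (auto simp: ideal_generated_def)
  show "two_sided_ideal T I \<Longrightarrow> S \<subseteq> I \<Longrightarrow> ideal_generated T S \<subseteq> I"
    by (auto simp: ideal_generated_def)
  have "F.subspace (\<Inter>{I. two_sided_ideal T I \<and> S \<subseteq> I})"
    by (rule F.subspace_Inter) (auto dest: two_sided_idealD)
  then show "two_sided_ideal T (ideal_generated T S)"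
    unfolding two_sided_ideal_def[of T "ideal_generated T S"] T_smul
  proof (intro conjI ballI)
    show "ideal_generated T S \<subseteq> carr T" using top S by (auto simp: ideal_generated_def)
    show "mul T r x \<in> ideal_generated T S" "mul T x r \<in> ideal_generated T S"
      if "r \<in> carr T" "x \<in> ideal_generated T S" for r x
      using that two_sided_idealD(3,4) unfolding ideal_generated_def by blast+
  qed (simp add: ideal_generated_def)
qed

text \<open>Existence of homogeneous components. Their uniqueness is later taken from the grading of
  the algebra to which the canonical map leads.\<close>

lemma T_decomp:
  assumes x: "x \<in> carr T"
  shows "\<exists>c S. (\<forall>i. c i \<in> gr T i) \<and> finite S \<and> (\<forall>i. i \<notin> S \<longrightarrow> c i = 0) \<and> x = (\<Sum>i\<in>S. c i)"
  using x unfolding carr_def T_smul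
proof (induction rule: F.span_induct_alt)
  case base
  show ?case
    by (intro exI[of _ "\<lambda>_. 0"] exI[of _ "{}"] conjI allI impI F.subspace_0[OF T_sub(2)]
      finite.emptyI refl sum.empty[symmetric])
next
  case (step a x y)
  then obtain k where k: "x \<in> gr T k" by blast
  from step obtain c S where c: "\<forall>i. c i \<in> gr T i" "finite S" "\<forall>i. i \<notin> S \<longrightarrow> c i = 0"
    "y = (\<Sum>i\<in>S. c i)" by blast
  define d where "d i = (if i = k then fun_scale a x else 0) + c i" for i
  have "(\<Sum>i\<in>insert k S. d i) =
      (\<Sum>i\<in>insert k S. if i = k then fun_scale a x else 0) + (\<Sum>i\<in>insert k S. c i)"
    unfolding d_def by (rule sum.distrib)
  also have "(\<Sum>i\<in>insert k S. if i = k then fun_scale a x else 0) = fun_scale a x"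
    using c(2) by (simp add: sum.delta)
  also have "(\<Sum>i\<in>insert k S. c i) = y"
    unfolding c(4) by (rule sum.mono_neutral_right) (use c in auto)
  finally have 1: "fun_scale a x + y = (\<Sum>i\<in>insert k S. d i)" by (rule sym)
  have 2: "d i \<in> gr T i" for i
  proof -
    have "(if i = k then fun_scale a x else 0) \<in> gr T i"
      using k F.subspace_scale[OF T_sub(2)] F.subspace_0[OF T_sub(2)] by auto
    then show ?thesis using c(1) F.subspace_add[OF T_sub(2)] unfolding d_def by blast
  qed
  have 3: "d i = 0" if "i \<notin> insert k S" for i
    using that c(3) unfolding d_def by (metis add.right_neutral insert_iff)
  show ?case using 1 2 3 c(2) by (intro exI[of _ d] exI[of _ "insert k S"]) blast
qed

end

section \<open>The canonical map from the tensor algebra, its kernel, and the ideal of quadratic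
  relations\<close>

locale canonical_map =
  fixes A :: "('k::field, 'v::ab_group_add) galgebra"
  assumes A: "graded_algebra A"
begin

lemma gA: "graded_space A" by (rule graded_algebraD(1)[OF A])

sublocale tensor_alg "smul A" "gr A 1"
  by (rule tensor_alg.intro graded_spaceD(1,2)[OF gA])+

abbreviation "w xs \<equiv> word (smul A) (gr A 1) xs"
abbreviation "\<pi> \<equiv> tcanon A"

lemma \<pi>_lin: "linear_on fun_scale (carr T) (smul A) \<pi>"
  using tcanon_universal(1)[OF A] by simp

lemma \<pi>_word: "xs \<in> lists (gr A 1) \<Longrightarrow> \<pi> (w xs) = foldr (mul A) xs (one A)"
  by (rule tcanon_universal(2)[OF A])

lemma A1_carr: "x \<in> gr A 1 \<Longrightarrow> x \<in> carr A"
  using graded_spaceD(4)[OF gA] .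

lemma foldr_gr: "xs \<in> lists (gr A 1) \<Longrightarrow> foldr (mul A) xs (one A) \<in> gr A (length xs)"
proof (induction xs)
  case Nil
  show ?case using graded_algebraD(9)[OF A] by simp
next
  case (Cons x xs)
  then show ?case using graded_algebraD(3)[OF A, of x 1 _ "length xs"] by (simp add: plus_1_eq_Suc)
qed

lemma foldr_carr: "xs \<in> lists (gr A 1) \<Longrightarrow> foldr (mul A) xs (one A) \<in> carr A"
  using foldr_gr graded_spaceD(4)[OF gA] by blast

lemma foldr_mul_append:
  assumes "xs \<in> lists (gr A 1)" "ys \<in> lists (gr A 1)"
  shows "foldr (mul A) (xs @ ys) (one A) = mul A (foldr (mul A) xs (one A)) (foldr (mul A) ys
      (one A))"
  using assms(1)
proof (induction xs)
  case Nil
  show ?case using graded_algebraD(5)[OF A foldr_carr[OF assms(2)]] by simp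
next
  case (Cons x xs)
  then show ?case
    using graded_algebraD(4)[OF A _ foldr_carr foldr_carr[OF assms(2)], of x xs] A1_carr by simp
qed

lemma \<pi>_gr: "x \<in> gr T n \<Longrightarrow> \<pi> x \<in> gr A n"
  by (rule T_gr_subspaceI[OF graded_spaceD(1)[OF gA] \<pi>_lin graded_spaceD(2)[OF gA]])
    (use foldr_gr in \<open>auto simp: \<pi>_word\<close>)

lemma \<pi>_carr [simp]: "x \<in> carr T \<Longrightarrow> \<pi> x \<in> carr A"
  by (rule T_subspaceI[OF graded_spaceD(1)[OF gA] \<pi>_lin graded_spaceD(3)[OF gA]])
    (use foldr_carr in \<open>auto simp: \<pi>_word\<close>)

lemma \<pi>_mul:
  assumes x: "x \<in> carr T" and y: "y \<in> carr T"
  shows "\<pi> (mul T x y) = mul A (\<pi> x) (\<pi> y)"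
proof -
  note v = graded_spaceD(1)[OF gA]
  note b = bilinear_onD[OF graded_algebraD(2)[OF A]]
  show ?thesis
  proof (rule T_eqI[OF v linear_on_comp[OF mul_T_lin1 _ \<pi>_lin] linear_on_comp[OF \<pi>_lin _ b(1)] _ x])
    fix xs assume xs: "xs \<in> lists (gr A 1)"
    show "\<pi> (mul T (w xs) y) = mul A (\<pi> (w xs)) (\<pi> y)"
      by (rule T_eqI[OF v linear_on_comp[OF mul_T_lin2 _ \<pi>_lin] linear_on_comp[OF \<pi>_lin _ b(2)] _
          y])
        (use xs in \<open>simp_all add: mul_word_word \<pi>_word foldr_mul_append foldr_carr del:
            foldr_append\<close>)
  qed (use y in simp_all)
qed

lemma \<pi>_diff: "x \<in> carr T \<Longrightarrow> y \<in> carr T \<Longrightarrow> \<pi> (x - y) = \<pi> x - \<pi> y"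
  by (rule linear_on_diff[OF vector_space_fun_scale graded_spaceD(1)[OF gA] T_sub(1) \<pi>_lin])

lemma \<pi>_one: "\<pi> (one T) = one A"
  by (simp add: one_T \<pi>_word)

lemma \<pi>_0: "\<pi> 0 = 0"
  by (rule linear_on_0[OF vector_space_fun_scale graded_spaceD(1)[OF gA] T_sub(1) \<pi>_lin])

lemma \<pi>_letter: "x \<in> gr A 1 \<Longrightarrow> \<pi> (w [x]) = x"
  using graded_algebraD(6)[OF A A1_carr] by (simp add: \<pi>_word)

abbreviation "K \<equiv> tcanon_kernel A"

lemma kernel_ideal: "two_sided_ideal T K"
  unfolding two_sided_ideal_def
proof (intro conjI ballI)
  interpret A: vector_space "smul A" by (rule graded_spaceD(1)[OF gA])
  show "module.subspace (smul T) K"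
    unfolding T_smul F.subspace_def using \<pi>_lin by (auto simp: tcanon_kernel_def \<pi>_0 linear_on_def)
  show "K \<subseteq> carr T" by (auto simp: tcanon_kernel_def)
  note b = bilinear_onD[OF graded_algebraD(2)[OF A]]
  note z = linear_on_0[OF graded_spaceD(1)[OF gA] graded_spaceD(1)[OF gA] graded_spaceD(3)[OF gA]]
  show "mul T r x \<in> K" if "r \<in> carr T" "x \<in> K" for r x
    using that z[OF b(2)[of "\<pi> r"]] by (simp add: tcanon_kernel_def \<pi>_mul)
  show "mul T x r \<in> K" if "r \<in> carr T" "x \<in> K" for r x
    using that z[OF b(1)[of "\<pi> r"]] by (simp add: tcanon_kernel_def \<pi>_mul)
qed

abbreviation "I \<equiv> ideal_generated T (K \<inter> gr T 2)"

lemma I_ideal: "two_sided_ideal T I" and I_base: "K \<inter> gr T 2 \<subseteq> I" and I_K: "I \<subseteq> K"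
  and I_min: "two_sided_ideal T J \<Longrightarrow> K \<inter> gr T 2 \<subseteq> J \<Longrightarrow> I \<subseteq> J"
proof -
  have 1: "K \<inter> gr T 2 \<subseteq> carr T" by (auto simp: tcanon_kernel_def)
  note i = ideal_generated[OF 1]
  show "two_sided_ideal T I" "K \<inter> gr T 2 \<subseteq> I" by (rule i)+
  show "I \<subseteq> K" by (rule i(3)[OF kernel_ideal]) blast
  show "two_sided_ideal T J \<Longrightarrow> K \<inter> gr T 2 \<subseteq> J \<Longrightarrow> I \<subseteq> J" by (rule i(3))
qed

text \<open>The kernel is graded: the images of the components of \<open>x\<close> are the
  components of \<open>\<pi> x\<close>, which is 0, so each component lies in the kernel.\<close>

lemma kernel_decomp:
  assumes x: "x \<in> K" and Z: "F.subspace Z" and hom: "\<And>n y. y \<in> K \<Longrightarrow> y \<in> gr T n \<Longrightarrow> y \<in> Z"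
  shows "x \<in> Z"
proof -
  from x have xT: "x \<in> carr T" and x0: "\<pi> x = 0" by (auto simp: tcanon_kernel_def)
  obtain c S where c: "\<And>i. c i \<in> gr T i" "finite S" "\<And>i. i \<notin> S \<Longrightarrow> c i = 0" "x = (\<Sum>i\<in>S. c i)"
    using T_decomp[OF xT] by blast
  have s: "\<pi> x = (\<Sum>i\<in>S. \<pi> (c i))"
    unfolding c(4) by (rule linear_on_sum[OF vector_space_fun_scale graded_spaceD(1)[OF gA]
        T_sub(1) \<pi>_lin])
      (use c(1) gr_T_carr in blast)
  have z: "\<pi> (c i) = 0" for i
  proof -
    have "hcomp A i (\<pi> x) = \<pi> (c i)"
      by (rule hcomp_eq[OF gA _ c(2) _ s]) (use c \<pi>_gr in \<open>auto simp: \<pi>_0\<close>)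
    moreover have "hcomp A i 0 = 0"
      by (rule hcomp_eq[OF gA, of "\<lambda>_. 0" "{}"]) (use gr_closed(3)[OF gA] in auto)
    ultimately show ?thesis using x0 by simp
  qed
  have "c i \<in> Z" for i
    using hom[OF _ c(1)] gr_T_carr[OF c(1)] z by (simp add: tcanon_kernel_def)
  then show ?thesis unfolding c(4) by (intro F.subspace_sum[OF Z]) auto
qed

text \<open>Any preimage of \<open>a\<close> can be replaced by its component of degree
  \<open>n\<close>, because the canonical map preserves degree and components in the algebra are
  unique.\<close>

lemma gr_lift:
  assumes "one_generated A" and a: "a \<in> gr A n"
  shows "\<exists>x\<in>gr T n. \<pi> x = a"
proof -
  have "a \<in> \<pi> ` carr T" using assms graded_spaceD(4)[OF gA] by (auto simp: one_generated_def)
  then obtain x where x: "x \<in> carr T" "\<pi> x = a" by blast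
  obtain c S where c: "\<And>i. c i \<in> gr T i" "finite S" "\<And>i. i \<notin> S \<Longrightarrow> c i = 0" "x = (\<Sum>i\<in>S. c i)"
    using T_decomp[OF x(1)] by blast
  have s: "\<pi> x = (\<Sum>i\<in>S. \<pi> (c i))"
    unfolding c(4) by (rule linear_on_sum[OF vector_space_fun_scale graded_spaceD(1)[OF gA]
        T_sub(1) \<pi>_lin])
      (use c(1) gr_T_carr in blast)
  have "hcomp A n (\<pi> x) = \<pi> (c n)"
    by (rule hcomp_eq[OF gA _ c(2) _ s]) (use c \<pi>_gr in \<open>auto simp: \<pi>_0\<close>)
  then have "\<pi> (c n) = a" using x(2) hcomp_gr[OF gA a] by simp
  then show ?thesis using c(1) by blast
qed

text \<open>A form that depends on a word of length \<open>m\<close> only through its product in the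
  algebra is evaluated through the canonical map; in particular it vanishes on relations of degree
  \<open>m\<close>.\<close>

lemma eval_factor:
  assumes \<psi>: "multilinear_form (smul A) (gr A 1) \<psi>" and G: "linear_on (smul A) (carr A) (*) G"
    and eq: "\<And>zs. zs \<in> lists (gr A 1) \<Longrightarrow> length zs = m \<Longrightarrow> \<psi> zs = G (foldr (mul A) zs (one A))"
    and r: "r \<in> gr T m"
  shows "r \<psi> = G (\<pi> r)"
  by (rule T_gr_eqI[OF vs_K eval_lin linear_on_comp[OF \<pi>_lin _ G] _ r])
    (simp_all add: word_eval[OF \<psi>] eq \<pi>_word)

lemma quadratic_iff: "quadratic A \<longleftrightarrow> one_generated A \<and> K \<subseteq> I"
  using I_K by (auto simp: quadratic_def)

end

text \<open>
  The bound \<open>N\<close> makes it possible to glue sections in the single degrees by a finite sum.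
\<close>

lemma (in canonical_map) section_upto:
  assumes og: "one_generated A"
  shows "\<exists>S. linear_on (smul A) (carr A) fun_scale S \<and> (\<forall>a\<in>carr A. S a \<in> carr T) \<and>
    (\<forall>i\<le>N. \<forall>a\<in>gr A i. S a \<in> gr T i \<and> \<pi> (S a) = a)"
proof -
  note vA = graded_spaceD(1)[OF gA] and vF = vector_space_fun_scale
  have "\<exists>g. Vector_Spaces.linear (smul A) fun_scale g \<and> (\<forall>a\<in>gr A i. g a \<in> gr T i \<and> \<pi> (g a) =
      a)" for i
  proof (rule linear_on_right_inverse[OF vF vA _ T_sub(2) graded_spaceD(2)[OF gA]])
    show "linear_on fun_scale (gr T i) (smul A) \<pi>"
      by (rule linear_on_mono[OF \<pi>_lin]) (use gr_T_carr in blast)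
    show "gr A i \<subseteq> \<pi> ` gr T i" using gr_lift[OF og] by blast
  qed
  then obtain g where g: "\<And>i. Vector_Spaces.linear (smul A) fun_scale (g i)"
    "\<And>i a. a \<in> gr A i \<Longrightarrow> g i a \<in> gr T i" "\<And>i a. a \<in> gr A i \<Longrightarrow> \<pi> (g i a) = a" by metis
  have gl: "linear_on (smul A) (carr A) fun_scale (g i)" for i
  proof -
    interpret g: Vector_Spaces.linear "smul A" fun_scale "g i" by (rule g)
    show ?thesis by (simp add: linear_on_def g.add g.scale)
  qed
  have g0: "g i 0 = 0" for i by (rule linear_on_0[OF vA vF graded_spaceD(3)[OF gA] gl])
  define S where "S a = (\<Sum>i\<le>N. g i (hcomp A i a))" for a
  have h: "hcomp A i a \<in> carr A" if "a \<in> carr A" for i a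
    using linear_on_hcomp(2)[OF gA that] graded_spaceD(4)[OF gA] by blast
  have l: "linear_on (smul A) (carr A) fun_scale (\<lambda>a. \<Sum>i\<in>P. g i (hcomp A i a))" if "finite P" for P
    using that
  proof (induction P rule: finite_induct)
    case empty
    show ?case unfolding sum.empty by (rule linear_on_zero_map[OF vF])
  next
    case (insert i P)
    show ?case unfolding sum.insert[OF insert.hyps]
      by (rule linear_on_plus[OF vF linear_on_comp[OF linear_on_hcomp(1)[OF gA] h gl] insert.IH])
  qed
  have e: "S a = g i a" if "i \<le> N" "a \<in> gr A i" for i a
  proof -
    have "S a = (\<Sum>j\<le>N. if j = i then g i a else 0)"
      unfolding S_def by (rule sum.cong[OF refl]) (simp add: hcomp_gr[OF gA that(2)] g0)
    then show ?thesis using that(1) by (simp add: sum.delta)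
  qed
  have "linear_on (smul A) (carr A) fun_scale S" using l[of "{..N}"] by (simp add: S_def[abs_def])
  moreover have "S a \<in> carr T" if "a \<in> carr A" for a
    unfolding S_def
    by (rule F.subspace_sum[OF T_sub(1)])
        (use g(2) linear_on_hcomp(2)[OF gA that] gr_T_carr in blast)
  ultimately show ?thesis using e g by (intro exI[of _ S]) simp
qed

text \<open>One-generation makes degree n + 1 the span of the products of degree 1 with degree n: a
  word is cut behind its first letter. This is the induction principle for splitting letters off
  elements of A and B.\<close>

lemma (in canonical_map) gr_Suc_subspaceI:
  assumes og: "one_generated A" and X: "vector_space s'" and f: "linear_on (smul A) (carr A) s' f"
    and Z: "module.subspace s' Z" and base: "\<And>x y. x \<in> gr A 1 \<Longrightarrow> y \<in> gr A n \<Longrightarrow> f (mul A x y) \<in> Z"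
    and a: "a \<in> gr A (Suc n)"
  shows "f a \<in> Z"
proof -
  obtain u where u: "u \<in> gr T (Suc n)" "\<pi> u = a" using gr_lift[OF og a] by blast
  have "f (\<pi> u) \<in> Z"
  proof (rule T_gr_subspaceI[OF X linear_on_comp[OF \<pi>_lin _ f] Z _ u(1)])
    fix xs assume xs: "xs \<in> lists (gr A 1)" "length xs = Suc n"
    then obtain y ys where y: "xs = y # ys" by (cases xs) auto
    with xs foldr_gr[of ys] show "f (\<pi> (w xs)) \<in> Z" by (simp add: \<pi>_word base)
  qed simp
  then show ?thesis using u by simp
qed

lemma (in canonical_map) foldr_lin:
  assumes as: "as \<in> lists (gr A 1)" and bs: "bs \<in> lists (gr A 1)"
  shows "linear_on (smul A) (gr A 1) (smul A) (\<lambda>u. foldr (mul A) (as @ u # bs) (one A))"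
proof -
  note b = bilinear_onD[OF graded_algebraD(2)[OF A]]
  have "linear_on (smul A) (gr A 1) (smul A) (\<lambda>u. mul A (foldr (mul A) as (one A)) (mul A u (foldr
      (mul A) bs (one A))))"
    by (rule linear_on_comp[OF linear_on_mono[OF b(1)] _ b(2)])
      (use as bs A1_carr foldr_carr graded_algebraD(10)[OF A] in auto)
  then show ?thesis
    by (rule linear_on_cong) (use as bs graded_spaceD[OF gA] in \<open>auto simp: foldr_mul_append simp
        del: foldr_append\<close>)
qed

section \<open>Homomorphisms of graded algebras\<close>

locale algebra_hom =
  fixes A :: "('k::field, 'v::ab_group_add) galgebra" and E :: "('k, 'c::ab_group_add) galgebra"
    and \<iota> :: "'v \<Rightarrow> 'c"
  assumes A: "graded_algebra A" and E: "graded_algebra E"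
    and lin: "linear_on (smul A) (carr A) (smul E) \<iota>"
    and hom_gr: "\<And>n a. a \<in> gr A n \<Longrightarrow> \<iota> a \<in> gr E n"
    and hom_mul: "\<And>a b. a \<in> carr A \<Longrightarrow> b \<in> carr A \<Longrightarrow> \<iota> (mul A a b) = mul E (\<iota> a) (\<iota> b)"
    and hom_one: "\<iota> (one A) = one E"
begin

sublocale dom: canonical_map A by unfold_locales (rule A)
sublocale cod: canonical_map E by unfold_locales (rule E)

lemma map_\<iota>: "xs \<in> lists (gr A 1) \<Longrightarrow> map \<iota> xs \<in> lists (gr E 1)"
  by (induction xs) (simp_all add: hom_gr)

text \<open>The map of tensor algebras induced by \<iota>. Elements are functionals on forms, so
  applying \<iota> to each letter amounts to pulling the form back along \<iota>.\<close>

definition F :: "(('v list \<Rightarrow> 'k) \<Rightarrow> 'k) \<Rightarrow> ('c list \<Rightarrow> 'k) \<Rightarrow> 'k" where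
  "F x = (\<lambda>\<phi>. if multilinear_form (smul E) (gr E 1) \<phi> then x (\<lambda>xs. \<phi> (map \<iota> xs)) else 0)"

lemma F_lin: "linear_on fun_scale V fun_scale F"
  by (auto simp: linear_on_def F_def fun_eq_iff fun_scale_def)

lemma F_word:
  assumes xs: "xs \<in> lists (gr A 1)" shows "F (dom.w xs) = cod.w (map \<iota> xs)"
proof
  fix \<phi>
  have "multilinear_form (smul A) (gr A 1) (\<lambda>xs. \<phi> (map \<iota> xs))" if \<phi>: "multilinear_form (smul E)
      (gr E 1) \<phi>"
    unfolding multilinear_form_def
  proof (intro ballI)
    fix as bs assume "as \<in> lists (gr A 1)" "bs \<in> lists (gr A 1)"
    then have l: "linear_on (smul E) (gr E 1) (*) (\<lambda>u. \<phi> (map \<iota> as @ u # map \<iota> bs))"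
      using \<phi> map_\<iota> unfolding multilinear_form_def by blast
    have "linear_on (smul A) (gr A 1) (*) (\<lambda>u. \<phi> (map \<iota> as @ \<iota> u # map \<iota> bs))"
      by (rule linear_on_comp[OF linear_on_mono[OF lin] hom_gr l]) (use dom.A1_carr in auto)
    then show "linear_on (smul A) (gr A 1) (*) (\<lambda>u. \<phi> (map \<iota> (as @ u # bs)))" by simp
  qed
  then show "F (dom.w xs) \<phi> = cod.w (map \<iota> xs) \<phi>" by (simp add: F_def word_def)
qed

lemma F_gr: "x \<in> gr dom.T n \<Longrightarrow> F x \<in> gr cod.T n"
  by (rule dom.T_gr_subspaceI[OF vector_space_fun_scale F_lin cod.T_sub(2)])
    (use cod.word_gr[OF map_\<iota>] in \<open>auto simp: F_word\<close>)

lemma F_carr [simp]: "x \<in> carr dom.T \<Longrightarrow> F x \<in> carr cod.T"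
  by (rule dom.T_subspaceI[OF vector_space_fun_scale F_lin cod.T_sub(1)])
    (simp_all add: F_word map_\<iota>)

lemma F_mul:
  assumes x: "x \<in> carr dom.T" and y: "y \<in> carr dom.T"
  shows "F (mul dom.T x y) = mul cod.T (F x) (F y)"
proof -
  note v = vector_space_fun_scale
  show ?thesis
  proof (rule dom.T_eqI[OF v linear_on_comp[OF dom.mul_T_lin1 _ F_lin[of "carr dom.T"]]
      linear_on_comp[OF F_lin _ cod.mul_T_lin1[of "carr cod.T"]] _ x])
    fix xs assume xs: "xs \<in> lists (gr A 1)"
    show "F (mul dom.T (dom.w xs) y) = mul cod.T (F (dom.w xs)) (F y)"
      by (rule dom.T_eqI[OF v linear_on_comp[OF dom.mul_T_lin2 _ F_lin[of "carr dom.T"]]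
          linear_on_comp[OF F_lin _ cod.mul_T_lin2] _ y])
        (use xs in \<open>simp_all add: F_word map_\<iota> dom.mul_word_word cod.mul_word_word\<close>)
  qed (use y in simp_all)
qed

lemma F_one: "F (one dom.T) = one cod.T"
  by (simp add: dom.one_T cod.one_T F_word)

lemma F_diff: "x \<in> carr dom.T \<Longrightarrow> y \<in> carr dom.T \<Longrightarrow> F (x - y) = F x - F y"
  by (rule linear_on_diff[OF vector_space_fun_scale vector_space_fun_scale dom.T_sub(1) F_lin])

lemma foldr_\<iota>: "xs \<in> lists (gr A 1) \<Longrightarrow> foldr (mul E) (map \<iota> xs) (one E) =
    \<iota> (foldr (mul A) xs (one A))"
  by (induction xs) (simp_all add: hom_one hom_mul dom.A1_carr dom.foldr_carr)

lemma \<pi>_F: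
  assumes x: "x \<in> carr dom.T" shows "cod.\<pi> (F x) = \<iota> (dom.\<pi> x)"
  by (rule dom.T_eqI[OF graded_spaceD(1)[OF cod.gA] linear_on_comp[OF F_lin F_carr cod.\<pi>_lin]
      linear_on_comp[OF dom.\<pi>_lin _ lin] _ x])
    (simp_all add: F_word map_\<iota> dom.\<pi>_word cod.\<pi>_word foldr_\<iota>)

text \<open>The elements mapped by \<open>F\<close> into the ideal of quadratic relations form a
  two-sided ideal. It contains the kernel in degree 2, since \<open>F\<close> is compatible with the
  canonical maps, hence the whole kernel when the source is quadratic.\<close>

lemma F_kernel:
  assumes q: "quadratic A" and x: "x \<in> dom.K" shows "F x \<in> cod.I"
proof -
  note J = cod.two_sided_idealD[OF cod.I_ideal]
  let ?J = "{x \<in> carr dom.T. F x \<in> cod.I}"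
  have "two_sided_ideal dom.T ?J"
    unfolding two_sided_ideal_def dom.T_smul
  proof (intro conjI ballI)
    have F0: "F 0 = 0"
      by (rule linear_on_0[OF vector_space_fun_scale vector_space_fun_scale dom.T_sub(1) F_lin])
    show "dom.F.subspace ?J"
      using cod.F.subspace_0[OF J(1)] cod.F.subspace_add[OF J(1)] cod.F.subspace_scale[OF J(1)]
          F_lin[of "carr dom.T"]
      by (auto simp: dom.F.subspace_def F0 linear_on_def)
  qed (auto simp: F_mul intro: J(3,4))
  moreover have "dom.K \<inter> gr dom.T 2 \<subseteq> ?J"
  proof
    fix x assume x: "x \<in> dom.K \<inter> gr dom.T 2"
    then have xT: "x \<in> carr dom.T" "dom.\<pi> x = 0" by (auto simp: tcanon_kernel_def)
    have "\<iota> 0 = 0"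
      by (rule linear_on_0[OF graded_spaceD(1)[OF dom.gA] graded_spaceD(1)[OF cod.gA]
          graded_spaceD(3)[OF dom.gA] lin])
    then have "F x \<in> cod.K \<inter> gr cod.T 2"
      using x xT F_gr[of x 2] by (simp add: tcanon_kernel_def \<pi>_F)
    then show "x \<in> ?J" using cod.I_base xT by blast
  qed
  ultimately have "dom.I \<subseteq> ?J" by (rule dom.I_min)
  then show ?thesis using q x by (auto simp: dom.quadratic_iff)
qed

text \<open>\<open>s\<close> is a linear section of the canonical map of A followed by
  \<open>F\<close>. A linear section need not be multiplicative, but its failures lie in the kernel
  of that canonical map, and for quadratic A they become elements of \<open>cod.I\<close>.\<close>

lemma hom_section_upto:
  assumes q: "quadratic A"
  obtains s where "linear_on (smul A) (carr A) fun_scale s" "\<And>a. a \<in> carr A \<Longrightarrow> s a \<in> carr cod.T"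
    "\<And>i a. i \<le> N \<Longrightarrow> a \<in> gr A i \<Longrightarrow> s a \<in> gr cod.T i"
    "\<And>i a. i \<le> N \<Longrightarrow> a \<in> gr A i \<Longrightarrow> cod.\<pi> (s a) = \<iota> a"
    "\<And>i j a b. i + j \<le> N \<Longrightarrow> a \<in> gr A i \<Longrightarrow> b \<in> gr A j \<Longrightarrow> s (mul A a b) - mul cod.T (s a) (s b) \<in> cod.I"
    "s (one A) - one cod.T \<in> cod.I"
    "\<And>a. 1 \<le> N \<Longrightarrow> a \<in> gr A 1 \<Longrightarrow> s a - cod.w [\<iota> a] \<in> cod.I"
proof -
  have og: "one_generated A" using q by (simp add: quadratic_def)
  obtain S where S: "linear_on (smul A) (carr A) fun_scale S"
    and Sc': "\<And>a. a \<in> carr A \<Longrightarrow> S a \<in> carr dom.T" and S':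
    "\<And>i a. i \<le> N \<Longrightarrow> a \<in> gr A i \<Longrightarrow> S a \<in> gr dom.T i" "\<And>i a. i \<le> N \<Longrightarrow> a \<in> gr A i \<Longrightarrow> dom.\<pi> (S a) = a"
    using dom.section_upto[OF og] by metis
  note S = S S'
  have Sc: "S a \<in> carr dom.T" if "i \<le> N" "a \<in> gr A i" for i a
    using S(2)[OF that] dom.gr_T_carr by blast
  have kernel: "F x - F y \<in> cod.I" if "x \<in> carr dom.T" "y \<in> carr dom.T" "dom.\<pi> x = dom.\<pi> y" for x y
    using F_kernel[OF q, of "x - y"] that by (simp add: F_diff dom.\<pi>_diff tcanon_kernel_def)
  show thesis
  proof
    show "linear_on (smul A) (carr A) fun_scale (\<lambda>a. F (S a))"
      by (rule linear_on_comp[OF S(1) _ F_lin]) (rule UNIV_I)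
    show "F (S a) \<in> carr cod.T" if "a \<in> carr A" for a
      by (rule F_carr[OF Sc'[OF that]])
    show "F (S a) \<in> gr cod.T i" if "i \<le> N" "a \<in> gr A i" for i a
      by (rule F_gr[OF S(2)[OF that]])
    show "cod.\<pi> (F (S a)) = \<iota> a" if "i \<le> N" "a \<in> gr A i" for i a
      using that by (simp add: \<pi>_F Sc S(3))
    show "F (S (mul A a b)) - mul cod.T (F (S a)) (F (S b)) \<in> cod.I"
      if ij: "i + j \<le> N" and a: "a \<in> gr A i" and b: "b \<in> gr A j" for i j a b
    proof -
      have 1: "i \<le> N" "j \<le> N" using ij by auto
      note ab = graded_algebraD(3)[OF A a b]
      have "F (S (mul A a b)) - F (mul dom.T (S a) (S b)) \<in> cod.I"
        by (rule kernel) (use Sc[OF ij ab] Sc[OF 1(1) a] Sc[OF 1(2) b] S(3)[OF ij ab] S(3)[OF 1(1)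
            a] S(3)[OF 1(2) b]
          in \<open>simp_all add: dom.\<pi>_mul\<close>)
      then show ?thesis by (simp add: F_mul Sc[OF 1(1) a] Sc[OF 1(2) b])
    qed
    show "F (S (one A)) - one cod.T \<in> cod.I"
      using kernel[of "S (one A)" "one dom.T"] Sc[OF _ graded_algebraD(9)[OF A]] S(3)[OF _
          graded_algebraD(9)[OF A]]
      by (simp add: F_one dom.\<pi>_one)
    show "F (S a) - cod.w [\<iota> a] \<in> cod.I" if "1 \<le> N" "a \<in> gr A 1" for a
      using kernel[of "S a" "dom.w [a]"] that by (simp add: Sc S(3) F_word dom.\<pi>_letter)
  qed
qed

end

section \<open>The algebra $A \otimes_\tau B$\<close>

locale twisted_algebra = algebra_pair A B for A :: "('k::field, 'a::ab_group_add) galgebra"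
    and B :: "('k, 'b::ab_group_add) galgebra" +
  fixes \<tau> :: "(('b \<Rightarrow> 'a \<Rightarrow> 'k) \<Rightarrow> 'k) \<Rightarrow> ('a \<Rightarrow> 'b \<Rightarrow> 'k) \<Rightarrow> 'k"
  assumes tw: "graded_twisting A B \<tau>" and qA: "quadratic A" and qB: "quadratic B"
begin

text \<open>An opaque name, as the simplifier would rewrite \<open>smul\<close> and \<open>gr\<close> inside \<open>T1\<close>.\<close>

definition E :: "('k, ('a \<Rightarrow> 'b \<Rightarrow> 'k) \<Rightarrow> 'k) galgebra" where "E = twisted_tensor A B \<tau>"

lemma E_simps:
  "smul E = fun_scale" "gr E = gr C" "mul E = tmul \<tau>" "one E = tAB (one A) (one B)" "carr E =
      carr C"
  by (simp_all add: E_def)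

lemmas \<tau> = graded_twistingD(1)[OF tw]
lemmas \<tau>_unital = graded_twistingD(2)[OF tw]
lemmas \<tau>_hexagons = graded_twistingD(3)[OF tw]

lemma E_algebra: "graded_algebra E"
  unfolding E_def by (rule graded_algebra_twisted_tensor[OF tw])

sublocale Q: canonical_map E by unfold_locales (rule E_algebra)

lemma \<tau>_one:
  "a \<in> carr A \<Longrightarrow> \<tau> (tBA (one B) a) = tA a" "b \<in> carr B \<Longrightarrow> \<tau> (tBA b (one A)) = tB b"
  using tw by (simp_all add: graded_twisting_def)

lemma tmul_tA_tA: "a \<in> carr A \<Longrightarrow> a' \<in> carr A \<Longrightarrow> tmul \<tau> (tA a) (tA a') = tA (mul A a a')"
  by (simp add: tmul_tens[OF \<tau>] \<tau>_one act_lin)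

lemma tmul_tB_tB: "b \<in> carr B \<Longrightarrow> b' \<in> carr B \<Longrightarrow> tmul \<tau> (tB b) (tB b') = tB (mul B b b')"
  by (simp add: tmul_tens[OF \<tau>] \<tau>_one act_lin)

lemma tmul_tA_tB: "a \<in> carr A \<Longrightarrow> b \<in> carr B \<Longrightarrow> tmul \<tau> (tA a) (tB b) = tAB a b"
  using \<tau>_one(1)[OF one_in(1)] by (simp add: tmul_tens[OF \<tau>] act_lin)

lemma tmul_tB_tA: "a \<in> carr A \<Longrightarrow> b \<in> carr B \<Longrightarrow> tmul \<tau> (tB b) (tA a) = \<tau> (tBA b a)"
  by (simp add: tmul_tens[OF \<tau>] act_one glinD(3)[OF \<tau>])

sublocale hA: algebra_hom A E "\<lambda>a. tAB a (one B)"
  by unfold_locales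
    (use tens_gr'(1)[OF _ one_in(4)] in \<open>auto simp: A E_algebra E_simps tens_lin tmul_tA_tA\<close>)

sublocale hB: algebra_hom B E "\<lambda>b. tAB (one A) b"
  by unfold_locales
    (use tens_gr'(1)[OF one_in(3)] in \<open>auto simp: B E_algebra E_simps tens_lin tmul_tB_tB\<close>)

text \<open>As a \<otimes> b is the product of a \<otimes> 1 and 1 \<otimes> b, it is reached by
  multiplying the images of preimages of a and b in the two tensor algebras.\<close>

lemma one_generated_E: "one_generated E"
proof -
  have ogA: "one_generated A" and ogB: "one_generated B" using qA qB by (auto simp: quadratic_def)
  have sub: "Q.F.subspace (carr Q.T)" by simp
  have l: "linear_on fun_scale (carr Q.T) fun_scale Q.\<pi>" using Q.\<pi>_lin by (simp add: E_simps(1))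
  note Z = linear_on_image_subspace[OF vector_space_fun_scale vs(3) l sub]
  have "x \<in> Q.\<pi> ` carr Q.T" if x: "x \<in> carr C" for x
  proof (rule tprod_carr_subspaceI[OF gs(1,2) vs(3) linear_on_id Z _ x])
    fix a b assume a: "a \<in> carr A" and b: "b \<in> carr B"
    have "a \<in> hA.dom.\<pi> ` carr hA.dom.T" using a ogA by (simp add: one_generated_def)
    then obtain u where u: "u \<in> carr hA.dom.T" "hA.dom.\<pi> u = a" by blast
    have "b \<in> hB.dom.\<pi> ` carr hB.dom.T" using b ogB by (simp add: one_generated_def)
    then obtain v where v: "v \<in> carr hB.dom.T" "hB.dom.\<pi> v = b" by blast
    have "Q.\<pi> (mul Q.T (hA.F u) (hB.F v)) = tAB a b"
      using u v a b by (simp add: Q.\<pi>_mul hA.\<pi>_F hB.\<pi>_F E_simps(3) tmul_tA_tB)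
    then show "tAB a b \<in> Q.\<pi> ` carr Q.T" using u(1) v(1)
        by (intro image_eqI[where x = "mul Q.T (hA.F u) (hB.F v)"]) simp_all
  qed
  moreover have "Q.\<pi> ` carr Q.T \<subseteq> carr E" by auto
  ultimately show ?thesis unfolding one_generated_def using E_algebra by (auto simp: E_simps(5))
qed

lemma quadratic_E_iff: "quadratic E \<longleftrightarrow> Q.K \<subseteq> Q.I"
  using one_generated_E by (simp add: Q.quadratic_iff)

end

section \<open>If $A \otimes_\tau B$ is quadratic then extensions are unique\<close>

locale twisting_extension = twisted_algebra A B \<tau> for A :: "('k::field, 'a::ab_group_add) galgebra"
    and B :: "('k, 'b::ab_group_add) galgebra" and \<tau> +
  fixes n \<tau>'
  assumes n: "3 \<le> n" and t': "glin \<tau>'" and to: "graded_twisting_to A B n \<tau>'"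
    and eq: "\<And>i z. i < n \<Longrightarrow> z \<in> gr D i \<Longrightarrow> \<tau>' z = \<tau> z"
    and qE: "quadratic E"
begin

lemma unital_\<tau>': "i \<le> n \<Longrightarrow> unital i \<tau>'" and hexagons_\<tau>': "i \<le> n \<Longrightarrow> hexagons i \<tau>'"
  using to by (simp_all add: graded_twisting_to_iff[OF t'])

text \<open>Restricted to degree \<open>n\<close> by \<open>hcomp\<close>: above that degree nothing
  relates \<tau>' to \<tau>, and below it they agree.\<close>

definition \<delta> where "\<delta> z = \<tau>' (hcomp D n z) - \<tau> (hcomp D n z)"

lemma \<delta>_gr: "z \<in> gr D i \<Longrightarrow> \<delta> z = (if i = n then \<tau>' z - \<tau> z else 0)"
  using linear_on_0[OF vs(3) vs(3) sub(2) glinD(1)[OF t']] linear_on_0[OF vs(3) vs(3) sub(2)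
      glinD(1)[OF \<tau>]]
  unfolding \<delta>_def by (simp add: hcomp_gr[OF gs(4)])

lemma \<delta>: "glin \<delta>"
  unfolding graded_linear_def
proof (intro conjI allI ballI)
  have h: "hcomp D n z \<in> carr D" if "z \<in> carr D" for z
    using linear_on_hcomp(2)[OF gs(4) that] gr_carr by blast
  have "linear_on fun_scale (carr D) fun_scale (\<lambda>z. \<tau>' (hcomp D n z) - \<tau> (hcomp D n z))"
    using linear_on_hcomp(1)[OF gs(4), of n] unfolding smul_tprod
    by (intro linear_on_minus[OF vs(3)] linear_on_comp[OF _ h glinD(1)[OF t']] linear_on_comp[OF _
        h glinD(1)[OF \<tau>]])
  then show "linear_on (smul D) (carr D) (smul C) \<delta>" by (simp add: \<delta>_def[abs_def])
  show "\<delta> z \<in> gr C i" if "z \<in> gr D i" for i z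
    using glinD(2)[OF t' that] glinD(2)[OF \<tau> that] gr_closed(3,4)[OF gs(3)]
    by (cases "i = n") (simp_all add: \<delta>_gr[OF that])
qed

lemma tmul_\<delta>:
  assumes "x \<in> gr C p" "y \<in> gr C q" "p + q \<le> n"
  shows "tmul \<delta> x y = tmul \<tau>' x y - tmul \<tau> x y"
proof (rule tmul_diff[OF t' \<tau> \<delta> _ assms])
  show "\<delta> z = \<tau>' z - \<tau> z" if "j \<le> n" "z \<in> gr D j" for j z
    using that eq[of j z] by (cases "j = n") (simp_all add: \<delta>_gr)
qed

lemma tmul_low:
  assumes x: "x \<in> gr C p" and y: "y \<in> gr C q" and n: "p + q < n"
  shows "tmul \<tau>' x y = tmul \<tau> x y"
  by (rule tmul_cong[OF t' \<tau> eq x y le_refl]) (use n in auto)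

text \<open>The difference of the associativity laws of \<open>\<tau>'\<close> and \<open>\<tau>\<close> in total degree \<open>n\<close>.\<close>

lemma tmul_\<delta>_assoc:
  assumes x: "x \<in> gr C p" and y: "y \<in> gr C q" and z: "z \<in> gr C r" and pqr: "p + q + r =
      n" "1 \<le> p" "1 \<le> r"
  shows "tmul \<delta> x (tmul \<tau> y z) = tmul \<delta> (tmul \<tau> x y) z"
proof -
  note xy = tmul_gr[OF \<tau> x y refl] and yz = tmul_gr[OF \<tau> y z refl]
  \<comment> \<open>As \<open>p\<close> and \<open>r\<close> are positive, the inner products have
    degree below \<open>n\<close>, where \<tau>' and \<tau> define the same product; only the outer
    product distinguishes them.\<close>
  have 1: "tmul \<tau>' (tmul \<tau> x y) z = tmul \<tau>' x (tmul \<tau> y z)"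
    using tmul_assoc_gr[OF t' unital_\<tau>' hexagons_\<tau>' x y z] tmul_low[OF x y] tmul_low[OF y z] pqr
        by simp
  have 2: "tmul \<tau> (tmul \<tau> x y) z = tmul \<tau> x (tmul \<tau> y z)"
    by (rule tmul_assoc_gr[OF \<tau> \<tau>_unital \<tau>_hexagons x y z le_refl])
  show ?thesis using tmul_\<delta>[OF x yz] tmul_\<delta>[OF xy z] pqr 1 2 by simp
qed

section \<open>The multilinear form built from the difference, and its vanishing on
  relations\<close>

context
  fixes \<beta> :: "'a \<Rightarrow> 'b \<Rightarrow> 'k"
begin

text \<open>Elements of A \<otimes> B are functions on bilinear forms, so evaluation at the fixed
  \<open>\<beta>\<close> makes the \<delta>-product scalar; letting \<open>\<beta>\<close> vary
  recovers it. The tail is multiplied with \<tau>, and the value 0 on words of other lengths keeps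
  the form multilinear.\<close>

definition \<phi> :: "(('a \<Rightarrow> 'b \<Rightarrow> 'k) \<Rightarrow> 'k) list \<Rightarrow> 'k" where
  "\<phi> zs = (case zs of [] \<Rightarrow> 0 | x # xs \<Rightarrow>
     if Suc (length xs) = n then tmul \<delta> x (foldr (mul E) xs (one E)) \<beta> else 0)"

lemma eval_C: "linear_on fun_scale V (*) (\<lambda>x. x \<beta>)"
  by (simp add: linear_on_def fun_scale_def)

lemma letter_in: "x \<in> gr E 1 \<Longrightarrow> x \<in> carr C" "x \<in> gr E 1 \<Longrightarrow> x \<in> gr C 1"
  using gr_carr by (auto simp: E_simps)

lemma foldr_in: "xs \<in> lists (gr E 1) \<Longrightarrow> foldr (mul E) xs (one E) \<in> carr C"
  "xs \<in> lists (gr E 1) \<Longrightarrow> foldr (mul E) xs (one E) \<in> gr C (length xs)"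
  using Q.foldr_carr Q.foldr_gr by (auto simp: E_simps)

lemma \<phi>_multilinear: "multilinear_form (smul E) (gr E 1) \<phi>"
  unfolding multilinear_form_def
proof (intro ballI)
  fix as bs assume as: "as \<in> lists (gr E 1)" and bs: "bs \<in> lists (gr E 1)"
  have z: "linear_on (smul E) (gr E 1) (*) (\<lambda>_. 0)" by (simp add: linear_on_def)
  show "linear_on (smul E) (gr E 1) (*) (\<lambda>u. \<phi> (as @ u # bs))"
  proof (cases "Suc (length as + length bs) = n")
    case False
    then have "\<phi> (as @ u # bs) = 0" for u by (cases as) (auto simp: \<phi>_def)
    then show ?thesis using z by simp
  next
    case True
    show ?thesis
    proof (cases as)
      case Nil
      have "linear_on (smul E) (gr E 1) (*) (\<lambda>u. tmul \<delta> u (foldr (mul E) bs (one E)) \<beta>)"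
        unfolding E_simps(1)
        by (rule linear_on_comp[OF linear_on_mono[OF tmul_lin(1)[OF \<delta>]] _ eval_C[of UNIV]])
          (use foldr_in[OF bs] letter_in in auto)
      then show ?thesis using True Nil by (simp add: \<phi>_def)
    next
      case (Cons x as')
      have x: "x \<in> gr E 1" and as': "as' \<in> lists (gr E 1)" using as Cons by auto
      have "linear_on (smul E) (gr E 1) (*) (\<lambda>u. tmul \<delta> x (foldr (mul E) (as' @ u # bs) (one E)) \<beta>)"
      proof (rule linear_on_comp[OF Q.foldr_lin[OF as' bs]])
        show "foldr (mul E) (as' @ u # bs) (one E) \<in> carr C" if "u \<in> gr E 1" for u
          by (rule foldr_in(1)) (use that as' bs in simp)
        show "linear_on (smul E) (carr C) (*) (\<lambda>c. tmul \<delta> x c \<beta>)"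
          unfolding E_simps(1)
              by (rule linear_on_comp[OF tmul_lin(2)[OF \<delta> letter_in(1)[OF x]] _ eval_C[of UNIV]])
              simp
      qed
      then show ?thesis using True Cons by (simp add: \<phi>_def del: foldr_append foldr.simps)
    qed
  qed
qed

lemma \<phi>_Cons:
  "Suc (length xs) = n \<Longrightarrow> \<phi> (x # xs) = tmul \<delta> x (foldr (mul E) xs (one E)) \<beta>"
  by (simp add: \<phi>_def)

lemma \<phi>_length: "length xs \<noteq> n \<Longrightarrow> \<phi> xs = 0"
  by (auto simp: \<phi>_def split: list.splits)

text \<open>
  A relation inside the tail is killed by the product of \<open>E\<close>, one at the head by
  \<open>tmul_\<delta>_assoc\<close>.
\<close>

lemma \<phi>_relation:
  assumes r: "r \<in> Q.K \<inter> gr Q.T 2" and xs: "xs \<in> lists (gr E 1)" and ys: "ys \<in> lists (gr E 1)"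
  shows "r (\<lambda>zs. \<phi> (xs @ zs @ ys)) = 0"
proof -
  let ?f = "\<lambda>zs. foldr (mul E) zs (one E)"
  note ml = multilinear_form_affix[OF \<phi>_multilinear xs ys]
  have r2: "r \<in> gr Q.T 2" and r0: "Q.\<pi> r = 0" using r by (auto simp: tcanon_kernel_def)
  \<comment> \<open>It suffices to express the value on words with x y in the marked place linearly
    through the product of x and y in \<open>E\<close>, because that product becomes
    \<open>\<pi> r\<close>, which is 0.\<close>
  have main: "r (\<lambda>zs. \<phi> (xs @ zs @ ys)) = 0"
    if G: "linear_on fun_scale (carr C) (*) G"
      and e: "\<And>x y. x \<in> gr E 1 \<Longrightarrow> y \<in> gr E 1 \<Longrightarrow> \<phi> (xs @ [x, y] @ ys) = G (?f [x, y])" for G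
  proof -
    have "r (\<lambda>zs. \<phi> (xs @ zs @ ys)) = G (Q.\<pi> r)"
    proof (rule Q.eval_factor[OF ml _ _ r2])
      show "linear_on (smul E) (carr E) (*) G" using G by (simp add: E_simps)
      fix zs assume zs: "zs \<in> lists (gr E 1)" "length zs = 2"
      then obtain x y where "zs = [x, y]" by (auto simp: numeral_2_eq_2 length_Suc_conv)
      then show "\<phi> (xs @ zs @ ys) = G (?f zs)" using e zs by simp
    qed
    also have "\<dots> = 0" unfolding r0 by (rule linear_on_0[OF vs(3) Q.vs_K sub(1) G])
    finally show ?thesis .
  qed
  note fy = foldr_in[OF ys]
  show ?thesis
  proof (cases "length xs + length ys + 2 = n")
    case False
    show ?thesis by (rule main[of "\<lambda>_. 0"]) (use False in \<open>simp_all add: linear_on_def \<phi>_length\<close>)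
  next
    case len: True
    show ?thesis
    proof (cases xs)
      case Nil
      show ?thesis
      proof (rule main)
        show "linear_on fun_scale (carr C) (*) (\<lambda>c. tmul \<delta> c (?f ys) \<beta>)"
          by (rule linear_on_comp[OF tmul_lin(1)[OF \<delta> fy(1)] _ eval_C[of UNIV]]) simp
        fix x y assume x: "x \<in> gr E 1" and y: "y \<in> gr E 1"
        have "\<phi> (xs @ [x, y] @ ys) = tmul \<delta> x (tmul \<tau> y (?f ys)) \<beta>"
          using \<phi>_Cons[of "y # ys" x] len Nil by (simp add: E_simps(3))
        \<comment> \<open>The tail \<open>ys\<close> has length n - 2, which is positive by 3 \<le>
          n, as the comparison of associativity requires of its last factor.\<close>
        also have "\<dots> = tmul \<delta> (tmul \<tau> x y) (?f ys) \<beta>"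
          using tmul_\<delta>_assoc[OF letter_in(2)[OF x] letter_in(2)[OF y] fy(2)] len Nil n by simp
        also have "tmul \<tau> x y = ?f [x, y]"
          using graded_algebraD(6)[OF E_algebra Q.A1_carr[OF y]] by (simp add: E_simps(3))
        finally show "\<phi> (xs @ [x, y] @ ys) = tmul \<delta> (?f [x, y]) (?f ys) \<beta>" .
      qed
    next
      case (Cons u us)
      have u: "u \<in> carr C" and us: "us \<in> lists (gr E 1)" using xs Cons letter_in by auto
      show ?thesis
      proof (rule main)
        show "linear_on fun_scale (carr C) (*) (\<lambda>c. tmul \<delta> u (tmul \<tau> (?f us) (tmul \<tau> c (?f ys))) \<beta>)"
          by (rule linear_on_comp[OF linear_on_comp[OF linear_on_comp[OF tmul_lin(1)[OF \<tau> fy(1)] _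
             tmul_lin(2)[OF \<tau> foldr_in(1)[OF us]]] _ tmul_lin(2)[OF \<delta> u]] _ eval_C[of UNIV]])
            (use fy us foldr_in tmul_in[OF \<tau>] in auto)
        fix x y assume xy: "x \<in> gr E 1" "y \<in> gr E 1"
        have "\<phi> (xs @ [x, y] @ ys) = tmul \<delta> u (?f (us @ ([x, y] @ ys))) \<beta>"
          using \<phi>_Cons[of "us @ [x, y] @ ys" u] len Cons by (simp del: foldr_append foldr.simps)
        also have "?f (us @ ([x, y] @ ys)) = mul E (?f us) (mul E (?f [x, y]) (?f ys))"
          using us ys xy by (subst Q.foldr_mul_append, simp, simp, subst Q.foldr_mul_append)
              (simp_all del: foldr.simps)
        finally show "\<phi> (xs @ [x, y] @ ys) = tmul \<delta> u (tmul \<tau> (?f us) (tmul \<tau> (?f [x, y])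
            (?f ys))) \<beta>"
          by (simp only: E_simps(3))
      qed
    qed
  qed
qed

lemma \<phi>_kernel:
  assumes "r \<in> Q.K" shows "r \<phi> = 0"
proof -
  \<comment> \<open>Vanishing is demanded in every context \<open>xs\<close>, \<open>ys\<close>,
    because the elements killed by the form alone need not be closed under multiplication. The empty
    context gives the claim.\<close>
  let ?J = "{t \<in> carr Q.T. \<forall>xs\<in>lists (gr E 1). \<forall>ys\<in>lists (gr E 1). t (\<lambda>zs. \<phi> (xs @ zs @ ys)) = 0}"
  have J: "two_sided_ideal Q.T ?J"
    unfolding two_sided_ideal_def Q.T_smul
  proof (intro conjI ballI)
    show "Q.F.subspace ?J"
      unfolding Q.F.subspace_def by (auto simp: fun_scale_apply)
    fix r x assume r: "r \<in> carr Q.T" and x: "x \<in> ?J"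
    then have xT: "x \<in> carr Q.T" and x0: "\<And>xs ys. xs \<in> lists (gr E 1) \<Longrightarrow> ys \<in> lists (gr E 1) \<Longrightarrow>
        x (\<lambda>zs. \<phi> (xs @ zs @ ys)) = 0" by simp_all
    show "mul Q.T r x \<in> ?J"
    proof (intro CollectI conjI ballI)
      show "mul Q.T r x \<in> carr Q.T" by (rule Q.mul_T_carr[OF r xT])
      fix xs ys assume xs: "xs \<in> lists (gr E 1)" and ys: "ys \<in> lists (gr E 1)"
      note ml = multilinear_form_affix[OF \<phi>_multilinear xs ys]
      show "mul Q.T r x (\<lambda>zs. \<phi> (xs @ zs @ ys)) = 0"
      proof (rule Q.T_eqI[OF Q.vs_K linear_on_comp[OF Q.mul_T_lin1[of "carr Q.T"] _ Q.eval_lin[of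
          UNIV]] linear_on_zero_map[OF Q.vs_K] _ r])
        fix rs assume rs: "rs \<in> lists (gr E 1)"
        have "x (\<lambda>zs. \<phi> ((xs @ rs) @ zs @ ys)) = 0" by (rule x0) (use xs ys rs in simp_all)
        then show "mul Q.T (Q.w rs) x (\<lambda>zs. \<phi> (xs @ zs @ ys)) = 0"
          by (simp add: Q.mul_word_left[OF ml rs xT])
      qed simp
    qed
    show "mul Q.T x r \<in> ?J"
    proof (intro CollectI conjI ballI)
      show "mul Q.T x r \<in> carr Q.T" by (rule Q.mul_T_carr[OF xT r])
      fix xs ys assume xs: "xs \<in> lists (gr E 1)" and ys: "ys \<in> lists (gr E 1)"
      note ml = multilinear_form_affix[OF \<phi>_multilinear xs ys]
      show "mul Q.T x r (\<lambda>zs. \<phi> (xs @ zs @ ys)) = 0"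
      proof (rule Q.T_eqI[OF Q.vs_K linear_on_comp[OF Q.mul_T_lin2[OF xT] _ Q.eval_lin[of UNIV]]
          linear_on_zero_map[OF Q.vs_K] _ r])
        fix rs assume rs: "rs \<in> lists (gr E 1)"
        have "x (\<lambda>zs. \<phi> (xs @ zs @ (rs @ ys))) = 0" by (rule x0) (use xs ys rs in simp_all)
        then show "mul Q.T x (Q.w rs) (\<lambda>zs. \<phi> (xs @ zs @ ys)) = 0"
          by (simp add: Q.mul_word_right[OF ml rs xT])
      qed simp
    qed
  qed auto
  have "Q.K \<inter> gr Q.T 2 \<subseteq> ?J" using \<phi>_relation by (auto simp: tcanon_kernel_def)
  then have "Q.I \<subseteq> ?J" by (rule Q.I_min[OF J])
  then have "r \<in> ?J" using assms qE quadratic_E_iff by blast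
  then have "r (\<lambda>zs. \<phi> ([] @ zs @ [])) = 0" by blast
  then show ?thesis by simp
qed

text \<open>A preimage of \<open>x c\<close> that begins with the letter \<open>x\<close>: on it the
  form reads off the \<delta>-product of \<open>x\<close> and \<open>c\<close>, whatever preimage of
  \<open>c\<close> follows the letter.\<close>

lemma lift_mult:
  assumes x: "x \<in> gr E 1" and c: "c \<in> gr C (n - 1)"
  shows "\<exists>s\<in>gr Q.T n. Q.\<pi> s = tmul \<tau> x c \<and> s \<phi> = tmul \<delta> x c \<beta>"
proof -
  obtain u where u: "u \<in> gr Q.T (n - 1)" "Q.\<pi> u = c"
    using Q.gr_lift[OF one_generated_E, of c "n - 1"] c by (auto simp: E_simps)
  have uT: "u \<in> carr Q.T" by (rule Q.gr_T_carr[OF u(1)])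
  have wx: "[x] \<in> lists (gr E 1)" using x by simp
  have "mul Q.T (Q.w [x]) u \<in> gr Q.T n"
    using Q.mul_T_gr[OF Q.word_gr[OF wx] u(1)] n by simp
  moreover have "Q.\<pi> (mul Q.T (Q.w [x]) u) = tmul \<tau> x c"
    using Q.\<pi>_mul[OF Q.word_carr[OF wx] uT] u(2) Q.\<pi>_letter[OF x] by (simp add: E_simps(3))
  moreover have "mul Q.T (Q.w [x]) u \<phi> = tmul \<delta> x c \<beta>"
  proof -
    have "mul Q.T (Q.w [x]) u \<phi> = u (\<lambda>zs. \<phi> ([x] @ zs))"
      by (rule Q.mul_word_left[OF \<phi>_multilinear wx uT])
    also have "\<dots> = tmul \<delta> x (Q.\<pi> u) \<beta>"
    proof (rule Q.eval_factor[OF multilinear_form_prefix[OF \<phi>_multilinear wx] _ _ u(1)])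
      show "linear_on (smul E) (carr E) (*) (\<lambda>c. tmul \<delta> x c \<beta>)"
        unfolding E_simps
            by (rule linear_on_comp[OF tmul_lin(2)[OF \<delta> letter_in(1)[OF x]] _ eval_C[of UNIV]]) simp
    qed (use n in \<open>simp add: \<phi>_Cons\<close>)
    finally show ?thesis using u(2) by simp
  qed
  ultimately show ?thesis by blast
qed

text \<open>
  Words that start in $A_1$ or lie entirely in $B_1$ are killed by \<open>\<phi>\<close>, as \<open>\<delta>\<close> vanishes on
  $1 \otimes A$ and $B \otimes 1$.
\<close>

lemma lift_annihilated:
  assumes c: "c \<in> gr C n"
  shows "c \<in> Q.\<pi> ` {s \<in> gr Q.T n. s \<phi> = 0}"
proof -
  let ?Z = "Q.\<pi> ` {s \<in> gr Q.T n. s \<phi> = 0}"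
  have Z: "module.subspace fun_scale ?Z"
  proof (rule linear_on_image_subspace[OF vector_space_fun_scale vs(3)])
    show "linear_on fun_scale {s \<in> gr Q.T n. s \<phi> = 0} fun_scale Q.\<pi>"
    proof (rule linear_on_mono)
      show "linear_on fun_scale (carr Q.T) fun_scale Q.\<pi>" using Q.\<pi>_lin by (simp add: E_simps(1))
    qed (use Q.gr_T_carr in blast)
    show "Q.F.subspace {s \<in> gr Q.T n. s \<phi> = 0}"
      using Q.F.subspace_0[OF Q.T_sub(2)] Q.F.subspace_add[OF Q.T_sub(2)] Q.F.subspace_scale[OF
          Q.T_sub(2)]
      by (auto simp: Q.F.subspace_def fun_scale_apply)
  qed
  have mult: "tmul \<tau> x c \<in> ?Z" if "x \<in> gr E 1" "c \<in> gr C (n - 1)" "tmul \<delta> x c = 0" for x c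
    using lift_mult[OF that(1,2)] that(3) by (auto simp: image_iff)
  \<comment> \<open>In degree \<open>n\<close> both maps are unital and cancel; in every other
    degree \<delta> vanishes by construction.\<close>
  have \<delta>u: "\<delta> (tBA (one B) v) = 0" if v: "v \<in> gr A k" for v k
    using unitalD(1)[OF unital_\<tau>', of k v] unitalD(1)[OF \<tau>_unital, of v k] \<delta>_gr[OF tens_gr'(2)[OF
        v one_in(4)]] v by auto
  have \<delta>u': "\<delta> (tBA v (one A)) = 0" if v: "v \<in> gr B k" for v k
    using unitalD(2)[OF unital_\<tau>', of k v] unitalD(2)[OF \<tau>_unital, of v k] \<delta>_gr[OF tens_gr'(2)[OF
        one_in(3) v]] v by auto
  have act0: "act a b 0 = 0" if "a \<in> carr A" "b \<in> carr B" for a b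
    by (rule linear_on_0[OF vs(3) vs(3) sub(1) act_lin(1)[OF that]])
  have ogA: "one_generated A" and ogB: "one_generated B" using qA qB by (auto simp: quadratic_def)
  show ?thesis
  proof (rule tprod_subspaceI[OF gs(1,2) vs(3) linear_on_id Z _ c])
    fix v w k l assume v: "v \<in> gr A k" and w: "w \<in> gr B l" and kl: "k + l = n"
    note cv = gr_carr(1)[OF v] and cw = gr_carr(2)[OF w]
    show "tAB v w \<in> ?Z"
    proof (cases k)
      case (Suc m)
      show ?thesis
      proof (rule hA.dom.gr_Suc_subspaceI[OF ogA vs(3) tens_lin(1)[OF cw] Z _ v[unfolded Suc]])
        fix x y assume x: "x \<in> gr A 1" and y: "y \<in> gr A m"
        note cx = gr_carr(1)[OF x] and cy = gr_carr(1)[OF y]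
        have e: "tmul \<tau> (tA x) (tAB y w) = tAB (mul A x y) w"
          using cx cy cw by (simp add: tmul_tens[OF \<tau>] \<tau>_one act_lin)
        show "tAB (mul A x y) w \<in> ?Z" unfolding e[symmetric]
          by (rule mult) (use hA.hom_gr[OF x] tens_gr'(1)[OF y w] Suc kl cx cy cw \<delta>u[OF y] act0 in
              \<open>auto simp: tmul_tens[OF \<delta>]\<close>)
      qed
    next
      case 0
      \<comment> \<open>The A-part is a scalar, so the B-part carries the full positive degree
        \<open>n\<close> and a letter x of B can be split off. The \<delta>-product then starts from
        \<delta>(x \<otimes> 1), which is 0.\<close>
      obtain m where l: "l = Suc m" using 0 kl n by (cases l) auto
      obtain d where d: "v = smul A d (one A)" using graded_algebraD(7)[OF A] v 0 by auto
      interpret FC: vector_space "fun_scale :: 'k \<Rightarrow> (('a \<Rightarrow> 'b \<Rightarrow> 'k) \<Rightarrow> 'k) \<Rightarrow> _" by (rule vs)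
      have "tB w \<in> ?Z"
      proof (rule hB.dom.gr_Suc_subspaceI[OF ogB vs(3) tens_lin(2)[OF one_in(1)] Z _ w[unfolded l]])
        fix x y assume x: "x \<in> gr B 1" and y: "y \<in> gr B m"
        note cx = gr_carr(2)[OF x] and cy = gr_carr(2)[OF y]
        show "tB (mul B x y) \<in> ?Z" unfolding tmul_tB_tB[OF cx cy, symmetric]
          by (rule mult) (use hB.hom_gr[OF x] tens_gr'(1)[OF one_in(3) y] 0 l kl cx cy \<delta>u'[OF x]
              act0 in
              \<open>auto simp: tmul_tens[OF \<delta>]\<close>)
      qed
      moreover have "tAB v w = fun_scale d (tB w)" using cw by (simp add: d tens_scale_left)
      ultimately show ?thesis using FC.subspace_scale[OF Z] by simp
    qed
  qed
qed

text \<open>Two preimages of the same element \<tau>(w \<otimes> a) are compared: one begins with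
  the letter \<open>w\<close> and has form value \<delta>(w \<otimes> a) at \<open>\<beta>\<close>,
  the other is annihilated by the form. They differ by an element of the kernel, on which the form
  vanishes.\<close>

lemma \<delta>_letter_eval:
  assumes w: "w \<in> gr B 1" and a: "a \<in> gr A (n - 1)"
  shows "\<delta> (tBA w a) \<beta> = 0"
proof -
  note cw = gr_carr(2)[OF w] and ca = gr_carr(1)[OF a]
  obtain s where s: "s \<in> gr Q.T n" "Q.\<pi> s = tmul \<tau> (tB w) (tA a)" "s \<phi> = tmul \<delta> (tB w) (tA a) \<beta>"
    using lift_mult[OF hB.hom_gr[OF w], of "tA a"] tens_gr'(1)[OF a one_in(4)] by auto
  have "tmul \<tau> (tB w) (tA a) \<in> gr C n"
    using tmul_gr[OF \<tau> tens_gr'(1)[OF one_in(3) w] tens_gr'(1)[OF a one_in(4)]] n by simp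
  from lift_annihilated[OF this] obtain s' where s': "s' \<in> gr Q.T n" "s' \<phi> = 0" "Q.\<pi> s' =
      tmul \<tau> (tB w) (tA a)" by auto
  have "s - s' \<in> Q.K"
    using s s' Q.gr_T_carr[OF s(1)] Q.gr_T_carr[OF s'(1)] by (simp add: tcanon_kernel_def Q.\<pi>_diff)
  from \<phi>_kernel[OF this] have "tmul \<delta> (tB w) (tA a) \<beta> = 0" using s s' by simp
  then show ?thesis using cw ca by (simp add: tmul_tens[OF \<delta>] act_one glinD(3)[OF \<delta>])
qed

end

section \<open>Vanishing of the difference in degree n\<close>

lemma \<delta>_letter:
  assumes w: "w \<in> gr B 1" and a: "a \<in> gr A j"
  shows "\<delta> (tBA w a) = 0"
proof (cases "j = n - 1")
  case True
  then show ?thesis using \<delta>_letter_eval[OF w] a by (auto simp: fun_eq_iff)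
next
  case False
  then show ?thesis using \<delta>_gr[OF tens_gr'(2)[OF a w]] n by auto
qed

text \<open>For scalar b unitality decides. Otherwise b = y b' with a letter y, and the first
  hexagons of \<tau>' and \<tau> differ only in the outer product, as b' \<otimes> a has degree
  below \<open>n\<close>. The difference is thus a \<delta>-product of y with \<tau>(b' \<otimes>
  a).\<close>

lemma extension_unique:
  assumes x: "x \<in> gr D n" shows "\<tau>' x = \<tau> x"
proof (rule tprod_eqI[OF gs(2,1) vs(3) glinD(1)[OF t'] glinD(1)[OF \<tau>] _ x])
  fix b a i j assume b: "b \<in> gr B i" and a: "a \<in> gr A j" and ij: "i + j = n"
  note cb = gr_carr(2)[OF b] and ca = gr_carr(1)[OF a]
  have ogB: "one_generated B" using qB by (auto simp: quadratic_def)
  show "\<tau>' (tBA b a) = \<tau> (tBA b a)"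
  proof (cases i)
    case 0
    then obtain d where d: "b = smul B d (one B)" using graded_algebraD(7)[OF B] b by auto
    have "t (tBA b a) = fun_scale d (t (tBA (one B) a))" if "glin t" for t
      using glinD(1)[OF that] ca by (simp add: d tens_scale_left linear_on_def)
    then show ?thesis
      using t' \<tau> unitalD(1)[OF unital_\<tau>' a] unitalD(1)[OF \<tau>_unital a] ij by simp
  next
    case (Suc m)
    have "\<delta> (tBA b a) \<in> {0}"
    proof (rule hB.dom.gr_Suc_subspaceI[OF ogB vs(3) _ subspace_0'[OF vs(3)] _ b[unfolded Suc]])
      show "linear_on (smul B) (carr B) fun_scale (\<lambda>b. \<delta> (tBA b a))"
        by (rule linear_on_comp[OF tens_lin(4)[OF ca] _ glinD(1)[OF \<delta>]]) (use ca in simp)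
      fix y b' assume y: "y \<in> gr B 1" and b': "b' \<in> gr B m"
      note cy = gr_carr(2)[OF y] and cb' = gr_carr(2)[OF b']
      have deg: "1 + m + j = n" using ij Suc by simp
      note ba = tens_gr'(2)[OF a b']
      have e: "\<tau>' (tBA b' a) = \<tau> (tBA b' a)" by (rule eq[OF _ ba]) (use deg in simp)
      have g: "tB y \<in> gr C 1" using tens_gr'(1)[OF one_in(3) y] by simp
      have "\<delta> (tBA (mul B y b') a) = \<tau>' (tBA (mul B y b') a) - \<tau> (tBA (mul B y b') a)"
        using \<delta>_gr[OF tens_gr'(2)[OF a mul_gr(2)[OF y b']]] deg by simp
      also have "\<dots> = tmul \<tau>' (tB y) (\<tau> (tBA b' a)) - tmul \<tau> (tB y) (\<tau> (tBA b' a))"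
        unfolding hexagonsD(1)[OF hexagons_\<tau>'[OF le_refl] deg y b' a] hexagonsD(1)[OF \<tau>_hexagons
            deg y b' a] e ..
      also have "\<dots> = tmul \<delta> (tB y) (\<tau> (tBA b' a))"
        by (rule tmul_\<delta>[OF g glinD(2)[OF \<tau> ba], symmetric]) (use deg in simp)
      \<comment> \<open>On a summand v \<otimes> w of \<tau>(b' \<otimes> a) the \<delta>-product is
        \<delta>(y \<otimes> v) acted on by w, and y is a letter.\<close>
      also have "\<dots> = 0"
      proof (rule tprod_eqI[OF gs(1,2) vs(3) tmul_lin(2)[OF \<delta>] linear_on_zero_map[OF vs(3)] _
          glinD(2)[OF \<tau> ba]])
        show "tB y \<in> carr C" using cy by simp
        fix v w k l assume vw: "v \<in> gr A k" "w \<in> gr B l"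
        note c = gr_carr(1)[OF vw(1)] gr_carr(2)[OF vw(2)]
        have "act (one A) w 0 = 0"
          by (rule linear_on_0[OF vs(3) vs(3) sub(1) act_lin(1)[OF one_in(1) c(2)]])
        then show "tmul \<delta> (tB y) (tAB v w) = 0"
          using c cy \<delta>_letter[OF y vw(1)] by (simp add: tmul_tens[OF \<delta>])
      qed
      finally show "\<delta> (tBA (mul B y b') a) \<in> {0}" by simp
    qed
    then show ?thesis using \<delta>_gr[OF tens_gr'(2)[OF a b]] ij by simp
  qed
qed

end

lemma (in twisted_algebra) unique_extension_if_quadratic:
  assumes qE: "quadratic E" shows "unique_extension A B \<tau>"
  unfolding unique_extension_def
proof (intro allI impI ballI, elim conjE)
  fix n \<tau>' x assume *: "3 \<le> n" "glin \<tau>'" "graded_twisting_to A B n \<tau>'"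
    "\<forall>i<n. \<forall>x\<in>gr D i. \<tau>' x = \<tau> x" and x: "x \<in> gr D n"
  interpret twisting_extension A B \<tau> n \<tau>'
    by unfold_locales (use * qE in auto)
  show "\<tau>' x = \<tau> x" by (rule extension_unique[OF x])
qed

section \<open>If extensions are unique then $A \otimes_\tau B$ is quadratic\<close>

context canonical_map
begin

definition cong :: "(('v list \<Rightarrow> 'k) \<Rightarrow> 'k) \<Rightarrow> (('v list \<Rightarrow> 'k) \<Rightarrow> 'k) \<Rightarrow> bool" (infix \<open>\<approx>\<close> 50) where
  "x \<approx> y \<longleftrightarrow> x - y \<in> I"

abbreviation tmult (infixl \<open>\<star>\<close> 70) where "x \<star> y \<equiv> mul T x y"

lemmas ID = two_sided_idealD[OF I_ideal]

lemma cong_refl [simp]: "x \<approx> x"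
  using F.subspace_0[OF ID(1)] by (simp add: cong_def)

lemma cong_trans [trans]: "x \<approx> y \<Longrightarrow> y \<approx> z \<Longrightarrow> x \<approx> z"
  using F.subspace_add[OF ID(1), of "x - y" "y - z"] by (simp add: cong_def)

lemma cong_sym: "x \<approx> y \<Longrightarrow> y \<approx> x"
  using F.subspace_neg[OF ID(1), of "x - y"] by (simp add: cong_def)

lemma cong_mul:
  assumes "x \<approx> x'" "y \<approx> y'" "x \<in> carr T" "x' \<in> carr T" "y \<in> carr T" "y' \<in> carr T"
  shows "x \<star> y \<approx> x' \<star> y'"
proof -
  have "x \<star> y - x' \<star> y' = (x - x') \<star> y + x' \<star> (y - y')"
    using assms by (simp add: mul_T_diff)
  then show ?thesis
    using F.subspace_add[OF ID(1) ID(4)[OF assms(5) assms(1)[unfolded cong_def]] ID(3)[OF assms(4)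
        assms(2)[unfolded cong_def]]]
    by (simp only: cong_def)
qed

lemma cong_diff:
  assumes "x \<approx> x'" "y \<approx> y'" shows "x - y \<approx> x' - y'"
proof -
  have "(x - y) - (x' - y') = (x - x') - (y - y')" by (simp add: algebra_simps)
  then show ?thesis using F.subspace_diff[OF ID(1) assms[unfolded cong_def]] by
      (simp only: cong_def)
qed

text \<open>
  The definitions admit the zero algebra; it is not quadratic, as the kernel of the canonical
  map contains the unit of the tensor algebra.
\<close>

lemma quadratic_one_neq_0:
  assumes "quadratic A" shows "one A \<noteq> 0"
proof
  assume 0: "one A = 0"
  \<comment> \<open>This form reads off the constant coefficient of an element of the tensor
    algebra. The elements where it vanishes form a two-sided ideal that contains degree 2 but not
    the unit.\<close>
  define \<phi> :: "'v list \<Rightarrow> 'k" where "\<phi> xs = (if xs = [] then 1 else 0)" for xs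
  have ml: "multilinear_form (smul A) (gr A 1) \<phi>"
    by (simp add: multilinear_form_def linear_on_def \<phi>_def)
  have z: "x (\<lambda>_. 0) = 0" if "x \<in> carr T" for x
    by (rule T_eqI[OF vs_K eval_lin linear_on_zero_map[OF vs_K] _ that]) (simp add: word_def)
  let ?J = "{x \<in> carr T. x \<phi> = 0}"
  have "two_sided_ideal T ?J"
    unfolding two_sided_ideal_def T_smul
  proof (intro conjI ballI)
    show "F.subspace ?J" unfolding F.subspace_def by (auto simp: fun_scale_apply)
    fix r x assume r: "r \<in> carr T" and "x \<in> ?J"
    then have x: "x \<in> carr T" "x \<phi> = 0" by auto
    have 1: "(r \<star> x) \<phi> = 0"
    proof (rule T_eqI[OF vs_K linear_on_comp[OF mul_T_lin1[of "carr T"] _ eval_lin[of UNIV]]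
        linear_on_zero_map[OF vs_K] _ r])
      fix rs assume rs: "rs \<in> lists (gr A 1)"
      show "(w rs \<star> x) \<phi> = 0"
        unfolding mul_word_left[OF ml rs x(1)] by (cases rs) (simp_all add: x z \<phi>_def[of "_ # _"])
    qed simp
    have 2: "(x \<star> r) \<phi> = 0"
    proof (rule T_eqI[OF vs_K linear_on_comp[OF mul_T_lin2[OF x(1)] _ eval_lin[of UNIV]]
        linear_on_zero_map[OF vs_K] _ r])
      fix rs assume rs: "rs \<in> lists (gr A 1)"
      show "(x \<star> w rs) \<phi> = 0"
        unfolding mul_word_right[OF ml rs x(1)] by (cases rs)
            (simp_all add: x z \<phi>_def[of "_ @ _ # _"])
    qed simp
    show "r \<star> x \<in> ?J" "x \<star> r \<in> ?J" using 1 2 r x by auto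
  qed auto
  moreover have "K \<inter> gr T 2 \<subseteq> ?J"
  proof
    fix x assume x: "x \<in> K \<inter> gr T 2"
    have "x \<phi> = x (\<lambda>_. 0)"
      by (rule eval_gr_cong[OF ml, of _ 2])
          (use x in \<open>auto simp: multilinear_form_def linear_on_def \<phi>_def\<close>)
    then show "x \<in> ?J" using x z[of x] by (auto simp: tcanon_kernel_def)
  qed
  ultimately have "I \<subseteq> ?J" by (rule I_min)
  moreover have "one T \<in> K" using 0 by (simp add: tcanon_kernel_def \<pi>_one)
  ultimately have "one T \<phi> = 0" using assms quadratic_iff by blast
  then show False by (simp add: one_T word_eval[OF ml] \<phi>_def)
qed

lemma letter_lin:
  "linear_on (smul A) (gr A 1) fun_scale (\<lambda>x. w [x])"
proof -
  have "linear_on (smul A) (gr A 1) (*) (\<lambda>u. \<phi> [u])" if "multilinear_form (smul A) (gr A 1) \<phi>" for \<phi>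
    using that[unfolded multilinear_form_def, rule_format, of "[]" "[]"] by simp
  then show ?thesis by (auto simp: linear_on_def word_def fun_eq_iff fun_scale_def)
qed

text \<open>In degree 0 the kernel is 0 because the unit of the algebra is not; in degree 1 because
  a letter is recovered from its image; in degree 2 the kernel generates \<open>I\<close>. This
  starts the induction on the degree.\<close>

lemma kernel_low:
  assumes q: "one A \<noteq> 0" and n: "n \<le> 2" and y: "y \<in> K" "y \<in> gr T n"
  shows "y \<in> I"
proof -
  interpret A: vector_space "smul A" by (rule graded_spaceD(1)[OF gA])
  consider "n = 0" | "n = 1" | "n = 2" using n by linarith
  then show ?thesis
  proof cases
    case 1
    have "{w xs | xs. xs \<in> lists (gr A 1) \<and> length xs = 0} = {one T}" by (auto simp: one_T)
    then obtain c where c: "y = fun_scale c (one T)" using y(2) unfolding gr_T 1 by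
        (auto simp: F.span_singleton)
    have "smul A c (one A) = 0"
      using y(1) \<pi>_lin by (simp add: c tcanon_kernel_def linear_on_def \<pi>_one)
    then have "c = 0" using q A.scale_eq_0_iff by blast
    then show ?thesis using F.subspace_0[OF ID(1)] by (simp add: c)
  next
    case 2
    have l: "linear_on fun_scale (gr T 1) fun_scale (\<lambda>y. w [\<pi> y])"
      by (rule linear_on_comp[OF linear_on_mono[OF \<pi>_lin] \<pi>_gr letter_lin]) (use gr_T_carr in auto)
    have "y = w [\<pi> y]"
    proof (rule subspace_eqI[OF vector_space_fun_scale vector_space_fun_scale linear_on_id l
        T_sub(2)])
      show "y \<in> F.span {w xs |xs. xs \<in> lists (gr A 1) \<and> length xs = 1}" using y(2)
          unfolding gr_T 2 .
      show "{w xs |xs. xs \<in> lists (gr A 1) \<and> length xs = 1} \<subseteq> gr T 1" unfolding gr_T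
          by (rule F.span_superset)
      fix x assume "x \<in> {w xs |xs. xs \<in> lists (gr A 1) \<and> length xs = 1}"
      then obtain u where "u \<in> gr A 1" "x = w [u]" by (auto simp: One_nat_def length_Suc_conv)
      then show "x = w [\<pi> x]" by (simp add: \<pi>_letter)
    qed
    also have "\<dots> = w [0]" using y(1) by (simp add: tcanon_kernel_def)
    also have "\<dots> = 0"
        by (rule linear_on_0[OF A.vector_space_axioms vector_space_fun_scale graded_spaceD(2)[OF
        gA] letter_lin])
    finally show ?thesis using F.subspace_0[OF ID(1)] by simp
  next
    case 3
    then show ?thesis using y I_base by blast
  qed
qed

end

text \<open>The situation at one degree \<open>n\<close>: \<open>IH\<close> states that kernel and
  quadratic relations agree below it, \<open>sA\<close> and \<open>sB\<close> lift A and B to the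
  tensor algebra, multiplicatively modulo \<open>Q.I\<close>, and \<open>lam\<close> is a functional
  killing \<open>Q.I\<close> that will be shown to kill the kernel in degree
  \<open>n\<close>.\<close>

locale relation_test = twisted_algebra A B \<tau> for A :: "('k::field, 'a::ab_group_add) galgebra"
    and B :: "('k, 'b::ab_group_add) galgebra" and \<tau> +
  fixes n :: nat and sA :: "'a \<Rightarrow> ((('a \<Rightarrow> 'b \<Rightarrow> 'k) \<Rightarrow> 'k) list \<Rightarrow> 'k) \<Rightarrow> 'k"
    and sB :: "'b \<Rightarrow> ((('a \<Rightarrow> 'b \<Rightarrow> 'k) \<Rightarrow> 'k) list \<Rightarrow> 'k) \<Rightarrow> 'k"
    and lam :: "(((('a \<Rightarrow> 'b \<Rightarrow> 'k) \<Rightarrow> 'k) list \<Rightarrow> 'k) \<Rightarrow> 'k) \<Rightarrow> 'k"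
  assumes n: "3 \<le> n"
    and IH: "\<And>i y. i < n \<Longrightarrow> y \<in> Q.K \<Longrightarrow> y \<in> gr Q.T i \<Longrightarrow> y \<in> Q.I"
    and sA: "linear_on (smul A) (carr A) fun_scale sA" "\<And>a. a \<in> carr A \<Longrightarrow> sA a \<in> carr Q.T"
      "\<And>i a. i \<le> n \<Longrightarrow> a \<in> gr A i \<Longrightarrow> sA a \<in> gr Q.T i"
      "\<And>i a. i \<le> n \<Longrightarrow> a \<in> gr A i \<Longrightarrow> Q.\<pi> (sA a) = tAB a (one B)"
      "\<And>i j a b. i + j \<le> n \<Longrightarrow> a \<in> gr A i \<Longrightarrow> b \<in> gr A j \<Longrightarrow> Q.cong (sA (mul A a b)) (mul Q.T (sA a)
          (sA b))"
      "Q.cong (sA (one A)) (one Q.T)"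
      "\<And>a. a \<in> gr A 1 \<Longrightarrow> Q.cong (sA a) (Q.w [tAB a (one B)])"
    and sB: "linear_on (smul B) (carr B) fun_scale sB" "\<And>b. b \<in> carr B \<Longrightarrow> sB b \<in> carr Q.T"
      "\<And>i b. i \<le> n \<Longrightarrow> b \<in> gr B i \<Longrightarrow> sB b \<in> gr Q.T i"
      "\<And>i b. i \<le> n \<Longrightarrow> b \<in> gr B i \<Longrightarrow> Q.\<pi> (sB b) = tAB (one A) b"
      "\<And>i j a b. i + j \<le> n \<Longrightarrow> a \<in> gr B i \<Longrightarrow> b \<in> gr B j \<Longrightarrow> Q.cong (sB (mul B a b)) (mul Q.T (sB a)
          (sB b))"
      "Q.cong (sB (one B)) (one Q.T)"
      "\<And>b. b \<in> gr B 1 \<Longrightarrow> Q.cong (sB b) (Q.w [tAB (one A) b])"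
    and lam: "Vector_Spaces.linear fun_scale (*) lam" and lam_I: "\<And>x. x \<in> Q.I \<Longrightarrow> lam x = 0"
    and ue: "unique_extension A B \<tau>"
begin

notation Q.cong (infix \<open>\<approx>\<close> 50)
notation Q.tmult (infixl \<open>\<star>\<close> 70)

sublocale lam: Vector_Spaces.linear fun_scale "(*)" lam by (rule lam)

lemma lam_lin: "linear_on fun_scale V (*) lam"
  by (simp add: linear_on_def lam.add lam.scale)

lemma lam_cong: "x \<approx> y \<Longrightarrow> lam x = lam y"
  using lam_I[of "x - y"] by (simp add: lam.diff Q.cong_def)

lemma sAB [simp]: "a \<in> carr A \<Longrightarrow> sA a \<in> carr Q.T" "b \<in> carr B \<Longrightarrow> sB b \<in> carr Q.T"
  by (rule sA sB; assumption)+

section \<open>Lifts with the A-part in front, and the defect of commuting B past A\<close>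

lemma bil_AB: "bilinear_on A B (smul Q.T) (\<lambda>a b. sA a \<star> sB b)"
  unfolding Q.T_smul
  by (intro bilinear_onI linear_on_comp[OF sA(1) _ Q.mul_T_lin1[of "carr Q.T"]] linear_on_comp[OF
      sB(1) _ Q.mul_T_lin2]) simp_all

lemma bil_BA: "bilinear_on B A (smul Q.T) (\<lambda>b a. sB b \<star> sA a)"
  unfolding Q.T_smul
  by (intro bilinear_onI linear_on_comp[OF sB(1) _ Q.mul_T_lin1[of "carr Q.T"]] linear_on_comp[OF
      sA(1) _ Q.mul_T_lin2]) simp_all

lemma vT: "vector_space (smul Q.T)" by (simp add: vector_space_fun_scale)

text \<open>\<open>\<Delta>\<close> is the lifted defect of the relations $b a = \tau(b \otimes a)$.\<close>

definition \<sigma> where "\<sigma> = tlift A B Q.T (\<lambda>a b. sA a \<star> sB b)"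
definition \<rho> where "\<rho> = tlift B A Q.T (\<lambda>b a. sB b \<star> sA a)"
definition \<Delta> where "\<Delta> x = \<rho> x - \<sigma> (\<tau> x)"

lemma \<sigma>_lin: "linear_on fun_scale (carr C) fun_scale \<sigma>"
  using tensor_universal(1)[OF gs(1,2) vT bil_AB] by (simp add: \<sigma>_def)

lemma \<sigma>_tens: "a \<in> carr A \<Longrightarrow> b \<in> carr B \<Longrightarrow> \<sigma> (tAB a b) = sA a \<star> sB b"
  unfolding \<sigma>_def by (rule tensor_universal(2)[OF gs(1,2) vT bil_AB])

lemma \<sigma>_in [simp]: "c \<in> carr C \<Longrightarrow> \<sigma> c \<in> carr Q.T"
  unfolding \<sigma>_def by (rule tlift_in[OF gs(1,2) vT bil_AB]) simp_all

lemma \<sigma>_gr: "i \<le> n \<Longrightarrow> c \<in> gr C i \<Longrightarrow> \<sigma> c \<in> gr Q.T i"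
  unfolding \<sigma>_def
  by (rule tlift_gr[OF gs(1,2) vT bil_AB])
      (use Q.mul_T_gr[OF sA(3) sB(3)] in \<open>auto simp del: Q.T_sub simp: Q.T_sub[unfolded Q.T_smul]\<close>)

lemma E_lin_pi: "linear_on fun_scale (carr Q.T) fun_scale Q.\<pi>"
  using Q.\<pi>_lin by (simp add: E_simps(1))

lemma \<pi>_in: "x \<in> carr Q.T \<Longrightarrow> Q.\<pi> x \<in> carr C" "x \<in> gr Q.T i \<Longrightarrow> Q.\<pi> x \<in> gr C i"
  using Q.\<pi>_carr Q.\<pi>_gr[of x i] by (simp_all add: E_simps)

text \<open>With the A-part written first no reordering takes place, since (a \<otimes> 1)(1
  \<otimes> b) = a \<otimes> b. Hence \<open>\<sigma>\<close> is a section of the canonical map up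
  to degree \<open>n\<close>.\<close>

lemma \<pi>_\<sigma>:
  assumes i: "i \<le> n" and c: "c \<in> gr C i" shows "Q.\<pi> (\<sigma> c) = c"
proof (rule tprod_eqI[OF gs(1,2) vs(3) linear_on_comp[OF \<sigma>_lin \<sigma>_in E_lin_pi] linear_on_id _ c])
  fix a b k l assume ab: "a \<in> gr A k" "b \<in> gr B l" "k + l = i"
  note c = gr_carr(1)[OF ab(1)] gr_carr(2)[OF ab(2)]
  have "k \<le> n" "l \<le> n" using ab i by auto
  then show "Q.\<pi> (\<sigma> (tAB a b)) = tAB a b"
    using c by (simp add: \<sigma>_tens Q.\<pi>_mul sA(4)[OF _ ab(1)] sB(4)[OF _ ab(2)] E_simps(3) tmul_tA_tB)
qed

lemma \<Delta>_lin: "linear_on fun_scale (carr D) fun_scale \<Delta>"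
proof -
  have "linear_on fun_scale (carr D) fun_scale \<rho>"
    using tensor_universal(1)[OF gs(2,1) vT bil_BA] by (simp add: \<rho>_def)
  from linear_on_minus[OF vector_space_fun_scale this linear_on_comp[OF glinD(1,3)[OF \<tau>] \<sigma>_lin]]
  show ?thesis by (simp add: \<Delta>_def[abs_def])
qed

lemma \<Delta>_tens: "a \<in> carr A \<Longrightarrow> b \<in> carr B \<Longrightarrow> \<Delta> (tBA b a) = sB b \<star> sA a - \<sigma> (\<tau> (tBA b a))"
  using tensor_universal(2)[OF gs(2,1) vT bil_BA] by (simp add: \<Delta>_def \<rho>_def)

lemma \<Delta>_in [simp]: "a \<in> carr A \<Longrightarrow> b \<in> carr B \<Longrightarrow> \<Delta> (tBA b a) \<in> carr Q.T"
  by (simp add: \<Delta>_tens glinD(3)[OF \<tau>])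

text \<open>In \<open>E\<close> the product b a equals \<tau>(b \<otimes> a), so the defect lies in
  the kernel; below degree \<open>n\<close> the kernel consists of quadratic consequences.\<close>

lemma \<Delta>_I:
  assumes a: "a \<in> gr A i" and b: "b \<in> gr B j" and ij: "i + j < n"
  shows "\<Delta> (tBA b a) \<in> Q.I"
proof (rule IH[of "j + i"])
  note c = gr_carr(1)[OF a] gr_carr(2)[OF b]
  have d: "i \<le> n" "j \<le> n" "j + i \<le> n" using ij by auto
  note t = glinD(2)[OF \<tau> tens_gr'(2)[OF a b]]
  have "Q.\<pi> (\<Delta> (tBA b a)) = 0"
    using c d by (simp add: \<Delta>_tens Q.\<pi>_diff glinD(3)[OF \<tau>] Q.\<pi>_mul sA(4)[OF _ a] sB(4)[OF _ b]
        E_simps(3) tmul_tB_tA \<pi>_\<sigma>[OF d(3) t])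
  then show "\<Delta> (tBA b a) \<in> Q.K" using c by (simp add: tcanon_kernel_def)
  show "\<Delta> (tBA b a) \<in> gr Q.T (j + i)"
    using Q.F.subspace_diff[OF Q.T_sub(2) Q.mul_T_gr[OF sB(3)[OF d(2) b] sA(3)[OF d(1) a]] \<sigma>_gr[OF
        d(3) t]] c
    by (simp add: \<Delta>_tens)
qed (use ij in simp)

text \<open>The difference is in the kernel because \<open>\<sigma>\<close> is a section, hence in
  \<open>Q.I\<close> below degree \<open>n\<close>. Elements of lower degree may thus be replaced by
  their ordered form.\<close>

lemma low_section:
  assumes t: "t \<in> gr Q.T i" and i: "i < n" shows "t \<approx> \<sigma> (Q.\<pi> t)"
  unfolding Q.cong_def
proof (rule IH[OF i])
  note tc = Q.gr_T_carr[OF t] and p = \<pi>_in(2)[OF t]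
  have "\<sigma> (Q.\<pi> t) \<in> gr Q.T i" using \<sigma>_gr[OF _ p] i by simp
  then show "t - \<sigma> (Q.\<pi> t) \<in> gr Q.T i" using Q.F.subspace_diff[OF Q.T_sub(2) t] by simp
  show "t - \<sigma> (Q.\<pi> t) \<in> Q.K"
    using tc \<pi>_in(1)[OF tc] \<pi>_\<sigma>[OF _ p] i by (simp add: tcanon_kernel_def Q.\<pi>_diff)
qed

lemma sB_one_right: "x \<in> carr Q.T \<Longrightarrow> x \<star> sB (one B) \<approx> x"
  using Q.cong_mul[OF Q.cong_refl sB(6), of x] by simp

lemma sA_one_left: "x \<in> carr Q.T \<Longrightarrow> sA (one A) \<star> x \<approx> x"
  using Q.cong_mul[OF sA(6) Q.cong_refl, of x] by simp

lemma sB_one_left: "x \<in> carr Q.T \<Longrightarrow> sB (one B) \<star> x \<approx> x"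
  using Q.cong_mul[OF sB(6) Q.cong_refl, of x] by simp

lemma sA_one_right: "x \<in> carr Q.T \<Longrightarrow> x \<star> sA (one A) \<approx> x"
  using Q.cong_mul[OF Q.cong_refl sA(6), of x] by simp

text \<open>The left factor from A and the right factor from B are absorbed on their own sides by
  the multiplicativity of \<open>sA\<close> and \<open>sB\<close> modulo \<open>Q.I\<close>; nothing
  from B has to cross anything from A.\<close>

lemma \<sigma>_act:
  assumes a: "a \<in> gr A i" and b: "b \<in> gr B k" and c: "c \<in> gr C j" and n: "i + j + k \<le> n"
  shows "\<sigma> (act a b c) \<approx> sA a \<star> \<sigma> c \<star> sB b"
  unfolding Q.cong_def
proof (rule tprod_subspaceI[OF gs(1,2) vector_space_fun_scale _ Q.ID(1) _ c])
  note ca = gr_carr(1)[OF a] and cb = gr_carr(2)[OF b]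
  show "linear_on fun_scale (carr C) fun_scale (\<lambda>c. \<sigma> (act a b c) - sA a \<star> \<sigma> c \<star> sB b)"
    by (rule linear_on_minus[OF vector_space_fun_scale linear_on_comp[OF act_lin(1,2)[OF ca cb]
        \<sigma>_lin]
        linear_on_comp[OF linear_on_comp[OF \<sigma>_lin \<sigma>_in Q.mul_T_lin2] _ Q.mul_T_lin1[of "carr
            Q.T"]]])
      (use ca in simp_all)
  fix v w p q assume vw: "v \<in> gr A p" "w \<in> gr B q" "p + q = j"
  note c = gr_carr(1)[OF vw(1)] gr_carr(2)[OF vw(2)]
  have "sA (mul A a v) \<star> sB (mul B w b) \<approx> (sA a \<star> sA v) \<star> (sB w \<star> sB b)"
    by (rule Q.cong_mul[OF sA(5)[OF _ a vw(1)] sB(5)[OF _ vw(2) b]]) (use n vw ca cb c in simp_all)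
  then show "\<sigma> (act a b (tAB v w)) - sA a \<star> \<sigma> (tAB v w) \<star> sB b \<in> Q.I"
    using ca cb c by (simp add: act_lin \<sigma>_tens Q.mul_T_assoc Q.cong_def)
qed

lemma \<sigma>_act_left:
  assumes a: "a \<in> gr A i" and c: "c \<in> gr C j" and n: "i + j \<le> n"
  shows "\<sigma> (act a (one B) c) \<approx> sA a \<star> \<sigma> c"
  by (rule Q.cong_trans[OF \<sigma>_act[OF a one_in(4) c] sB_one_right])
      (use n gr_carr(1)[OF a] gr_carr(3)[OF c] in simp_all)

lemma \<sigma>_act_right:
  assumes b: "b \<in> gr B k" and c: "c \<in> gr C j" and n: "j + k \<le> n"
  shows "\<sigma> (act (one A) b c) \<approx> \<sigma> c \<star> sB b"
proof -
  note cb = gr_carr(2)[OF b] and cc = gr_carr(3)[OF c]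
  have "sA (one A) \<star> \<sigma> c \<star> sB b \<approx> \<sigma> c \<star> sB b"
    by (rule Q.cong_mul[OF sA_one_left]) (use cb cc in simp_all)
  with \<sigma>_act[OF one_in(3) b c] n show ?thesis using Q.cong_trans by simp
qed

text \<open>Multiplying the ordered lift of v \<otimes> w by b from the left is no longer ordered;
  commuting b past v costs \<Delta>(b \<otimes> v), with the lift of w left standing behind
  it.\<close>

lemma defect_left:
  assumes b: "b \<in> gr B i" and v: "v \<in> gr A k" and w: "w \<in> gr B l" and n: "i + k + l \<le> n"
  shows "sB b \<star> \<sigma> (tAB v w) - \<sigma> (tmul \<tau> (tB b) (tAB v w)) \<approx> \<Delta> (tBA b v) \<star> sB w"
proof -
  note c = gr_carr(2)[OF b] gr_carr(1)[OF v] gr_carr(2)[OF w]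
  let ?t = "\<tau> (tBA b v)"
  have t: "?t \<in> carr C" using c by (simp add: glinD(3)[OF \<tau>])
  have "\<sigma> (tmul \<tau> (tB b) (tAB v w)) \<approx> \<sigma> ?t \<star> sB w"
    using \<sigma>_act_right[OF w glinD(2)[OF \<tau> tens_gr'(2)[OF v b]]] n c by (simp add: tmul_tens[OF \<tau>])
  then have "sB b \<star> \<sigma> (tAB v w) - \<sigma> (tmul \<tau> (tB b) (tAB v w)) \<approx> sB b \<star> \<sigma> (tAB v w) - \<sigma> ?t \<star> sB w"
    by (rule Q.cong_diff[OF Q.cong_refl])
  also have "sB b \<star> \<sigma> (tAB v w) - \<sigma> ?t \<star> sB w = \<Delta> (tBA b v) \<star> sB w"
    using c t by (simp add: \<sigma>_tens \<Delta>_tens Q.mul_T_diff Q.mul_T_assoc)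
  finally show ?thesis .
qed

text \<open>The mirror image: a crosses w from the right, and the lift of v remains in front of the
  defect.\<close>

lemma defect_right:
  assumes a: "a \<in> gr A i" and v: "v \<in> gr A k" and w: "w \<in> gr B l" and n: "i + k + l \<le> n"
  shows "\<sigma> (tAB v w) \<star> sA a - \<sigma> (tmul \<tau> (tAB v w) (tA a)) \<approx> sA v \<star> \<Delta> (tBA w a)"
proof -
  note c = gr_carr(1)[OF a] gr_carr(1)[OF v] gr_carr(2)[OF w]
  let ?t = "\<tau> (tBA w a)"
  have t: "?t \<in> carr C" using c by (simp add: glinD(3)[OF \<tau>])
  have "\<sigma> (tmul \<tau> (tAB v w) (tA a)) \<approx> sA v \<star> \<sigma> ?t"
    using \<sigma>_act_left[OF v glinD(2)[OF \<tau> tens_gr'(2)[OF a w]]] n c by (simp add: tmul_tens[OF \<tau>])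
  then have "\<sigma> (tAB v w) \<star> sA a - \<sigma> (tmul \<tau> (tAB v w) (tA a)) \<approx> \<sigma> (tAB v w) \<star> sA a - sA v \<star> \<sigma> ?t"
    by (rule Q.cong_diff[OF Q.cong_refl])
  also have "\<sigma> (tAB v w) \<star> sA a - sA v \<star> \<sigma> ?t = sA v \<star> \<Delta> (tBA w a)"
    using c t by (simp add: \<sigma>_tens \<Delta>_tens Q.mul_T_diff Q.mul_T_assoc)
  finally show ?thesis .
qed

text \<open>If \<open>w\<close> has positive degree, \<Delta>(b \<otimes> v) has degree below
  \<open>n\<close> and lies in \<open>Q.I\<close>, which \<open>lam\<close> kills. In degree 0,
  \<open>w\<close> is a scalar and only rescales. Thus \<open>lam\<close> sees the defect only
  against scalars.\<close>

lemma lam_\<Delta>_right: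
  assumes b: "b \<in> gr B i" and v: "v \<in> gr A k" and w: "w \<in> gr B l" and ikl: "i + k + l = n"
  shows "0 < l \<Longrightarrow> lam (\<Delta> (tBA b v) \<star> sB w) = 0"
    "w = smul B d (one B) \<Longrightarrow> lam (\<Delta> (tBA b v) \<star> sB w) = d * lam (\<Delta> (tBA b v))"
proof -
  note c = gr_carr(2)[OF b] gr_carr(1)[OF v] gr_carr(2)[OF w]
  show "lam (\<Delta> (tBA b v) \<star> sB w) = 0" if "0 < l"
    by (rule lam_I, rule Q.ID(4)[OF _ \<Delta>_I[OF v b]]) (use that ikl c in simp_all)
  assume w: "w = smul B d (one B)"
  have "sB w = fun_scale d (sB (one B))" using sB(1) by (simp add: w linear_on_def)
  then have "\<Delta> (tBA b v) \<star> sB w = fun_scale d (\<Delta> (tBA b v) \<star> sB (one B))"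
    using Q.mul_T_lin2[OF \<Delta>_in[OF c(2,1)]] by (simp add: linear_on_def)
  then show "lam (\<Delta> (tBA b v) \<star> sB w) = d * lam (\<Delta> (tBA b v))"
    using lam_cong[OF sB_one_right[OF \<Delta>_in[OF c(2,1)]]] by (simp add: lam.scale)
qed

lemma lam_\<Delta>_left:
  assumes a: "a \<in> gr A i" and v: "v \<in> gr A k" and w: "w \<in> gr B l" and ikl: "i + k + l = n"
  shows "0 < k \<Longrightarrow> lam (sA v \<star> \<Delta> (tBA w a)) = 0"
    "v = smul A d (one A) \<Longrightarrow> lam (sA v \<star> \<Delta> (tBA w a)) = d * lam (\<Delta> (tBA w a))"
proof -
  note c = gr_carr(1)[OF a] gr_carr(1)[OF v] gr_carr(2)[OF w]
  show "lam (sA v \<star> \<Delta> (tBA w a)) = 0" if "0 < k"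
    by (rule lam_I, rule Q.ID(3)[OF _ \<Delta>_I[OF a w]]) (use that ikl c in simp_all)
  assume v: "v = smul A d (one A)"
  have "sA v = fun_scale d (sA (one A))" using sA(1) by (simp add: v linear_on_def)
  then have "sA v \<star> \<Delta> (tBA w a) = fun_scale d (sA (one A) \<star> \<Delta> (tBA w a))"
    using Q.mul_T_lin1[of UNIV "\<Delta> (tBA w a)"] by (simp add: linear_on_def)
  then show "lam (sA v \<star> \<Delta> (tBA w a)) = d * lam (\<Delta> (tBA w a))"
    using lam_cong[OF sA_one_left[OF \<Delta>_in[OF c(1,3)]]] by (simp add: lam.scale)
qed

text \<open>\<tau> is unital, so the defect compares two orders of multiplying by a lift of the
  unit, and modulo \<open>Q.I\<close> that lift is the unit of the tensor algebra.\<close>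

lemma lam_\<Delta>_unital:
  "a \<in> gr A n \<Longrightarrow> lam (\<Delta> (tBA (one B) a)) = 0" "b \<in> gr B n \<Longrightarrow> lam (\<Delta> (tBA b (one A))) = 0"
proof -
  show "lam (\<Delta> (tBA (one B) a)) = 0" if a: "a \<in> gr A n"
  proof -
    note c = gr_carr(1)[OF a]
    have "sB (one B) \<star> sA a \<approx> sA a \<star> sB (one B)"
      by (rule Q.cong_trans[OF sB_one_left Q.cong_sym[OF sB_one_right]]) (use c in simp_all)
    then show ?thesis using c by (simp add: \<Delta>_tens \<tau>_one \<sigma>_tens lam_I Q.cong_def)
  qed
  show "lam (\<Delta> (tBA b (one A))) = 0" if b: "b \<in> gr B n"
  proof -
    note c = gr_carr(2)[OF b]
    have "sB b \<star> sA (one A) \<approx> sA (one A) \<star> sB b"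
      by (rule Q.cong_trans[OF sA_one_right Q.cong_sym[OF sA_one_left]]) (use c in simp_all)
    then show ?thesis using c by (simp add: \<Delta>_tens \<tau>_one \<sigma>_tens lam_I Q.cong_def)
  qed
qed

section \<open>Deforming \<tau> by the scalar defect in degree n\<close>

context
  fixes e assumes e: "e \<in> gr C n"
begin

text \<open>The element \<open>e\<close> turns the scalar defect into a map with values in $A \otimes B$.\<close>

definition \<epsilon> where "\<epsilon> x = fun_scale (lam (\<Delta> (hcomp D n x))) e"

lemma e_carr: "e \<in> carr C" using e by (rule gr_carr)

lemma \<epsilon>_gr: "x \<in> gr D i \<Longrightarrow> \<epsilon> x = (if i = n then fun_scale (lam (\<Delta> x)) e else 0)"
  using linear_on_0[OF vs(3) vector_space_fun_scale sub(2) \<Delta>_lin]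
  by (cases "i = n") (simp_all add: \<epsilon>_def hcomp_gr[OF gs(4)] lam.zero fun_scale_0)

lemma scale_e_lin: "linear_on (*) UNIV fun_scale (\<lambda>c. fun_scale c e)"
proof -
  interpret FC: vector_space "fun_scale :: 'k \<Rightarrow> (('a \<Rightarrow> 'b \<Rightarrow> 'k) \<Rightarrow> 'k) \<Rightarrow> _" by (rule vs)
  show ?thesis unfolding linear_on_def
    by (intro conjI ballI allI; (rule FC.scale_left_distrib | rule FC.scale_scale[symmetric]))
qed

lemma \<epsilon>: "glin \<epsilon>"
  unfolding graded_linear_def
proof (intro conjI allI ballI)
  have h: "hcomp D n z \<in> carr D" if "z \<in> carr D" for z
    using linear_on_hcomp(2)[OF gs(4) that] gr_carr by blast
  have 1: "linear_on fun_scale (carr D) fun_scale (\<lambda>z. \<Delta> (hcomp D n z))"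
    using linear_on_hcomp(1)[OF gs(4), of n] unfolding smul_tprod
    by (rule linear_on_comp[OF _ h \<Delta>_lin])
  have 2: "linear_on fun_scale (carr D) (*) (\<lambda>z. lam (\<Delta> (hcomp D n z)))"
    by (rule linear_on_comp[OF 1 UNIV_I lam_lin])
  have 3: "linear_on fun_scale (carr D) fun_scale (\<lambda>z. fun_scale (lam (\<Delta> (hcomp D n z))) e)"
    by (rule linear_on_comp[OF 2 UNIV_I scale_e_lin])
  show "linear_on (smul D) (carr D) (smul C) \<epsilon>"
    unfolding smul_tprod \<epsilon>_def[abs_def] by (rule 3)
  show "\<epsilon> z \<in> gr C i" if "z \<in> gr D i" for i z
    using gr_closed(2)[OF gs(3) e] gr_closed(3)[OF gs(3)] by (cases "i = n")
        (simp_all add: \<epsilon>_gr[OF that])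
qed

definition \<tau>' where "\<tau>' x = \<tau> x + \<epsilon> x"

lemma \<tau>': "glin \<tau>'"
  unfolding graded_linear_def
proof (intro conjI allI ballI)
  show "linear_on (smul D) (carr D) (smul C) \<tau>'"
    using linear_on_plus[OF vs(3) glinD(1)[OF \<tau>] glinD(1)[OF \<epsilon>]] by (simp add: \<tau>'_def[abs_def])
  show "\<tau>' z \<in> gr C i" if "z \<in> gr D i" for i z
    using gr_closed(1)[OF gs(3) glinD(2)[OF \<tau> that] glinD(2)[OF \<epsilon> that]] by (simp add: \<tau>'_def)
qed

lemma \<tau>'_low: "i < n \<Longrightarrow> x \<in> gr D i \<Longrightarrow> \<tau>' x = \<tau> x"
  by (simp add: \<tau>'_def \<epsilon>_gr)

lemma tmul_\<tau>':
  assumes x: "x \<in> gr C p" and y: "y \<in> gr C q"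
  shows "tmul \<tau>' x y = tmul \<tau> x y + tmul \<epsilon> x y"
proof -
  have "tmul \<epsilon> x y = tmul \<tau>' x y - tmul \<tau> x y"
    by (rule tmul_diff[OF \<tau>' \<tau> \<epsilon> _ x y le_refl]) (simp add: \<tau>'_def)
  then show ?thesis by simp
qed

lemma act_0: "a \<in> carr A \<Longrightarrow> b \<in> carr B \<Longrightarrow> act a b 0 = 0"
  by (rule linear_on_0[OF vs(3) vs(3) sub(1) act_lin(1)])

text \<open>Checked on c = v \<otimes> w. If w has positive degree, both sides vanish: the left one
  by \<open>lam_\<Delta>_right\<close>, the right one because \<epsilon> is zero below degree
  \<open>n\<close>. If w is a scalar, both are that multiple of \<open>e\<close>, with coefficient
  \<open>lam\<close> of \<Delta>(b \<otimes> v).\<close>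

lemma lam_defect_left:
  assumes b: "b \<in> gr B i" and c: "c \<in> gr C m" and im: "i + m = n"
  shows "fun_scale (lam (sB b \<star> \<sigma> c - \<sigma> (tmul \<tau> (tB b) c))) e = tmul \<epsilon> (tB b) c"
proof (rule tprod_eqI[where f = "\<lambda>c. fun_scale (lam (sB b \<star> \<sigma> c - \<sigma> (tmul \<tau> (tB b) c))) e",
      OF gs(1,2) vs(3) _ _ _ c])
  note cb = gr_carr(2)[OF b]
  show "linear_on fun_scale (carr C) fun_scale (tmul \<epsilon> (tB b))" by (rule tmul_lin[OF \<epsilon>])
      (use cb in simp)
  show "linear_on fun_scale (carr C) fun_scale (\<lambda>c. fun_scale (lam (sB b \<star> \<sigma> c - \<sigma> (tmul \<tau> (tB b)
      c))) e)"
    by (rule linear_on_comp[OF linear_on_comp[OF linear_on_minus[OF vector_space_fun_scale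
       linear_on_comp[OF \<sigma>_lin \<sigma>_in Q.mul_T_lin2] linear_on_comp[OF tmul_lin(2)[OF \<tau>] tmul_in[OF
           \<tau>] \<sigma>_lin]] _ lam_lin[of UNIV]] _ scale_e_lin])
      (use cb in simp_all)
  fix v w k l assume v: "v \<in> gr A k" and w: "w \<in> gr B l" and kl: "k + l = m"
  note c = gr_carr(1)[OF v] gr_carr(2)[OF w]
  have 1: "lam (sB b \<star> \<sigma> (tAB v w) - \<sigma> (tmul \<tau> (tB b) (tAB v w))) = lam (\<Delta> (tBA b v) \<star> sB w)"
    by (rule lam_cong[OF defect_left[OF b v w]]) (use kl im in simp)
  have "fun_scale (lam (\<Delta> (tBA b v) \<star> sB w)) e = tmul \<epsilon> (tB b) (tAB v w)"
  proof (cases "l = 0")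
    case False
    then have "\<epsilon> (tBA b v) = 0" using \<epsilon>_gr[OF tens_gr'(2)[OF v b]] kl im by simp
    then show ?thesis using lam_\<Delta>_right(1)[OF b v w] False kl im c cb
      by (simp add: tmul_tens[OF \<epsilon>] act_0 fun_scale_0)
  next
    case True
    then obtain d where d: "w = smul B d (one B)" using graded_algebraD(7)[OF B] w by auto
    have ed: "\<epsilon> (tBA b v) = fun_scale (lam (\<Delta> (tBA b v))) e"
      using \<epsilon>_gr[OF tens_gr'(2)[OF v b]] kl im True by simp
    have aw: "act (one A) w x = fun_scale d x" if "x \<in> carr C" for x
      using act_lin_param(2)[OF that one_in(1)] act_one[OF that] by (simp add: d linear_on_def)
    have L: "lam (\<Delta> (tBA b v) \<star> sB w) = d * lam (\<Delta> (tBA b v))"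
      by (rule lam_\<Delta>_right(2)[OF b v w _ d]) (use kl im in simp)
    have e1: "tmul \<epsilon> (tB b) (tAB v w) = act (one A) w (fun_scale (lam (\<Delta> (tBA b v))) e)"
      unfolding tmul_tens[OF \<epsilon> one_in(1) cb c] ed ..
    have e2: "act (one A) w (fun_scale (lam (\<Delta> (tBA b v))) e) =
        fun_scale d (fun_scale (lam (\<Delta> (tBA b v))) e)" by (rule aw[OF C_closed(3)[OF e_carr]])
    have e3: "fun_scale d (fun_scale (lam (\<Delta> (tBA b v))) e) = fun_scale (d * lam (\<Delta> (tBA b v))) e"
        by (rule fun_scale_fun_scale)
    show ?thesis unfolding L e1 e2 e3 ..
  qed
  then show "fun_scale (lam (sB b \<star> \<sigma> (tAB v w) - \<sigma> (tmul \<tau> (tB b) (tAB v w)))) e =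
      tmul \<epsilon> (tB b) (tAB v w)"
    unfolding 1 .
qed

text \<open>As in \<open>lam_defect_left\<close>, with the roles exchanged: both sides vanish unless
  v is a scalar.\<close>

lemma lam_defect_right:
  assumes a: "a \<in> gr A i" and c: "c \<in> gr C m" and im: "i + m = n"
  shows "fun_scale (lam (\<sigma> c \<star> sA a - \<sigma> (tmul \<tau> c (tA a)))) e = tmul \<epsilon> c (tA a)"
proof (rule tprod_eqI[where f = "\<lambda>c. fun_scale (lam (\<sigma> c \<star> sA a - \<sigma> (tmul \<tau> c (tA a)))) e",
      OF gs(1,2) vs(3) _ _ _ c])
  note ca = gr_carr(1)[OF a]
  show "linear_on fun_scale (carr C) fun_scale (\<lambda>c. tmul \<epsilon> c (tA a))" by (rule tmul_lin[OF \<epsilon>])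
      (use ca in simp)
  show "linear_on fun_scale (carr C) fun_scale (\<lambda>c. fun_scale (lam (\<sigma> c \<star> sA a - \<sigma> (tmul \<tau> c
      (tA a)))) e)"
    by (rule linear_on_comp[OF linear_on_comp[OF linear_on_minus[OF vector_space_fun_scale
       linear_on_comp[OF \<sigma>_lin \<sigma>_in Q.mul_T_lin1] linear_on_comp[OF tmul_lin(1)[OF \<tau>] tmul_in[OF
           \<tau>] \<sigma>_lin]] _ lam_lin[of UNIV]] _ scale_e_lin])
      (use ca in simp_all)
  fix v w k l assume v: "v \<in> gr A k" and w: "w \<in> gr B l" and kl: "k + l = m"
  note c = gr_carr(1)[OF v] gr_carr(2)[OF w]
  have 1: "lam (\<sigma> (tAB v w) \<star> sA a - \<sigma> (tmul \<tau> (tAB v w) (tA a))) = lam (sA v \<star> \<Delta> (tBA w a))"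
    by (rule lam_cong[OF defect_right[OF a v w]]) (use kl im in simp)
  have "fun_scale (lam (sA v \<star> \<Delta> (tBA w a))) e = tmul \<epsilon> (tAB v w) (tA a)"
  proof (cases "k = 0")
    case False
    then have "\<epsilon> (tBA w a) = 0" using \<epsilon>_gr[OF tens_gr'(2)[OF a w]] kl im by simp
    then show ?thesis using lam_\<Delta>_left(1)[OF a v w] False kl im c ca
      by (simp add: tmul_tens[OF \<epsilon>] act_0 fun_scale_0)
  next
    case True
    then obtain d where d: "v = smul A d (one A)" using graded_algebraD(7)[OF A] v by auto
    have ed: "\<epsilon> (tBA w a) = fun_scale (lam (\<Delta> (tBA w a))) e"
      using \<epsilon>_gr[OF tens_gr'(2)[OF a w]] kl im True by simp
    have aw: "act v (one B) x = fun_scale d x" if "x \<in> carr C" for x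
      using act_lin_param(1)[OF that one_in(2)] act_one[OF that] by (simp add: d linear_on_def)
    have L: "lam (sA v \<star> \<Delta> (tBA w a)) = d * lam (\<Delta> (tBA w a))"
      by (rule lam_\<Delta>_left(2)[OF a v w _ d]) (use kl im in simp)
    have e1: "tmul \<epsilon> (tAB v w) (tA a) = act v (one B) (fun_scale (lam (\<Delta> (tBA w a))) e)"
      unfolding tmul_tens[OF \<epsilon> c ca one_in(2)] ed ..
    have e2: "act v (one B) (fun_scale (lam (\<Delta> (tBA w a))) e) =
        fun_scale d (fun_scale (lam (\<Delta> (tBA w a))) e)" by (rule aw[OF C_closed(3)[OF e_carr]])
    have e3: "fun_scale d (fun_scale (lam (\<Delta> (tBA w a))) e) = fun_scale (d * lam (\<Delta> (tBA w a))) e"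
        by (rule fun_scale_fun_scale)
    show ?thesis unfolding L e1 e2 e3 ..
  qed
  then show "fun_scale (lam (\<sigma> (tAB v w) \<star> sA a - \<sigma> (tmul \<tau> (tAB v w) (tA a)))) e =
      tmul \<epsilon> (tAB v w) (tA a)"
    unfolding 1 .
qed

text \<open>The first-order part of the first hexagon. As \<open>i\<close> is positive, b' \<otimes>
  a has degree below \<open>n\<close>, so b' a may be replaced by the ordered lift of \<tau>(b'
  \<otimes> a) modulo \<open>Q.I\<close>. By the hexagon of \<tau>, the defect of b b' \<otimes> a
  becomes the defect of b against that lift.\<close>

lemma \<epsilon>_hexagon_left:
  assumes b: "b \<in> gr B i" and b': "b' \<in> gr B j" and a: "a \<in> gr A k" and ijk: "i + j + k = n" "0 < i"
  shows "\<epsilon> (tBA (mul B b b') a) = tmul \<epsilon> (tB b) (\<tau> (tBA b' a))"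
proof -
  note c = gr_carr(2)[OF b] gr_carr(2)[OF b'] gr_carr(1)[OF a]
  note t = glinD(2)[OF \<tau> tens_gr'(2)[OF a b']]
  have tc: "\<tau> (tBA b' a) \<in> carr C" using t by (rule gr_carr)
  have "sB (mul B b b') \<star> sA a \<approx> sB b \<star> sB b' \<star> sA a"
    by (rule Q.cong_mul[OF sB(5)[OF _ b b'] Q.cong_refl]) (use ijk c in simp_all)
  also have "sB b \<star> sB b' \<star> sA a = sB b \<star> (sB b' \<star> sA a)" using c by (simp add: Q.mul_T_assoc)
  also have "\<dots> \<approx> sB b \<star> \<sigma> (\<tau> (tBA b' a))"
    by (rule Q.cong_mul[OF Q.cong_refl])
        (use \<Delta>_I[OF a b'] ijk c tc in \<open>simp_all add: \<Delta>_tens Q.cong_def\<close>)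
  finally have "sB (mul B b b') \<star> sA a - \<sigma> (\<tau> (tBA (mul B b b') a)) \<approx>
      sB b \<star> \<sigma> (\<tau> (tBA b' a)) - \<sigma> (tmul \<tau> (tB b) (\<tau> (tBA b' a)))"
    unfolding hexagonsD(1)[OF \<tau>_hexagons ijk(1) b b' a] by (rule Q.cong_diff[OF _ Q.cong_refl])
  from lam_cong[OF this] have "lam (\<Delta> (tBA (mul B b b') a)) =
      lam (sB b \<star> \<sigma> (\<tau> (tBA b' a)) - \<sigma> (tmul \<tau> (tB b) (\<tau> (tBA b' a))))"
    using c by (simp add: \<Delta>_tens)
  then show ?thesis
    using lam_defect_left[OF b t] \<epsilon>_gr[OF tens_gr'(2)[OF a mul_gr(2)[OF b b']]] ijk by simp
qed

text \<open>The first-order part of the second hexagon: here \<open>k\<close> positive puts b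
  \<otimes> a below degree \<open>n\<close>, and the defect left over is that of a' on the
  right.\<close>

lemma \<epsilon>_hexagon_right:
  assumes b: "b \<in> gr B i" and a: "a \<in> gr A j" and a': "a' \<in> gr A k" and ijk: "i + j + k = n" "0 < k"
  shows "\<epsilon> (tBA b (mul A a a')) = tmul \<epsilon> (\<tau> (tBA b a)) (tA a')"
proof -
  note c = gr_carr(2)[OF b] gr_carr(1)[OF a'] gr_carr(1)[OF a]
  note t = glinD(2)[OF \<tau> tens_gr'(2)[OF a b]]
  have tc: "\<tau> (tBA b a) \<in> carr C" using t by (rule gr_carr)
  have "sB b \<star> sA (mul A a a') \<approx> sB b \<star> (sA a \<star> sA a')"
    by (rule Q.cong_mul[OF Q.cong_refl sA(5)[OF _ a a']]) (use ijk c in simp_all)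
  also have "sB b \<star> (sA a \<star> sA a') = sB b \<star> sA a \<star> sA a'" using c by (simp add: Q.mul_T_assoc)
  also have "\<dots> \<approx> \<sigma> (\<tau> (tBA b a)) \<star> sA a'"
    by (rule Q.cong_mul[OF _ Q.cong_refl])
        (use \<Delta>_I[OF a b] ijk c tc in \<open>simp_all add: \<Delta>_tens Q.cong_def\<close>)
  finally have "sB b \<star> sA (mul A a a') - \<sigma> (\<tau> (tBA b (mul A a a'))) \<approx>
      \<sigma> (\<tau> (tBA b a)) \<star> sA a' - \<sigma> (tmul \<tau> (\<tau> (tBA b a)) (tA a'))"
    unfolding hexagonsD(2)[OF \<tau>_hexagons ijk(1) b a a'] by (rule Q.cong_diff[OF _ Q.cong_refl])
  from lam_cong[OF this] have "lam (\<Delta> (tBA b (mul A a a'))) =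
      lam (\<sigma> (\<tau> (tBA b a)) \<star> sA a' - \<sigma> (tmul \<tau> (\<tau> (tBA b a)) (tA a')))"
    using c by (simp add: \<Delta>_tens)
  then show ?thesis
    using lam_defect_right[OF a' t] \<epsilon>_gr[OF tens_gr'(2)[OF mul_gr(1)[OF a a'] b]] ijk by simp
qed

lemma \<tau>'_unital: "i \<le> n \<Longrightarrow> unital i \<tau>'"
proof (cases "i = n")
  case True
  have "\<epsilon> (tBA (one B) a) = 0" if a: "a \<in> gr A n" for a
    using \<epsilon>_gr[OF tens_gr'(2)[OF a one_in(4)]] lam_\<Delta>_unital(1)[OF a] by (simp add: fun_scale_0)
  moreover have "\<epsilon> (tBA b (one A)) = 0" if b: "b \<in> gr B n" for b
    using \<epsilon>_gr[OF tens_gr'(2)[OF one_in(3) b]] lam_\<Delta>_unital(2)[OF b] by (simp add: fun_scale_0)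
  ultimately show ?thesis
    using unitalD[OF \<tau>_unital, of _ n] by (simp add: unital_def \<tau>'_def True)
next
  case False
  assume "i \<le> n"
  with False have "i < n" by simp
  then show ?thesis by (intro unital_cong[OF _ \<tau>_unital] \<tau>'_low[symmetric])
qed

lemma \<tau>'_hexagons: "hexagons n \<tau>'"
  unfolding hexagons_def
proof (intro allI impI conjI ballI)
  fix i j k assume ijk: "i + j + k = n"
  fix b assume b: "b \<in> gr B i"
  note cb = gr_carr(2)[OF b]
  {
    fix b' a assume b': "b' \<in> gr B j" and a: "a \<in> gr A k"
    note cb' = gr_carr(2)[OF b'] and ca = gr_carr(1)[OF a]
    note ba = tens_gr'(2)[OF a b']
    show "\<tau>' (tBA (mul B b b') a) = tmul \<tau>' (tB b) (\<tau>' (tBA b' a))"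
    proof (cases "i = 0")
      \<comment> \<open>With a scalar b the hexagon reduces to the unit law of \<tau>', where
        \<epsilon> occurs on both sides.\<close>
      case True
      then obtain d where d: "b = smul B d (one B)" using graded_algebraD(7)[OF B] b by auto
      have "mul B b b' = smul B d b'" using mul_lin(3)[OF cb'] cb' by (simp add: d linear_on_def)
      then have "\<tau>' (tBA (mul B b b') a) = fun_scale d (\<tau>' (tBA b' a))"
        using glinD(1)[OF \<tau>'] cb' ca by (simp add: tens_scale_left linear_on_def)
      also have "\<dots> = fun_scale d (tmul \<tau>' (tB (one B)) (\<tau>' (tBA b' a)))"
        using tmul_left_unit[OF \<tau>' \<tau>'_unital glinD(2)[OF \<tau>' ba] _ one_in(1)] ijk True
          act_one[OF gr_carr(3)[OF glinD(2)[OF \<tau>' ba]]] by simp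
      also have "\<dots> = tmul \<tau>' (tB b) (\<tau>' (tBA b' a))"
        using tmul_lin(1)[OF \<tau>' gr_carr(3)[OF glinD(2)[OF \<tau>' ba]]] by
            (simp add: d tens_scale_right linear_on_def)
      finally show ?thesis .
    next
      case False
      \<comment> \<open>The inner value lies below degree \<open>n\<close> and is not changed by
        \<epsilon>, so the hexagon of \<tau>' is the sum of the hexagon of \<tau> and the linear
        condition on \<epsilon>.\<close>
      have t: "\<tau>' (tBA b' a) = \<tau> (tBA b' a)" by (rule \<tau>'_low[OF _ ba]) (use False ijk in simp)
      show ?thesis
        unfolding t tmul_\<tau>'[OF tens_gr'(1)[OF one_in(3) b] glinD(2)[OF \<tau> ba]]
        using \<epsilon>_hexagon_left[OF b b' a ijk] False hexagonsD(1)[OF \<tau>_hexagons ijk b b' a] by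
            (simp add: \<tau>'_def)
    qed
  }
  {
    fix a a' assume a: "a \<in> gr A j" and a': "a' \<in> gr A k"
    note ca = gr_carr(1)[OF a] and ca' = gr_carr(1)[OF a']
    note ba = tens_gr'(2)[OF a b]
    show "\<tau>' (tBA b (mul A a a')) = tmul \<tau>' (\<tau>' (tBA b a)) (tA a')"
    proof (cases "k = 0")
      case True
      then obtain d where d: "a' = smul A d (one A)" using graded_algebraD(7)[OF A] a' by auto
      have "mul A a a' = smul A d a" using mul_lin(2)[OF ca] ca by (simp add: d linear_on_def)
      then have "\<tau>' (tBA b (mul A a a')) = fun_scale d (\<tau>' (tBA b a))"
        using glinD(1)[OF \<tau>'] cb ca by (simp add: tens_scale_right linear_on_def)
      also have "\<dots> = fun_scale d (tmul \<tau>' (\<tau>' (tBA b a)) (tA (one A)))"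
        using tmul_right_unit[OF \<tau>' \<tau>'_unital glinD(2)[OF \<tau>' ba] _ one_in(2)] ijk True
          act_one[OF gr_carr(3)[OF glinD(2)[OF \<tau>' ba]]] by simp
      also have "\<dots> = tmul \<tau>' (\<tau>' (tBA b a)) (tA a')"
        using tmul_lin(2)[OF \<tau>' gr_carr(3)[OF glinD(2)[OF \<tau>' ba]]] by
            (simp add: d tens_scale_left linear_on_def)
      finally show ?thesis .
    next
      case False
      have t: "\<tau>' (tBA b a) = \<tau> (tBA b a)" by (rule \<tau>'_low[OF _ ba]) (use False ijk in simp)
      show ?thesis
        unfolding t tmul_\<tau>'[OF glinD(2)[OF \<tau> ba] tens_gr'(1)[OF a' one_in(4)]]
        using \<epsilon>_hexagon_right[OF b a a' ijk] False hexagonsD(2)[OF \<tau>_hexagons ijk b a a'] by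
            (simp add: \<tau>'_def)
    qed
  }
qed

lemma \<epsilon>_zero:
  assumes x: "x \<in> gr D n" shows "fun_scale (lam (\<Delta> x)) e = 0"
proof -
  have "graded_twisting_to A B n \<tau>'"
    unfolding graded_twisting_to_iff[OF \<tau>']
  proof (intro allI impI conjI)
    fix i assume i: "i \<le> n"
    show "unital i \<tau>'" by (rule \<tau>'_unital[OF i])
    show "hexagons i \<tau>'"
    proof (cases "i = n")
      case False
      show ?thesis by (rule hexagons_cong[OF \<tau> \<tau>' \<tau>'_low[symmetric] \<tau>_hexagons])
          (use False i in auto)
    qed (use \<tau>'_hexagons in simp)
  qed
  then have "\<tau>' x = \<tau> x"
    using ue n \<tau>' \<tau>'_low x unfolding unique_extension_def by blast
  then show ?thesis using \<epsilon>_gr[OF x] by (simp add: \<tau>'_def)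
qed

end

section \<open>Consequence of uniqueness: the functional vanishes on the kernel\<close>

lemma lam_\<Delta>_zero:
  assumes a: "a \<in> gr A i" and b: "b \<in> gr B j" and ij: "i + j = n"
  shows "lam (\<Delta> (tBA b a)) = 0"
proof (cases "tAB a b = 0")
  case True
  have "\<Delta> 0 = 0" by (rule linear_on_0[OF vs(3) vector_space_fun_scale sub(2) \<Delta>_lin])
  then show ?thesis by (simp add: tens_swap_eq_0[OF True] lam.zero)
next
  case False
  interpret FC: vector_space "fun_scale :: 'k \<Rightarrow> (('a \<Rightarrow> 'b \<Rightarrow> 'k) \<Rightarrow> 'k) \<Rightarrow> _" by (rule vs)
  \<comment> \<open>The element a \<otimes> b itself serves as multiplier \<open>e\<close>: it has
    degree \<open>n\<close> and is nonzero in this case, so the scalar in front of it must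
    vanish.\<close>
  have "fun_scale (lam (\<Delta> (tBA b a))) (tAB a b) = 0"
    by (rule \<epsilon>_zero[OF tens_gr[OF a b ij] tens_gr[OF b a]]) (use ij in simp)
  then show ?thesis using False by (metis FC.scale_eq_0_iff)
qed

text \<open>Under \<open>lam\<close>, a letter in front of an ordered lift is absorbed into the
  ordered lift of the product. For a letter of A this holds already modulo \<open>Q.I\<close>; for a
  letter of B it is the vanishing of the defects, obtained from uniqueness.\<close>

lemma lam_letter:
  assumes x: "x \<in> gr C 1" and c: "c \<in> gr C (n - 1)"
  shows "lam (Q.w [x] \<star> \<sigma> c) = lam (\<sigma> (tmul \<tau> x c))"
proof -
  interpret FC: vector_space "fun_scale :: 'k \<Rightarrow> (('a \<Rightarrow> 'b \<Rightarrow> 'k) \<Rightarrow> 'k) \<Rightarrow> _" by (rule vs)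
  note cc = gr_carr(3)[OF c]
  have e1: "gr E 1 = gr C 1" by (simp add: E_simps)
  define f where "f x = lam (Q.w [x] \<star> \<sigma> c) - lam (\<sigma> (tmul \<tau> x c))" for x
  have l1: "linear_on fun_scale (gr C 1) (*) (\<lambda>x. lam (Q.w [x] \<star> \<sigma> c))"
  proof (rule linear_on_comp[OF _ UNIV_I lam_lin], rule linear_on_comp[OF _ UNIV_I Q.mul_T_lin1])
    show "linear_on fun_scale (gr C 1) fun_scale (\<lambda>x. Q.w [x])"
      using Q.letter_lin by (simp add: E_simps(1,2))
  qed
  have l2: "linear_on fun_scale (gr C 1) (*) (\<lambda>x. lam (\<sigma> (tmul \<tau> x c)))"
    by (rule linear_on_comp[OF linear_on_comp[OF linear_on_mono[OF tmul_lin(1)[OF \<tau> cc]] _ \<sigma>_lin]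
        _ lam_lin[of UNIV]])
      (use gr_carr cc tmul_in[OF \<tau>] in auto)
  have l: "linear_on fun_scale (gr C 1) (*) f"
    using linear_on_minus[OF Q.vs_K l1 l2] by (simp add: f_def[abs_def])
  let ?Z = "{x \<in> gr C 1. f x = 0}"
  have Z: "FC.subspace ?Z"
    unfolding FC.subspace_def
  proof (intro conjI ballI allI)
    show "0 \<in> ?Z" using FC.subspace_0[OF sub(3)] linear_on_0[OF vs(3) Q.vs_K sub(3) l] by simp
    show "y + z \<in> ?Z" if "y \<in> ?Z" "z \<in> ?Z" for y z
      using that FC.subspace_add[OF sub(3)] l unfolding linear_on_def by auto
    show "fun_scale d y \<in> ?Z" if "y \<in> ?Z" for d y
      using that FC.subspace_scale[OF sub(3)] l unfolding linear_on_def by auto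
  qed
  have A1: "tA v \<in> ?Z" if v: "v \<in> gr A 1" for v
  proof -
    note cv = gr_carr(1)[OF v]
    have "Q.w [tA v] \<star> \<sigma> c \<approx> sA v \<star> \<sigma> c"
      by (rule Q.cong_mul[OF Q.cong_sym[OF sA(7)[OF v]] Q.cong_refl])
          (use cv cc hA.hom_gr[OF v] in simp_all)
    also have "\<dots> \<approx> \<sigma> (act v (one B) c)"
      by (rule Q.cong_sym[OF \<sigma>_act_left[OF v c]]) (use n in simp)
    finally have *: "Q.w [tA v] \<star> \<sigma> c \<approx> \<sigma> (act v (one B) c)" .
    have "act v (one B) c = tmul \<tau> (tA v) c"
      by (rule tmul_left_unit[OF \<tau> \<tau>_unital c le_refl cv, symmetric])
    then show ?thesis using lam_cong[OF *] hA.hom_gr[OF v] by (simp add: E_simps f_def)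
  qed
  have B1: "tB u \<in> ?Z" if u: "u \<in> gr B 1" for u
  proof -
    note cu = gr_carr(2)[OF u]
    have "Q.w [tB u] \<star> \<sigma> c \<approx> sB u \<star> \<sigma> c"
      by (rule Q.cong_mul[OF Q.cong_sym[OF sB(7)[OF u]] Q.cong_refl])
          (use cu cc hB.hom_gr[OF u] in simp_all)
    \<comment> \<open>Commuting u past v leaves \<Delta>(u \<otimes> v) times the lift of w. For w
      of positive degree this is killed by degree, for scalar w by
      \<open>lam_\<Delta>_zero\<close>.\<close>
    moreover have "lam (sB u \<star> \<sigma> c - \<sigma> (tmul \<tau> (tB u) c)) = 0"
    proof (rule tprod_eqI[OF gs(1,2) Q.vs_K _ linear_on_zero_map[OF Q.vs_K] _ c])
      show "linear_on fun_scale (carr C) (*) (\<lambda>c. lam (sB u \<star> \<sigma> c - \<sigma> (tmul \<tau> (tB u) c)))"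
        by (rule linear_on_comp[OF linear_on_minus[OF vector_space_fun_scale
           linear_on_comp[OF \<sigma>_lin \<sigma>_in Q.mul_T_lin2] linear_on_comp[OF tmul_lin(2)[OF \<tau>]
               tmul_in[OF \<tau>] \<sigma>_lin]] _ lam_lin[of UNIV]])
          (use cu in simp_all)
      fix v w k l assume v: "v \<in> gr A k" and w: "w \<in> gr B l" and kl: "k + l = n - 1"
      have s: "1 + k + l = n" using kl n by simp
      have "lam (sB u \<star> \<sigma> (tAB v w) - \<sigma> (tmul \<tau> (tB u) (tAB v w))) = lam (\<Delta> (tBA u v) \<star> sB w)"
        by (rule lam_cong[OF defect_left[OF u v w]]) (use s in simp)
      also have "\<dots> = 0"
      proof (cases "l = 0")
        case True
        then obtain d where "w = smul B d (one B)" using graded_algebraD(7)[OF B] w by auto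
        then show ?thesis using lam_\<Delta>_right(2)[OF u v w s] lam_\<Delta>_zero[OF v u] s True by simp
      qed (use lam_\<Delta>_right(1)[OF u v w s] in simp)
      finally show "lam (sB u \<star> \<sigma> (tAB v w) - \<sigma> (tmul \<tau> (tB u) (tAB v w))) = 0" .
    qed
    ultimately show ?thesis using lam_cong hB.hom_gr[OF u] by (simp add: E_simps lam.diff f_def)
  qed
  have "x \<in> ?Z"
  proof (rule tprod_subspaceI[OF gs(1,2) vs(3) linear_on_id Z _ x])
    fix v u k l assume v: "v \<in> gr A k" and u: "u \<in> gr B l" and kl: "k + l = 1"
    note cv = gr_carr(1)[OF v] and cu = gr_carr(2)[OF u]
    consider "k = 0" "l = 1" | "k = 1" "l = 0" using kl by linarith
    then show "tAB v u \<in> ?Z"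
    proof cases
      case 1
      then obtain d where d: "v = smul A d (one A)" using graded_algebraD(7)[OF A] v by auto
      have e: "tAB v u = fun_scale d (tB u)" using cu by (simp add: d tens_scale_left)
      show ?thesis unfolding e by (rule FC.subspace_scale[OF Z B1]) (use u 1 in simp)
    next
      case 2
      then obtain d where d: "u = smul B d (one B)" using graded_algebraD(7)[OF B] u by auto
      have e: "tAB v u = fun_scale d (tA v)" using cv by (simp add: d tens_scale_right)
      show ?thesis unfolding e by (rule FC.subspace_scale[OF Z A1]) (use v 2 in simp)
    qed
  qed
  then show ?thesis by (simp add: f_def)
qed

text \<open>On degree \<open>n\<close>, \<open>lam\<close> factors through the canonical map: the
  tail of a word has degree n - 1 and may be ordered modulo \<open>Q.I\<close>, and the first letter
  is then absorbed by \<open>lam_letter\<close>. A functional of \<open>\<pi> y\<close> vanishes on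
  the kernel.\<close>

lemma lam_kernel:
  assumes y: "y \<in> Q.K" "y \<in> gr Q.T n" shows "lam y = 0"
proof -
  have "lam y = lam (\<sigma> (Q.\<pi> y))"
  proof (rule Q.T_gr_eqI[OF Q.vs_K lam_lin linear_on_comp[OF linear_on_comp[OF E_lin_pi \<pi>_in(1)
      \<sigma>_lin] _ lam_lin[of UNIV]] _ y(2)])
    fix xs assume xs: "xs \<in> lists (gr E 1)" "length xs = n"
    then obtain z zs where z: "xs = z # zs" using n by (cases xs) auto
    have z1: "z \<in> gr E 1" "zs \<in> lists (gr E 1)" "length zs = n - 1" using xs z by auto
    have wz: "Q.w zs \<in> gr Q.T (n - 1)" using Q.word_gr[OF z1(2)] z1(3) by simp
    let ?c = "Q.\<pi> (Q.w zs)"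
    have c: "?c \<in> gr C (n - 1)" by (rule \<pi>_in(2)[OF wz])
    have e: "Q.w xs = Q.w [z] \<star> Q.w zs" using z1 by (simp add: Q.mul_word_word z)
    have "lam (Q.w xs) = lam (Q.w [z] \<star> \<sigma> ?c)"
      unfolding e by (rule lam_cong, rule Q.cong_mul[OF Q.cong_refl low_section[OF wz]])
        (use n z1 c gr_carr(3)[OF c] in simp_all)
    also have "\<dots> = lam (\<sigma> (tmul \<tau> z ?c))" by (rule lam_letter[OF _ c])
        (use z1 in \<open>simp add: E_simps\<close>)
    also have "tmul \<tau> z ?c = Q.\<pi> (Q.w xs)"
      unfolding e using z1 by (simp add: Q.\<pi>_mul Q.\<pi>_letter E_simps(3))
    finally show "lam (Q.w xs) = lam (\<sigma> (Q.\<pi> (Q.w xs)))" .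
  qed (assumption, rule UNIV_I)
  also have "\<dots> = 0"
    using y(1) linear_on_0[OF vs(3) vector_space_fun_scale sub(1) \<sigma>_lin] by
        (simp add: tcanon_kernel_def lam.zero)
  finally show ?thesis .
qed

end

text \<open>The kernel is graded, so it suffices to compare it with \<open>Q.I\<close> degree by
  degree, by strong induction. Above degree 2, an element outside \<open>Q.I\<close> would give a
  functional contradicting \<open>lam_kernel\<close>.\<close>

lemma (in twisted_algebra) quadratic_if_unique_extension:
  assumes ue: "unique_extension A B \<tau>" shows "quadratic E"
proof -
  \<comment> \<open>Quadratic algebras have a nonzero unit, and a tensor product of nonzero elements
    is nonzero. Degree 0 of the induction depends on this.\<close>
  have one: "one E \<noteq> 0"
    unfolding E_simps
        by (rule tens_neq_0[OF gs(1,2) hA.dom.quadratic_one_neq_0[OF qA]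
        hB.dom.quadratic_one_neq_0[OF qB]])
  define P where "P n \<longleftrightarrow> (\<forall>y\<in>Q.K. y \<in> gr Q.T n \<longrightarrow> y \<in> Q.I)" for n
  have main: "P n" for n
  proof (induction n rule: less_induct)
    case (less n)
    have "y \<in> Q.I" if y': "y \<in> Q.K" "y \<in> gr Q.T n" for y
    proof (cases "n \<le> 2")
      case True
      then show ?thesis using Q.kernel_low[OF one] y' by blast
    next
      case False
      obtain sA where sA: "linear_on (smul A) (carr A) fun_scale sA" "\<And>a. a \<in> carr A \<Longrightarrow>
          sA a \<in> carr Q.T"
        "\<And>i a. i \<le> n \<Longrightarrow> a \<in> gr A i \<Longrightarrow> sA a \<in> gr Q.T i"
        "\<And>i a. i \<le> n \<Longrightarrow> a \<in> gr A i \<Longrightarrow> Q.\<pi> (sA a) = tAB a (one B)"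
        "\<And>i j a b. i + j \<le> n \<Longrightarrow> a \<in> gr A i \<Longrightarrow> b \<in> gr A j \<Longrightarrow> sA (mul A a b) - mul Q.T (sA a) (sA b) \<in>
            Q.I"
        "sA (one A) - one Q.T \<in> Q.I"
        "\<And>a. 1 \<le> n \<Longrightarrow> a \<in> gr A 1 \<Longrightarrow> sA a - Q.w [tAB a (one B)] \<in> Q.I"
        by (rule hA.hom_section_upto[OF qA, of n]) blast
      obtain sB where sB: "linear_on (smul B) (carr B) fun_scale sB" "\<And>a. a \<in> carr B \<Longrightarrow>
          sB a \<in> carr Q.T"
        "\<And>i a. i \<le> n \<Longrightarrow> a \<in> gr B i \<Longrightarrow> sB a \<in> gr Q.T i"
        "\<And>i a. i \<le> n \<Longrightarrow> a \<in> gr B i \<Longrightarrow> Q.\<pi> (sB a) = tAB (one A) a"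
        "\<And>i j a b. i + j \<le> n \<Longrightarrow> a \<in> gr B i \<Longrightarrow> b \<in> gr B j \<Longrightarrow> sB (mul B a b) - mul Q.T (sB a) (sB b) \<in>
            Q.I"
        "sB (one B) - one Q.T \<in> Q.I"
        "\<And>a. 1 \<le> n \<Longrightarrow> a \<in> gr B 1 \<Longrightarrow> sB a - Q.w [tAB (one A) a] \<in> Q.I"
        by (rule hB.hom_section_upto[OF qB, of n]) blast
      show ?thesis
      proof (rule ccontr)
        assume y: "y \<notin> Q.I"
        \<comment> \<open>The functional separates \<open>y\<close> from \<open>Q.I\<close>: it is 1
          at \<open>y\<close>, whereas \<open>lam_kernel\<close> will give 0.\<close>
        obtain lam where lm: "Vector_Spaces.linear fun_scale (*) lam" "lam y = 1" "\<forall>x\<in>Q.I. lam x =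
            0"
          using exists_functional[OF vector_space_fun_scale Q.ID(1) y] by blast
        interpret relation_test A B \<tau> n sA sB lam
        proof (rule relation_test.intro[OF twisted_algebra_axioms relation_test_axioms.intro])
          show "3 \<le> n" using False by simp
          show "y \<in> Q.I" if "i < n" "y \<in> Q.K" "y \<in> gr Q.T i" for i y
            using less.IH[OF that(1)] that(2,3) by (simp add: P_def)
          show "lam x = 0" if "x \<in> Q.I" for x using lm(3) that by blast
          show "Q.cong (sA a) (Q.w [tAB a (one B)])" if "a \<in> gr A 1" for a
            using sA(7)[OF _ that] False by (simp add: Q.cong_def)
          show "Q.cong (sB a) (Q.w [tAB (one A) a])" if "a \<in> gr B 1" for a
            using sB(7)[OF _ that] False by (simp add: Q.cong_def)
        qed (rule lm(1) ue sA(1-6)[folded Q.cong_def] sB(1-6)[folded Q.cong_def]; assumption?)+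
        show False using lam_kernel[OF y'] lm(2) by simp
      qed
    qed
    then show ?case by (simp add: P_def)
  qed
  then show ?thesis
    unfolding quadratic_E_iff using Q.kernel_decomp[OF _ Q.ID(1)] main[unfolded P_def] by blast
qed

theorem theorem1p2:
  fixes A :: "('k::field, 'a::ab_group_add) galgebra"
    and B :: "('k, 'b::ab_group_add) galgebra"
    and \<tau> :: "(('b \<Rightarrow> 'a \<Rightarrow> 'k) \<Rightarrow> 'k) \<Rightarrow> ('a \<Rightarrow> 'b \<Rightarrow> 'k) \<Rightarrow> 'k"
  assumes "quadratic A" and "quadratic B"
    and "graded_twisting A B \<tau>"
  shows "unique_extension A B \<tau> \<longleftrightarrow> quadratic (twisted_tensor A B \<tau>)"
proof -
  interpret twisted_algebra A B \<tau>
    by unfold_locales (use assms in \<open>auto simp: quadratic_def one_generated_def\<close>)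
  show ?thesis
    using unique_extension_if_quadratic quadratic_if_unique_extension unfolding E_def by blast
qed

end
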